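(* Let $\alpha\in(0,1)$ be a fixed constant, and for each $n$ let $m,s,t$ be integers with $m/n=t/s=\alpha$ and $t\ge 3$. Let $A$ be drawn uniformly at random from $\mathcal{M}_{m,n,s,t}$. Then, with high probability, the set $\sigma(A)$ of singular values of $A$ satisfies $$\sigma(A)\subseteq\left[\sqrt{s-1}-(1+o(1))\sqrt{t-1},\ \sqrt{s-1}+(1+o(1))\sqrt{t-1}\right].$$ (No upper bound on $s$ as a function of $n$ is required.)
   Context: $\mathcal{M}_{m,n,s,t}$ denotes the set of matrices in $\{0,1,-1\}^{m\times n}$ in which every row has exactly $s$ nonzero entries and every column has exactly $t$ nonzero entries. "With high probability" means with probability tending to $1$ as $n\to\infty$; $o(1)$ refers to $n\to\infty$ with $\alpha$ constant. *)

theory Defs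
  imports Complex_Main "Jordan_Normal_Form.Char_Poly"
begin

definition signed_biregular :: "nat \<Rightarrow> nat \<Rightarrow> nat \<Rightarrow> nat \<Rightarrow> real mat set" where
  "signed_biregular m n s t =
     {A \<in> carrier_mat m n.
        (\<forall>i<m. \<forall>j<n. A $$ (i, j) \<in> {0, 1, -1}) \<and>
        (\<forall>i<m. card {j. j < n \<and> A $$ (i, j) \<noteq> 0} = s) \<and>
        (\<forall>j<n. card {i. i < m \<and> A $$ (i, j) \<noteq> 0} = t)}"

text \<open>Singular values of a real m x n matrix: the square roots of the eigenvalues of
  A A^T (if m \<le> n) resp. A^T A (if n < m), i.e. the min(m,n) singular values.\<close>
definition singular_values :: "real mat \<Rightarrow> real set" where
  "singular_values A =
     (if dim_row A \<le> dim_col A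
      then sqrt ` {k. eigenvalue (A * transpose_mat A) k}
      else sqrt ` {k. eigenvalue (transpose_mat A * A) k})"

end

theory Submission
  imports Defs "HOL-Real_Asymp.Real_Asymp"
begin

text \<open>
  Let \<open>q = s - 1\<close>, \<open>r = t - 1\<close>. The signed sums over non-backtracking walks of length \<open>2k\<close> between
  rows form a matrix that is a Chebyshev-like polynomial in \<open>A A\<^sup>T\<close>. At an eigenvalue \<open>K\<close> with
  \<open>\<bar>K - q - r\<bar> \<ge> (\<rho> + 1/\<rho>) sqrt (q r)\<close>, \<open>\<rho> > 1\<close>, this polynomial has size at least
  \<open>(q r)^(k/2) \<rho>^k\<close> up to a constant, so the squared Frobenius norm is at least \<open>(q r)^k \<rho>^(2k)\<close> there.
  Averaging the Frobenius norm over the signs leaves only those closed walks of length \<open>4k\<close>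
  (non-backtracking except at the two ends) that traverse no edge exactly once.

  Such walks are counted by an encoding. A step is fresh if it reaches a new vertex; any other step is
  either predicted, by repeating what the walk did after the latest traversal of its current edge, or
  annotated explicitly at a cost polynomial in \<open>k\<close>. Fresh steps contribute \<open>sqrt (q r)\<close> on average
  and there are at most \<open>2k\<close> of them, so it remains to bound the number of annotations.
  If \<open>s\<close> exceeds a large power of \<open>ln n\<close>, each annotation is paid for by a missing fresh step, and
  this works for every support. If \<open>s\<close> is at most polylogarithmic, a switching argument shows
  that with high probability all walks of length \<open>4k\<close> span few independent cycles and all shorter
  walks, of length about \<open>sqrt (ln n)\<close>, at most one. A non-backtracking walk spanning at most one cycle has the form
  path, repeated cycle, path, whence a bounded number of mispredictions per window away from the
  few vertices of degree at least three. Taking \<open>k\<close> a large multiple of \<open>ln n\<close> and applying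
  Markov's inequality excludes outlying eigenvalues.
\<close>

section \<open>Walks and their step types\<close>

text \<open>The factor m \<le> n from the starting row must be beaten by \<rho>^(2k), which forces k
  to be of order ln n; after that only losses of the form exp (o(ln n)) are affordable. An
  annotation costs a power of k, so o(ln n / ln ln n) of them come for free, which is less than one
  per step. For large s the way out is that a cycle of the trace, or a surplus traversal of its
  edges, displaces fresh steps, each worth sqrt (q r), which is of order s. For small s a fresh step
  may be worth only a constant, and the number of annotations itself must be small. A bound on the
  number of cycles alone does not achieve this: a walk can circle in a trace with two cycles and
  choose anew each time. Short windows cure this, since with a single cycle there is nothing to
  choose except when to leave it. They must be shorter than ln n / ln ln n for the union bound with
  one permitted cycle, yet few; about sqrt (ln n) windows with (ln n)^(1/4) cycles overall give
  annotations of order (ln n)^(3/4).\<close>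

definition step_edge :: "(nat \<Rightarrow> 'v) \<Rightarrow> nat \<Rightarrow> 'v set" where
  "step_edge x i = {x i, x (Suc i)}"

definition fresh :: "(nat \<Rightarrow> 'v) \<Rightarrow> nat \<Rightarrow> bool" where
  "fresh x i \<longleftrightarrow> x (Suc i) \<notin> x ` {..i}"

definition new_edge :: "(nat \<Rightarrow> 'v) \<Rightarrow> nat \<Rightarrow> bool" where
  "new_edge x i \<longleftrightarrow> step_edge x i \<notin> step_edge x ` {..<i}"

text \<open>A step that closes a cycle of the trace; such steps count its independent cycles, see
  \<open>card_boundary_step\<close>.\<close>

definition boundary_step :: "(nat \<Rightarrow> 'v) \<Rightarrow> nat \<Rightarrow> bool" where
  "boundary_step x i \<longleftrightarrow> new_edge x i \<and> \<not> fresh x i"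

definition last_traversal :: "(nat \<Rightarrow> 'v) \<Rightarrow> nat \<Rightarrow> nat \<Rightarrow> bool" where
  "last_traversal x j a \<longleftrightarrow> a < j \<and> step_edge x a = step_edge x j \<and> (\<forall>b. a < b \<and> b < j \<longrightarrow> step_edge x b \<noteq> step_edge x j)"

text \<open>The vertex after step \<open>j\<close> is predicted from the latest earlier traversal \<open>a\<close> of the edge of
  step \<open>j\<close>: continue as after \<open>a\<close> if the directions agree, and undo the step before \<open>a\<close> otherwise.\<close>
definition predicted :: "(nat \<Rightarrow> 'v) \<Rightarrow> nat \<Rightarrow> bool" where
  "predicted x j \<longleftrightarrow> (\<exists>a. last_traversal x j a \<and>
     (if x a = x j then x (j+2) = x (a+2) else 0 < a \<and> x (j+2) = x (a-1)))"

definition annotated :: "(nat \<Rightarrow> 'v) \<Rightarrow> nat \<Rightarrow> bool" where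
  "annotated x i \<longleftrightarrow> \<not> fresh x i \<and> \<not> (\<exists>j. i = Suc j \<and> predicted x j)"

text \<open>Time \<open>h\<close> is the joint of two non-backtracking halves. With
  \<open>h = 0\<close> nothing is exempted, which gives plain non-backtracking walks.\<close>

definition nbwalk :: "nat \<Rightarrow> nat \<Rightarrow> (nat \<Rightarrow> 'v) \<Rightarrow> bool" where
  "nbwalk h L x \<longleftrightarrow> (\<forall>i<L. x i \<noteq> x (Suc i)) \<and> (\<forall>i. Suc i < L \<and> Suc i \<noteq> h \<longrightarrow> x i \<noteq> x (i+2))"

text \<open>The excluded values of \<open>a\<close> are those at which the walk may backtrack, so that the predicted
  edge need not differ from the current one.\<close>
definition mispredicted :: "nat \<Rightarrow> nat \<Rightarrow> (nat \<Rightarrow> 'v) \<Rightarrow> nat \<Rightarrow> bool" where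
  "mispredicted h L x j \<longleftrightarrow> Suc j < L \<and> Suc j \<noteq> h \<and> \<not> new_edge x (Suc j) \<and> \<not> predicted x j \<and>
     (\<exists>a. last_traversal x j a \<and> a \<noteq> 0 \<and> a \<noteq> h \<and> Suc a \<noteq> h)"

lemma step_edge_eqD: "step_edge x a = step_edge x j \<Longrightarrow> (x a = x j \<and> x (Suc a) = x (Suc j)) \<or> (x a = x (Suc j) \<and> x (Suc a) = x j)"
  by (auto simp: step_edge_def doubleton_eq_iff)

lemma last_traversal_exists:
  assumes "\<not> new_edge x j" shows "\<exists>a. last_traversal x j a"
proof -
  define S where "S = {a. a < j \<and> step_edge x a = step_edge x j}"
  have S: "S \<noteq> {}" "finite S" using assms by (auto simp: new_edge_def image_iff S_def)
  have "Max S \<in> S" "\<And>b. b \<in> S \<Longrightarrow> b \<le> Max S" using S by auto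
  then have "last_traversal x j (Max S)" unfolding last_traversal_def S_def by fastforce
  then show ?thesis by blast
qed

lemma last_traversal_unique: "last_traversal x j a \<Longrightarrow> last_traversal x j b \<Longrightarrow> a = b"
  unfolding last_traversal_def by (metis linorder_neqE_nat)

text \<open>From \<open>a\<close> the time \<open>j\<close> is recovered as the next traversal of
  the same edge. So each \<open>a\<close> is consulted at most once, and a few exceptional values of
  \<open>a\<close> spoil at most as many predictions.\<close>

lemma last_traversal_inj: assumes "last_traversal x j a" "last_traversal x k a" shows "j = k"
proof (rule ccontr)
  assume "j \<noteq> k"
  moreover have "step_edge x j = step_edge x k" using assms by (auto simp: last_traversal_def)
  ultimately show False using assms unfolding last_traversal_def by (metis linorder_neqE_nat)
qed

lemma card_last_traversal_vimage:
  assumes "finite A" shows "finite {j. \<exists>a\<in>A. last_traversal x j a}" "card {j. \<exists>a\<in>A. last_traversal x j a} \<le> card A"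
proof -
  let ?f = "\<lambda>j. SOME a. a \<in> A \<and> last_traversal x j a"
  have f: "?f j \<in> A \<and> last_traversal x j (?f j)" if "\<exists>a\<in>A. last_traversal x j a" for j
    using someI_ex[of "\<lambda>a. a \<in> A \<and> last_traversal x j a"] that by blast
  have inj: "inj_on ?f {j. \<exists>a\<in>A. last_traversal x j a}"
  proof (rule inj_onI)
    fix j k assume "j \<in> {j. \<exists>a\<in>A. last_traversal x j a}" "k \<in> {j. \<exists>a\<in>A. last_traversal x j a}" and e: "?f j = ?f k"
    then have "last_traversal x j (?f j)" "last_traversal x k (?f k)" using f by blast+
    then show "j = k" using last_traversal_inj[of x j "?f k" k] e by simp
  qed
  have sub: "?f ` {j. \<exists>a\<in>A. last_traversal x j a} \<subseteq> A" using f by blast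
  show "finite {j. \<exists>a\<in>A. last_traversal x j a}" using finite_imageD[OF finite_subset[OF sub assms] inj] .
  show "card {j. \<exists>a\<in>A. last_traversal x j a} \<le> card A" using card_inj_on_le[OF inj sub assms] .
qed

lemma fresh_imp_new_edge: "fresh x i \<Longrightarrow> new_edge x i"
  unfolding fresh_def new_edge_def step_edge_def by (auto simp: doubleton_eq_iff)

lemma fresh_next_new:
  assumes "fresh x j" "x j \<noteq> x (j+2)" "x (Suc j) \<noteq> x (j+2)" shows "new_edge x (Suc j)"
proof (rule ccontr)
  assume "\<not> new_edge x (Suc j)"
  then obtain b where b: "b < Suc j" "step_edge x b = step_edge x (Suc j)" by (auto simp: new_edge_def image_iff)
  have "x (Suc j) \<in> step_edge x b" using b(2) by (simp add: step_edge_def)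
  then have "b = j" using b(1) assms(1) unfolding fresh_def step_edge_def
    by (auto simp: image_iff less_Suc_eq)
  then show False using b(2) assms by (auto simp: step_edge_def doubleton_eq_iff)
qed

text \<open>Every annotation gets a cause: a cycle-closing step (itself or the one before), the
  joint at \<open>h\<close>, one of the three traversal times whose prediction is missing or may
  backtrack, or a genuine misprediction. An old edge right after a fresh step is excluded by
  \<open>fresh_next_new\<close>.\<close>

lemma annotated_cases:
  assumes nb: "nbwalk h L x" and i: "i < L" "annotated x i"
  shows "boundary_step x i \<or> (\<exists>j<L. i = Suc j \<and> boundary_step x j) \<or> i = h \<or>
    (\<exists>j. i = Suc j \<and> (\<exists>a\<in>{0,h,h-1}. last_traversal x j a)) \<or> (\<exists>j. i = Suc j \<and> mispredicted h L x j)"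
proof (cases "new_edge x i \<or> i = h")
  case True
  then show ?thesis using i by (auto simp: boundary_step_def annotated_def)
next
  case False
  have "x 0 \<noteq> x (Suc 0)" if "0 < L" using nb that by (auto simp: nbwalk_def)
  then have "i \<noteq> 0" using i by (cases "i = 0") (auto simp: annotated_def fresh_def)
  then obtain j where j: "i = Suc j" by (cases i) auto
  show ?thesis
  proof (cases "new_edge x j")
    case True
    have "\<not> fresh x j"
      using fresh_next_new[of x j] False nb i(1) j unfolding nbwalk_def by auto
    then show ?thesis using True j i by (auto simp: boundary_step_def)
  next
    case nj: False
    obtain a where a: "last_traversal x j a" using last_traversal_exists[OF nj] by blast
    show ?thesis
    proof (cases "a \<in> {0,h,h-1}")
      case True then show ?thesis using a j by blast
    next
      case F: False
      have "mispredicted h L x j" unfolding mispredicted_def using a F i j False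
        by (auto simp: annotated_def)
      then show ?thesis using j by blast
    qed
  qed
qed

text \<open>Three edges meet: the one just used, the predicted one, and the one actually taken.\<close>
lemma mispredicted_branch:
  assumes nb: "nbwalk h L x" and m: "mispredicted h L x j"
  shows "3 \<le> card {e \<in> step_edge x ` {..<L}. x (Suc j) \<in> e}"
proof -
  obtain a where a: "last_traversal x j a" "a \<noteq> 0" "a \<noteq> h" "Suc a \<noteq> h" using m by (auto simp: mispredicted_def)
  have jL: "Suc j < L" "Suc j \<noteq> h" using m by (auto simp: mispredicted_def)
  have aj: "a < j" using a by (simp add: last_traversal_def)
  have np: "\<not> predicted x j" using m by (simp add: mispredicted_def)
  have ne: "\<And>i. i < L \<Longrightarrow> x i \<noteq> x (Suc i)" and nn: "\<And>i. Suc i < L \<Longrightarrow> Suc i \<noteq> h \<Longrightarrow> x i \<noteq> x (i+2)"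
    using nb by (auto simp: nbwalk_def)
  have n1: "x j \<noteq> x (j+2)" using nn jL by auto
  have "\<exists>b<L. \<exists>z. step_edge x b = {x (Suc j), z} \<and> z \<noteq> x j \<and> z \<noteq> x (j+2)"
  proof (cases "x a = x j")
    case True
    then have s: "x (Suc a) = x (Suc j)" using a(1) step_edge_eqD[of x a j] by (auto simp: last_traversal_def)
    have "x (a+2) \<noteq> x (j+2)" using np a(1) True by (auto simp: predicted_def)
    moreover have "x (a+2) \<noteq> x j" using nn[of a] a aj jL True by auto
    ultimately show ?thesis using s aj jL by (intro exI[of _ "Suc a"]) (auto simp: step_edge_def)
  next
    case False
    then have s: "x (Suc a) = x j" "x a = x (Suc j)" using a(1) step_edge_eqD[of x a j] by (auto simp: last_traversal_def)
    obtain b where b: "a = Suc b" using a(2) by (cases a) auto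
    have "x b \<noteq> x (j+2)" using np a(1) False b by (auto simp: predicted_def)
    moreover have "x b \<noteq> x j" using nn[of b] a aj jL b s by auto
    ultimately show ?thesis using s aj jL b by (intro exI[of _ b]) (auto simp: step_edge_def)
  qed
  then obtain b z where b: "b < L" "step_edge x b = {x (Suc j), z}" "z \<noteq> x j" "z \<noteq> x (j+2)" by blast
  have d: "step_edge x j = {x (Suc j), x j}" "step_edge x (Suc j) = {x (Suc j), x (j+2)}" by (auto simp: step_edge_def)
  have "card {step_edge x j, step_edge x (Suc j), step_edge x b} = 3"
    using b n1 d by (auto simp: doubleton_eq_iff card_insert_if)
  moreover have "{step_edge x j, step_edge x (Suc j), step_edge x b} \<subseteq> {e \<in> step_edge x ` {..<L}. x (Suc j) \<in> e}"
    using b jL d by auto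
  moreover have "finite {e \<in> step_edge x ` {..<L}. x (Suc j) \<in> e}" by simp
  ultimately show ?thesis using card_mono[of "{e \<in> step_edge x ` {..<L}. x (Suc j) \<in> e}"] by metis
qed

section \<open>Degree excess and independent cycles of a trace\<close>

lemma handshake:
  assumes "finite V" "finite Ed" "\<And>e. e \<in> Ed \<Longrightarrow> card e = 2 \<and> e \<subseteq> V"
  shows "(\<Sum>z\<in>V. card {e \<in> Ed. z \<in> e}) = 2 * card Ed"
proof -
  have "(\<Sum>z\<in>V. card {e \<in> Ed. z \<in> e}) = (\<Sum>z\<in>V. \<Sum>e\<in>Ed. if z \<in> e then 1 else 0)"
    using assms(2) by (intro sum.cong refl) (simp add: sum.If_cases Int_def conj_commute)
  also have "\<dots> = (\<Sum>e\<in>Ed. \<Sum>z\<in>V. if z \<in> e then 1 else 0)" by (rule sum.swap)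
  also have "\<dots> = (\<Sum>e\<in>Ed. 2)"
  proof (intro sum.cong refl)
    fix e assume "e \<in> Ed"
    then have "card e = 2" "V \<inter> e = e" using assms by auto
    then show "(\<Sum>z\<in>V. if z \<in> e then 1 else 0) = (2::nat)"
      using assms(1) by (simp add: sum.If_cases)
  qed
  finally show ?thesis by simp
qed

text \<open>The sum of d - 2 over all vertices is 2 |Ed| - 2 |V|. Only \<open>u1\<close> and
  \<open>u2\<close> can contribute negatively, by -1 each, and the summand 2 on the right absorbs
  this.\<close>

lemma branch_excess:
  assumes "finite V" "finite Ed" "\<And>e. e \<in> Ed \<Longrightarrow> card e = 2 \<and> e \<subseteq> V"
    and u: "u1 \<in> V" "u2 \<in> V"
    and d1: "\<And>z. z \<in> V \<Longrightarrow> 1 \<le> card {e \<in> Ed. z \<in> e}"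
    and d2: "\<And>z. z \<in> V \<Longrightarrow> z \<noteq> u1 \<Longrightarrow> z \<noteq> u2 \<Longrightarrow> 2 \<le> card {e \<in> Ed. z \<in> e}"
  shows "(\<Sum>z | z \<in> V \<and> 3 \<le> card {e \<in> Ed. z \<in> e}. card {e \<in> Ed. z \<in> e} - 2) + 2 * card V \<le> 2 * card Ed + 2"
proof -
  let ?d = "\<lambda>z. card {e \<in> Ed. z \<in> e}"
  let ?o = "\<lambda>z. if z = u1 \<or> z = u2 then 1 else (0::nat)"
  have "(\<Sum>z | z \<in> V \<and> 3 \<le> ?d z. ?d z - 2) + 2 * card V = (\<Sum>z\<in>V. (if 3 \<le> ?d z then ?d z - 2 else 0) + 2)"
    unfolding sum.distrib using assms(1) by (simp add: sum.If_cases Int_def)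
  also have "\<dots> \<le> (\<Sum>z\<in>V. ?d z + ?o z)"
    by (intro sum_mono) (use d1 d2 in \<open>fastforce simp: not_le\<close>)
  also have "\<dots> = 2 * card Ed + (\<Sum>z\<in>V. ?o z)" using handshake[OF assms(1-3)] by (simp add: sum.distrib)
  also have "(\<Sum>z\<in>V. ?o z) = card {z \<in> V. z = u1 \<or> z = u2}"
    using assms(1) by (simp add: sum.If_cases Int_def)
  also have "{z \<in> V. z = u1 \<or> z = u2} = {u1,u2}" using u by auto
  also have "card {u1,u2} \<le> 2" by (simp add: card_insert_if)
  finally show ?thesis by simp
qed

lemma card_vertices_fresh: "card (x ` {..n}) = Suc (card {i. i < n \<and> fresh x i})"
proof (induction n)
  case (Suc n)
  have "x ` {..Suc n} = insert (x (Suc n)) (x ` {..n})" by (auto simp: atMost_Suc)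
  moreover have "{i. i < Suc n \<and> fresh x i} = (if fresh x n then insert n {i. i < n \<and> fresh x i} else {i. i < n \<and> fresh x i})"
    by (auto simp: less_Suc_eq)
  ultimately show ?case using Suc by (auto simp: fresh_def insert_absorb)
qed auto

lemma card_edges_new_edge: "card (step_edge x ` {..<n}) = card {i. i < n \<and> new_edge x i}"
proof (induction n)
  case (Suc n)
  have "step_edge x ` {..<Suc n} = insert (step_edge x n) (step_edge x ` {..<n})" by (auto simp: lessThan_Suc)
  moreover have "{i. i < Suc n \<and> new_edge x i} = (if new_edge x n then insert n {i. i < n \<and> new_edge x i} else {i. i < n \<and> new_edge x i})"
    by (auto simp: less_Suc_eq)
  ultimately show ?case using Suc by (auto simp: new_edge_def insert_absorb)
qed auto

text \<open>First traversals of edges either discover a vertex or close a cycle, so the latter are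
  counted by the cyclomatic number |E| - |V| + 1 of the trace.\<close>

lemma card_boundary_step: "card {i. i < n \<and> boundary_step x i} + card (x ` {..n}) = card (step_edge x ` {..<n}) + 1"
proof -
  have "{i. i < n \<and> new_edge x i} = {i. i < n \<and> fresh x i} \<union> {i. i < n \<and> boundary_step x i}"
    using fresh_imp_new_edge by (auto simp: boundary_step_def)
  moreover have "card ({i. i < n \<and> fresh x i} \<union> {i. i < n \<and> boundary_step x i}) = card {i. i < n \<and> fresh x i} + card {i. i < n \<and> boundary_step x i}"
    by (intro card_Un_disjoint) (auto simp: boundary_step_def)
  ultimately show ?thesis by (simp add: card_vertices_fresh card_edges_new_edge)
qed

definition branch :: "nat \<Rightarrow> (nat \<Rightarrow> 'v) \<Rightarrow> 'v set" where
  "branch L x = {z \<in> x ` {..L}. 3 \<le> card {e \<in> step_edge x ` {..<L}. z \<in> e}}"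

text \<open>Only the joints \<open>x 0\<close> and \<open>x h\<close> can have degree one; at any
  other visited vertex the walk enters and leaves by different edges.\<close>

lemma closed_walk_branch:
  assumes nb: "nbwalk h L x" and L: "L = 2 * h" "0 < h" and cl: "x L = x 0"
  shows "(\<Sum>z\<in>branch L x. card {e \<in> step_edge x ` {..<L}. z \<in> e} - 2) + 2 * card (x ` {..L}) \<le> 2 * card (step_edge x ` {..<L}) + 2"
proof -
  let ?Ed = "step_edge x ` {..<L}"
  have ne: "\<And>i. i < L \<Longrightarrow> x i \<noteq> x (Suc i)" and nn: "\<And>i. Suc i < L \<Longrightarrow> Suc i \<noteq> h \<Longrightarrow> x i \<noteq> x (i+2)"
    using nb by (auto simp: nbwalk_def)
  have fin: "finite {e \<in> ?Ed. z \<in> e}" for z by simp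
  have one: "1 \<le> card {e \<in> ?Ed. z \<in> e}" if "z \<in> x ` {..L}" for z
  proof -
    from that obtain i where i: "i \<le> L" "z = x i" by auto
    have "\<exists>i<L. z = x i" using i cl L by (intro exI[of _ "if i = L then 0 else i"]) auto
    then have "{e \<in> ?Ed. z \<in> e} \<noteq> {}" by (auto simp: step_edge_def)
    then show ?thesis using fin[of z] by (simp add: Suc_leI card_gt_0_iff)
  qed
  have two: "2 \<le> card {e \<in> ?Ed. z \<in> e}" if z: "z \<in> x ` {..L}" "z \<noteq> x 0" "z \<noteq> x h" for z
  proof -
    from z obtain i where i: "i \<le> L" "z = x i" by auto
    then obtain j where j: "i = Suc j" "i < L" "i \<noteq> h" using z cl by (cases i) (auto simp: le_less)
    have "step_edge x j \<noteq> step_edge x i" using nn[of j] ne[of i] ne[of j] j by (auto simp: step_edge_def doubleton_eq_iff)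
    moreover have "{step_edge x j, step_edge x i} \<subseteq> {e \<in> ?Ed. z \<in> e}"
    proof -
      have "step_edge x j \<in> ?Ed" "step_edge x i \<in> ?Ed" using j by auto
      moreover have "z \<in> step_edge x j" "z \<in> step_edge x i" using i j by (auto simp: step_edge_def)
      ultimately show ?thesis by simp
    qed
    then have "card {step_edge x j, step_edge x i} \<le> card {e \<in> ?Ed. z \<in> e}" by (intro card_mono fin)
    ultimately show ?thesis by simp
  qed
  have edV: "card e = 2 \<and> e \<subseteq> x ` {..L}" if e: "e \<in> ?Ed" for e
  proof -
    obtain i where "i < L" "e = step_edge x i" using e by auto
    then show ?thesis using ne[of i] by (auto simp: step_edge_def)
  qed
  have u: "x 0 \<in> x ` {..L}" "x h \<in> x ` {..L}" using L by auto
  show ?thesis unfolding branch_def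
    by (rule branch_excess[OF _ _ edV u one two]) simp_all
qed

text \<open>For d \<ge> 3 the excess d - 2 is at least 1 and at least d / 3, so the total excess
  controls both the number of branch vertices and the number of their incidences.\<close>

lemma branch_bounds:
  assumes nb: "nbwalk h L x" and L: "L = 2 * h" "0 < h" and cl: "x L = x 0"
  defines "g \<equiv> card (step_edge x ` {..<L}) + 1 - card (x ` {..L})"
  shows "card (branch L x) \<le> 2 * g"
    and "(\<Sum>z\<in>branch L x. card {e \<in> step_edge x ` {..<L}. z \<in> e}) \<le> 6 * g"
proof -
  let ?d = "\<lambda>z. card {e \<in> step_edge x ` {..<L}. z \<in> e}"
  have s: "(\<Sum>z\<in>branch L x. ?d z - 2) \<le> 2 * g"
    using closed_walk_branch[OF nb L cl] by (simp add: g_def)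
  have "(\<Sum>z\<in>branch L x. 1) \<le> (\<Sum>z\<in>branch L x. ?d z - 2)"
    by (intro sum_mono) (auto simp: branch_def)
  then show "card (branch L x) \<le> 2 * g" using s by simp
  have "(\<Sum>z\<in>branch L x. ?d z) \<le> (\<Sum>z\<in>branch L x. 3 * (?d z - 2))"
    by (intro sum_mono) (auto simp: branch_def)
  then show "(\<Sum>z\<in>branch L x. ?d z) \<le> 6 * g" using s by (simp add: sum_distrib_left[symmetric])
qed

section \<open>Repeated traversals and mispredictions on an arbitrary support\<close>

definition prior_traversals :: "(nat \<Rightarrow> 'v) \<Rightarrow> nat \<Rightarrow> nat" where
  "prior_traversals x i = card {b. b < i \<and> step_edge x b = step_edge x i}"

lemma new_edge_iff_prior_traversals: "new_edge x i \<longleftrightarrow> prior_traversals x i = 0"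
  by (auto simp: new_edge_def prior_traversals_def image_iff)

lemma inj_on_second: "inj_on (step_edge x) {i. prior_traversals x i = 1}"
proof -
  have "\<not> i < j" if "prior_traversals x i = 1" "prior_traversals x j = 1" "step_edge x i = step_edge x j" for i j
  proof
    assume "i < j"
    have "insert i {b. b < i \<and> step_edge x b = step_edge x i} \<subseteq> {b. b < j \<and> step_edge x b = step_edge x j}"
      using \<open>i < j\<close> that by auto
    then have "card (insert i {b. b < i \<and> step_edge x b = step_edge x i}) \<le> prior_traversals x j"
      unfolding prior_traversals_def by (intro card_mono) auto
    then show False using that by (simp add: prior_traversals_def)
  qed
  then show ?thesis by (intro inj_onI) (metis mem_Collect_eq linorder_neqE_nat)
qed

definition singleton_free :: "nat \<Rightarrow> (nat \<Rightarrow> 'v) \<Rightarrow> bool" where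
  "singleton_free L x \<longleftrightarrow> (\<forall>i<L. \<exists>j<L. j \<noteq> i \<and> step_edge x j = step_edge x i)"

lemma second_onto:
  assumes "singleton_free L x"
  shows "step_edge x ` {..<L} \<subseteq> step_edge x ` {i. i < L \<and> prior_traversals x i = 1}"
proof
  fix e assume "e \<in> step_edge x ` {..<L}"
  then obtain b where b: "b < L" "step_edge x b = e" by auto
  define i0 where "i0 = (LEAST i. step_edge x i = e)"
  have i0: "step_edge x i0 = e" "\<And>i. step_edge x i = e \<Longrightarrow> i0 \<le> i"
    unfolding i0_def using b LeastI[of "\<lambda>i. step_edge x i = e" b] Least_le[of "\<lambda>i. step_edge x i = e"] by blast+
  have "i0 < L" using i0(2)[OF b(2)] b by simp
  then obtain j where j: "j < L" "j \<noteq> i0" "step_edge x j = e" using assms i0 by (auto simp: singleton_free_def)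
  then have "i0 < j" using i0(2)[of j] by auto
  define i1 where "i1 = (LEAST i. i0 < i \<and> step_edge x i = e)"
  have i1: "i0 < i1" "step_edge x i1 = e" "\<And>i. i0 < i \<Longrightarrow> step_edge x i = e \<Longrightarrow> i1 \<le> i"
    using LeastI[of "\<lambda>i. i0 < i \<and> step_edge x i = e" j] Least_le[of "\<lambda>i. i0 < i \<and> step_edge x i = e"] \<open>i0 < j\<close> j
    unfolding i1_def by auto
  have "{b. b < i1 \<and> step_edge x b = step_edge x i1} = {i0}"
    using i1 i0 by (auto simp: order.order_iff_strict) (metis leD le_less)
  then have "prior_traversals x i1 = 1" by (simp add: prior_traversals_def)
  moreover have "i1 < L" using i1(3)[of j] \<open>i0 < j\<close> j by simp
  ultimately show "e \<in> step_edge x ` {i. i < L \<and> prior_traversals x i = 1}" using i1 by blast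
qed

text \<open>If no edge is traversed exactly once, first and second traversals both number |E|, and
  what remains of the L steps are later traversals.\<close>

lemma card_third:
  assumes "singleton_free L x"
  shows "card {i. i < L \<and> 2 \<le> prior_traversals x i} + 2 * card (step_edge x ` {..<L}) \<le> L"
proof -
  have "card (step_edge x ` {..<L}) \<le> card (step_edge x ` {i. i < L \<and> prior_traversals x i = 1})"
    using second_onto[OF assms] by (intro card_mono) auto
  also have "\<dots> \<le> card {i. i < L \<and> prior_traversals x i = 1}" by (rule card_image_le) simp
  finally have a: "card (step_edge x ` {..<L}) \<le> card {i. i < L \<and> prior_traversals x i = 1}" .
  have b: "card (step_edge x ` {..<L}) = card {i. i < L \<and> prior_traversals x i = 0}"
    by (simp add: card_edges_new_edge new_edge_iff_prior_traversals)
  have "{..<L} = {i. i < L \<and> prior_traversals x i = 0} \<union> ({i. i < L \<and> prior_traversals x i = 1} \<union> {i. i < L \<and> 2 \<le> prior_traversals x i})"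
    by auto
  then have "L = card ({i. i < L \<and> prior_traversals x i = 0} \<union> ({i. i < L \<and> prior_traversals x i = 1} \<union> {i. i < L \<and> 2 \<le> prior_traversals x i}))"
    by (metis card_lessThan)
  also have "\<dots> = card {i. i < L \<and> prior_traversals x i = 0} + (card {i. i < L \<and> prior_traversals x i = 1} + card {i. i < L \<and> 2 \<le> prior_traversals x i})"
    by (subst card_Un_disjoint, simp, simp, force)+ simp
  finally show ?thesis using a b by linarith
qed

text \<open>A misprediction is followed by a step along an old edge out of a branch vertex. Either
  this is a third or later traversal, or it is the second traversal of its edge; in the latter case
  its vertex and edge identify it, and there are at most 6 such incidences per independent
  cycle.\<close>

lemma card_mispredicted:
  assumes nb: "nbwalk h L x" and L: "L = 2 * h" "0 < h" and cl: "x L = x 0" and sf: "singleton_free L x"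
  shows "card {j. mispredicted h L x j} + 2 * card (step_edge x ` {..<L}) \<le> 6 * (card (step_edge x ` {..<L}) + 1 - card (x ` {..L})) + L"
proof -
  let ?Ed = "step_edge x ` {..<L}"
  let ?T = "{i. i < L \<and> 2 \<le> prior_traversals x i}"
  let ?S = "{i. i < L \<and> prior_traversals x i = 1 \<and> x i \<in> branch L x}"
  have "Suc ` {j. mispredicted h L x j} \<subseteq> ?T \<union> ?S"
  proof
    fix i assume "i \<in> Suc ` {j. mispredicted h L x j}"
    then obtain j where j: "i = Suc j" "mispredicted h L x j" by auto
    then have "i < L" "prior_traversals x i \<noteq> 0" by (auto simp: mispredicted_def new_edge_iff_prior_traversals)
    moreover have "x i \<in> branch L x" using mispredicted_branch[OF nb j(2)] j \<open>i < L\<close> by (auto simp: branch_def)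
    ultimately show "i \<in> ?T \<union> ?S" by auto
  qed
  then have "card (Suc ` {j. mispredicted h L x j}) \<le> card (?T \<union> ?S)" by (intro card_mono) auto
  also have "\<dots> \<le> card ?T + card ?S" by (rule card_Un_le)
  finally have 1: "card {j. mispredicted h L x j} \<le> card ?T + card ?S" by (simp add: card_image)
  have finbr: "finite (branch L x)" by (simp add: branch_def)
  have "card ?S \<le> card (SIGMA z:branch L x. {e \<in> ?Ed. z \<in> e})"
  proof (rule card_inj_on_le[where f = "\<lambda>i. (x i, step_edge x i)"])
    show "inj_on (\<lambda>i. (x i, step_edge x i)) ?S" using inj_on_second[of x] by (auto simp: inj_on_def)
    show "(\<lambda>i. (x i, step_edge x i)) ` ?S \<subseteq> (SIGMA z:branch L x. {e \<in> ?Ed. z \<in> e})" by (auto simp: step_edge_def)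
    show "finite (SIGMA z:branch L x. {e \<in> ?Ed. z \<in> e})" using finbr by auto
  qed
  also have "\<dots> = (\<Sum>z\<in>branch L x. card {e \<in> ?Ed. z \<in> e})" using finbr by (simp add: card_SigmaI)
  also have "\<dots> \<le> 6 * (card ?Ed + 1 - card (x ` {..L}))" by (rule branch_bounds(2)[OF nb L cl])
  finally show ?thesis using 1 card_third[OF sf] by linarith
qed

lemma card_annotated_le:
  assumes nb: "nbwalk h L x"
  shows "card {i. i < L \<and> annotated x i} \<le> 2 * card {i. i < L \<and> boundary_step x i} + 4 + card {j. mispredicted h L x j}"
proof -
  let ?B = "{i. i < L \<and> boundary_step x i}"
  let ?E = "{j. \<exists>a\<in>{0,h,h-1}. last_traversal x j a}"
  let ?M = "{j. mispredicted h L x j}"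
  have fE: "finite ?E" "card ?E \<le> 3"
    using card_last_traversal_vimage[of "{0,h,h-1}" x] card_insert_le_m1[of 3 "{h,h-1}" 0]
    by (auto simp: card_insert_if split: if_splits)
  have fM: "finite ?M" by (rule finite_subset[of _ "{..<L}"]) (auto simp: mispredicted_def)
  have "{i. i < L \<and> annotated x i} \<subseteq> ?B \<union> Suc ` ?B \<union> {h} \<union> Suc ` ?E \<union> Suc ` ?M"
    using annotated_cases[OF nb] by blast
  then have "card {i. i < L \<and> annotated x i} \<le> card (?B \<union> Suc ` ?B \<union> {h} \<union> Suc ` ?E \<union> Suc ` ?M)"
    by (rule card_mono[rotated]) (use fE fM in simp)
  also have "\<dots> \<le> card ?B + card (Suc ` ?B) + card {h} + card (Suc ` ?E) + card (Suc ` ?M)"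
    by (intro order_trans[OF card_Un_le] add_mono order_refl)
  also have "\<dots> \<le> card ?B + card ?B + 1 + card ?E + card ?M"
    by (intro add_mono card_image_le) (use fE fM in auto)
  finally show ?thesis using fE by linarith
qed

text \<open>The form suits \<open>closed_walks_dense\<close>: each independent cycle and each edge
  short of L / 2 displaces one fresh step, and is charged with 8 and 2 annotations,
  respectively.\<close>

lemma annotated_bound_dense:
  assumes nb: "nbwalk h L x" and L: "L = 2 * h" "0 < h" and cl: "x L = x 0" and sf: "singleton_free L x"
  shows "card {i. i < L \<and> annotated x i} + 2 * card (step_edge x ` {..<L})
     \<le> 8 * (card (step_edge x ` {..<L}) + 1 - card (x ` {..L})) + L + 4"
proof -
  have "card {i. i < L \<and> boundary_step x i} = card (step_edge x ` {..<L}) + 1 - card (x ` {..L})"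
    using card_boundary_step[of L x] by simp
  then show ?thesis using card_annotated_le[OF nb] card_mispredicted[OF assms] by linarith
qed

section \<open>Walks whose trace has at most one cycle\<close>

text \<open>A path until time \<open>b\<close>, whose step \<open>b\<close> closes the only cycle at
  \<open>y p\<close>; afterwards a new edge can only discover a vertex. Until the next new edge the
  trace is a tail from \<open>y 0\<close> to \<open>y p\<close> with a cycle attached at
  \<open>y p\<close>.\<close>

locale unicyclic_walk =
  fixes y :: "nat \<Rightarrow> 'v" and l b p :: nat
  assumes nb: "nbwalk 0 l y"
    and bl: "b < l" and p: "p + 2 \<le> b" and close: "y (Suc b) = y p"
    and fr: "\<And>i. i < b \<Longrightarrow> fresh y i"
    and later: "\<And>i. i < l \<Longrightarrow> b < i \<Longrightarrow> \<not> boundary_step y i"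
    and nbb: "new_edge y b"
begin

definition per where "per = b + 1 - p"

lemma per: "per \<ge> 3" "p + per = Suc b" using p by (auto simp: per_def)

lemma ne: "i < l \<Longrightarrow> y i \<noteq> y (Suc i)" and nn: "Suc i < l \<Longrightarrow> y i \<noteq> y (i+2)"
  using nb by (auto simp: nbwalk_def)

lemma inj: "i \<le> b \<Longrightarrow> j \<le> b \<Longrightarrow> y i = y j \<Longrightarrow> i = j"
proof (induction i j rule: linorder_wlog)
  case (le i j)
  show ?case
  proof (rule ccontr)
    assume "i \<noteq> j"
    then obtain k where "j = Suc k" "i \<le> k" using le by (cases j) auto
    then show False using fr[of k] le unfolding fresh_def by (metis Suc_le_eq atMost_iff imageI)
  qed
qed auto

lemma step_edge_inj: "i \<le> b \<Longrightarrow> j \<le> b \<Longrightarrow> step_edge y i = step_edge y j \<Longrightarrow> i = j"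
proof (induction i j rule: linorder_wlog)
  case (le i j)
  have "new_edge y j" using fr[of j] fresh_imp_new_edge[of y j] nbb le by (cases "j = b") auto
  then show ?case using le by (auto simp: new_edge_def image_iff le_less)
qed auto

definition phase where "phase n \<longleftrightarrow> (\<forall>i. b < i \<and> i < n \<longrightarrow> \<not> new_edge y i)"

text \<open>The walk runs around its cycle until time \<open>d\<close> and then returns along the path by which it
  first reached the cycle.\<close>
definition shape where
  "shape n d \<longleftrightarrow> b < d \<and> d \<le> n \<and> (\<forall>i. b < i \<and> i \<le> d \<longrightarrow> y i = y (i - per)) \<and>
     (d < n \<longrightarrow> y d = y p) \<and> (\<forall>i. d < i \<and> i \<le> n \<longrightarrow> i \<le> d + p \<and> y i = y (p + d - i))"

lemma phase_edge: "phase n \<Longrightarrow> i < n \<Longrightarrow> \<exists>u\<le>b. step_edge y i = step_edge y u"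
proof (induction i rule: less_induct)
  case (less i)
  show ?case
  proof (cases "i \<le> b")
    case False
    then have "\<not> new_edge y i" using less.prems by (auto simp: phase_def)
    then obtain k where "k < i" "step_edge y k = step_edge y i" by (auto simp: new_edge_def image_iff)
    then show ?thesis using less by fastforce
  qed auto
qed

lemma periodic:
  assumes "shape n d" "p \<le> s" "s \<le> b" "s + k * per \<le> d" shows "y (s + k * per) = y s"
  using assms(4)
proof (induction k)
  case (Suc k)
  have "b < s + Suc k * per" using assms(2) per by simp
  then have "y (s + Suc k * per) = y (s + Suc k * per - per)" using assms(1) Suc.prems unfolding shape_def by blast
  also have "s + Suc k * per - per = s + k * per" by simp
  finally show ?case using Suc by simp
qed simp

lemma decompose:
  assumes "p \<le> i" obtains s k where "p \<le> s" "s \<le> b" "i = s + k * per"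
proof -
  have "i = p + (i - p) mod per + (i - p) div per * per" using assms mod_div_mult_eq[of "i - p" per] by linarith
  moreover have "p + (i - p) mod per \<le> b" using per mod_less_divisor[of per "i - p"] by linarith
  ultimately show thesis using that by (metis le_add1)
qed

lemma periodic_edge:
  assumes sh: "shape n d" and s: "p \<le> s" "s \<le> b" and le: "Suc (s + k * per) \<le> d"
  shows "step_edge y (s + k * per) = step_edge y s"
proof -
  have "y (Suc (s + k * per)) = y (Suc s)"
  proof (cases "s = b")
    case True
    have "Suc (s + k * per) = p + Suc k * per" using per True by simp
    moreover have "y (p + Suc k * per) = y p"
      by (rule periodic[OF sh]) (use calculation le p in auto)
    ultimately have "y (Suc (s + k * per)) = y p" by metis
    then show ?thesis using True close by simp
  next
    case False
    then show ?thesis using periodic[OF sh, of "Suc s" k] s le by simp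
  qed
  then show ?thesis using periodic[OF sh s, of k] le by (simp add: step_edge_def)
qed

text \<open>Without backtracking the only choice is at \<open>y p\<close>, between another round and
  the tail. On the tail the walk is forced towards \<open>y 0\<close>, and from there it cannot
  continue without a new edge.\<close>

lemma shape_Suc:
  assumes sh: "shape n d" and ph: "phase (Suc n)" and n: "n < l"
  shows "\<exists>d'. shape (Suc n) d'"
proof -
  have bn: "b < n" using sh by (auto simp: shape_def)
  obtain u where u: "u \<le> b" "step_edge y n = step_edge y u" using phase_edge[OF ph, of n] by auto
  obtain m where m: "n = Suc m" using bn by (cases n) auto
  have nb1: "y m \<noteq> y (Suc n)" using nn[of m] n m by auto
  from step_edge_eqD[OF u(2)] have alt: "(y n = y u \<and> y (Suc n) = y (Suc u)) \<or> (y n = y (Suc u) \<and> y (Suc n) = y u)" .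
  show ?thesis
  proof (cases "d < n")
    case True
    define s where "s = p + d - n"
    have n1: "n \<le> d + p" "y n = y s" using sh True by (auto simp: shape_def s_def)
    have sp: "s < p" using True n1 by (auto simp: s_def)
    have ym: "y m = y (Suc s)"
    proof (cases "d < m")
      case T: True
      then have "m \<le> d + p \<and> y m = y (p + d - m)" using sh m by (auto simp: shape_def)
      moreover have "p + d - m = Suc s" using m n1 by (auto simp: s_def)
      ultimately show ?thesis by simp
    next
      case False
      then have "m = d" using True m by simp
      then show ?thesis using sh True m by (auto simp: shape_def s_def)
    qed
    have "s \<le> b" using sp p by simp
    from alt have "y (Suc n) = y (s - 1) \<and> 0 < s"
    proof
      assume a: "y n = y u \<and> y (Suc n) = y (Suc u)"
      then have "u = s" using n1 inj[of u s] u \<open>s \<le> b\<close> by auto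
      then show ?thesis using a ym nb1 by simp
    next
      assume a: "y n = y (Suc u) \<and> y (Suc n) = y u"
      have "u \<noteq> b" using a n1 close inj[of s p] sp p by auto
      then have "Suc u = s" using a n1 inj[of "Suc u" s] u sp p by auto
      then show ?thesis using a by auto
    qed
    then have "shape (Suc n) d" using sh True n1 unfolding shape_def
      by (auto simp: le_Suc_eq s_def)
    then show ?thesis by blast
  next
    case False
    then have dn: "d = n" using sh by (auto simp: shape_def)
    have pn: "p \<le> n" using bn p by simp
    obtain s k where s: "p \<le> s" "s \<le> b" "n = s + k * per" using decompose[OF pn] .
    have k: "k \<noteq> 0" using s bn by (cases k) auto
    then obtain k' where k': "k = Suc k'" by (cases k) auto
    have yn: "y n = y s" using periodic[OF sh s(1,2), of k] s dn by simp
    from alt show ?thesis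
    proof
      assume a: "y n = y u \<and> y (Suc n) = y (Suc u)"
      then have us: "u = s" using yn inj[of u s] u s by auto
      have "n - per = s + k' * per" using s k' by simp
      moreover have "Suc (s + k' * per) \<le> d" using dn s k' per by simp
      ultimately have e: "step_edge y (n - per) = step_edge y s" using periodic_edge[OF sh s(1,2), of k'] by simp
      have ynp: "y (n - per) = y s" using sh bn dn yn unfolding shape_def by fastforce
      then have "y (Suc (n - per)) = y (Suc s)" using e step_edge_eqD[OF e] by auto
      moreover have "Suc (n - per) = Suc n - per" using s k' by simp
      ultimately have "y (Suc n) = y (Suc n - per)" using a us by simp
      moreover have "y i = y (i - per)" if "b < i" "i \<le> n" for i using sh dn that by (auto simp: shape_def)
      ultimately have "y i = y (i - per)" if "b < i" "i \<le> Suc n" for i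
        using that by (cases "i = Suc n") auto
      then have "shape (Suc n) (Suc n)" using bn unfolding shape_def by auto
      then show ?thesis by blast
    next
      assume a: "y n = y (Suc u) \<and> y (Suc n) = y u"
      show ?thesis
      \<comment> \<open>Reversal on the cycle would undo the previous step. The closing edge is
        treated apart because its far end is \<open>y p\<close> and not a further vertex of the
        path.\<close>
      proof (cases "u = b")
        case True
        then have "y s = y p" using a yn close by metis
        then have "s = p" using inj[of s p] s p by linarith
        then have mk: "m = b + k' * per" using s m k' per by simp
        have "y (b + k' * per) = y b" by (rule periodic[OF sh]) (use p dn m mk in auto)
        then show ?thesis using nb1 a True mk by metis
      next
        case F: False
        have "y (Suc u) = y s" using a yn by metis
        then have us: "Suc u = s" using inj[of "Suc u" s] u s F by linarith
        show ?thesis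
        proof (cases "s = p")
          case True
          have "y i = y (i - per)" if "b < i" "i \<le> n" for i using sh dn that by (auto simp: shape_def)
          moreover have "y n = y p" using yn True by simp
          moreover have "i \<le> n + p \<and> y i = y (p + n - i)" if "n < i" "i \<le> Suc n" for i
          proof -
            have i: "i = Suc n" using that by simp
            have "p + n - Suc n = u" "1 \<le> p" using us True by auto
            then show ?thesis unfolding i using a by simp
          qed
          ultimately have "shape (Suc n) n" using bn unfolding shape_def by simp
          then show ?thesis by blast
        next
          case G: False
          have mk: "m = u + k * per" "p \<le> u" using us s m G by auto
          have "y (u + k * per) = y u" by (rule periodic[OF sh]) (use u dn m mk in auto)
          then show ?thesis using nb1 a mk by metis
        qed
      qed
    qed
  qed
qed

lemma shape_exists: "b < n \<Longrightarrow> n \<le> l \<Longrightarrow> phase n \<Longrightarrow> \<exists>d. shape n d"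
proof (induction n rule: nat_induct)
  case (Suc n)
  show ?case
  proof (cases "b < n")
    case True
    then have "\<exists>d. shape n d" using Suc by (auto simp: phase_def)
    then show ?thesis using shape_Suc Suc.prems by auto
  next
    case False
    then have "n = b" using Suc by simp
    have "shape (Suc b) (Suc b)" using close per unfolding shape_def
      by (auto simp: le_Suc_eq per_def)
    then show ?thesis using \<open>n = b\<close> by auto
  qed
qed simp

text \<open>On the cycle the latest traversal of the current edge lies one period back, in the same
  direction. On the way out it is the original passage along the tail, in the opposite direction,
  which explains the two clauses of \<open>predicted\<close>. At \<open>Suc j = d\<close> the memory
  may suggest another round while the walk leaves.\<close>

lemma predicted_in_phase:
  assumes sh: "shape c d" and j: "b < j" "j + 2 \<le> c" "Suc j \<noteq> d"
  shows "predicted y j"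
proof (cases "j + 2 \<le> d")
  case True
  have pj: "p \<le> j" using j p by simp
  obtain s k where s: "p \<le> s" "s \<le> b" "j = s + k * per" using decompose[OF pj] .
  then obtain k' where k': "k = Suc k'" using j by (cases k) auto
  have ja: "j - per = s + k' * per" using s k' by simp
  have per': "\<And>i. b < i \<Longrightarrow> i \<le> d \<Longrightarrow> y i = y (i - per)" using sh by (auto simp: shape_def)
  have ej: "step_edge y j = step_edge y s" using periodic_edge[OF sh s(1,2), of k] s True by simp
  have ea: "step_edge y (j - per) = step_edge y s" using periodic_edge[OF sh s(1,2), of k'] ja s k' True by simp
  have "last_traversal y j (j - per)"
    unfolding last_traversal_def
  proof (intro conjI allI impI)
    show "j - per < j" using per j by simp
    show "step_edge y (j - per) = step_edge y j" using ej ea by simp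
    fix i assume i: "j - per < i \<and> i < j"
    have "p \<le> i" using i ja s by simp
    then obtain s' m where s': "p \<le> s'" "s' \<le> b" "i = s' + m * per" using decompose by metis
    have "step_edge y i = step_edge y s'" using periodic_edge[OF sh s'(1,2), of m] s' True i by simp
    moreover have "s' \<noteq> s"
    proof
      assume "s' = s"
      then have "k' * per < m * per" "m * per < Suc k' * per" using i ja s' s k' by auto
      then have "k' < m" "m < Suc k'" by (meson mult_less_cancel2)+
      then show False by simp
    qed
    ultimately show "step_edge y i \<noteq> step_edge y j" using ej step_edge_inj[of s' s] s s' by metis
  qed
  moreover have "y (j - per) = y j" using per'[of j] j True by simp
  moreover have "y (j + 2) = y (j - per + 2)" using per'[of "j+2"] j True ja s k' by simp
  ultimately show ?thesis unfolding predicted_def by auto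
next
  case False
  then have dj: "d \<le> j" using j by simp
  have dn: "y d = y p" "\<And>i. d < i \<Longrightarrow> i \<le> c \<Longrightarrow> i \<le> d + p \<and> y i = y (p + d - i)" and bd: "b < d"
    using sh j dj by (auto simp: shape_def)
  have dn': "i \<le> d + p \<and> y i = y (p + d - i)" if "d \<le> i" "i \<le> c" for i
    using dn that by (cases "i = d") auto
  define t where "t = p + d - j - 1"
  have j2: "j + 2 \<le> d + p" "y (j+2) = y (p + d - (j+2))" using dn'[of "j+2"] j dj by auto
  then have t: "0 < t" "t < p" "p + d - j = Suc t" "p + d - Suc j = t" "p + d - (j + 2) = t - 1" using dj by (auto simp: t_def)
  have step_edge_tail: "step_edge y i = step_edge y (p + d - Suc i)" if "d \<le> i" "i \<le> j" for i
    using dn'[of i] dn'[of "Suc i"] that j j2 by (auto simp: step_edge_def Suc_diff_Suc)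
  have "last_traversal y j t"
    unfolding last_traversal_def
  proof (intro conjI allI impI)
    show "t < j" using t p j by simp
    show "step_edge y t = step_edge y j" using step_edge_tail[of j] dj t by simp
    fix i assume i: "t < i \<and> i < j"
    have "\<exists>s'. s' \<le> b \<and> t < s' \<and> step_edge y i = step_edge y s'"
    proof (cases "d \<le> i")
      case True
      then show ?thesis using step_edge_tail[of i] i t p dj j2 by (intro exI[of _ "p + d - Suc i"]) auto
    next
      case F: False
      show ?thesis
      proof (cases "p \<le> i")
        case True
        obtain s' m where s': "p \<le> s'" "s' \<le> b" "i = s' + m * per" using decompose[OF True] .
        then have "step_edge y i = step_edge y s'" using periodic_edge[OF sh s'(1,2), of m] F by simp
        then show ?thesis using s' t by (intro exI[of _ s']) auto
      next
        case False
        then show ?thesis using i p by (intro exI[of _ i]) auto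
      qed
    qed
    then obtain s' where "s' \<le> b" "t < s'" "step_edge y i = step_edge y s'" by auto
    then show "step_edge y i \<noteq> step_edge y j" using step_edge_inj[of s' t] step_edge_tail[of j] dj t p by auto
  qed
  moreover have "y t \<noteq> y j" using dn'[of j] dj j t inj[of t "Suc t"] p by auto
  moreover have "y (j + 2) = y (t - 1)" using j2 t by simp
  ultimately show ?thesis using t unfolding predicted_def by auto
qed

text \<open>The only surprises are leaving the cycle and the first new edge after \<open>b\<close>,
  at time \<open>c\<close>. From \<open>c\<close> on every step is fresh: after a fresh step the
  next edge is new, and a new edge to an old vertex would be a second boundary step.\<close>

lemma unpredicted_card: "card {j. Suc j < l \<and> \<not> new_edge y j \<and> \<not> predicted y j} \<le> 2"
proof -
  define C where "C = {n. b < n \<and> n \<le> l \<and> phase n}"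
  have "Suc b \<in> C" "finite C" using bl by (auto simp: C_def phase_def)
  define c where "c = Max C"
  have cC: "c \<in> C" and cmax: "\<And>n. n \<in> C \<Longrightarrow> n \<le> c" using \<open>Suc b \<in> C\<close> \<open>finite C\<close> by (auto simp: c_def intro: Max_in)
  have cb: "b < c" "c \<le> l" "phase c" using cC by (auto simp: C_def)
  obtain d where d: "shape c d" using shape_exists[OF cb] by blast
  have fresh_after: "fresh y i" if "c \<le> i" "i < l" for i
    using that
  proof (induction i rule: dec_induct)
    case base
    have "\<not> phase (Suc c)" using cmax[of "Suc c"] base cb by (auto simp: C_def)
    then have "new_edge y c" using cb by (auto simp: phase_def less_Suc_eq)
    then show ?case using later[of c] cb base by (auto simp: boundary_step_def)
  next
    case (step i)
    then have "new_edge y (Suc i)" using fresh_next_new[of y i] nn[of i] ne[of "Suc i"] by auto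
    then show ?case using later[of "Suc i"] step cb by (auto simp: boundary_step_def)
  qed
  have "{j. Suc j < l \<and> \<not> new_edge y j \<and> \<not> predicted y j} \<subseteq> {c - 1, d - 1}"
  proof
    fix j assume "j \<in> {j. Suc j < l \<and> \<not> new_edge y j \<and> \<not> predicted y j}"
    then have j: "Suc j < l" "\<not> new_edge y j" "\<not> predicted y j" by auto
    have "j < c" using fresh_after[of j] fresh_imp_new_edge[of y j] j by (cases "j < c") auto
    moreover have "b < j" using fr[of j] fresh_imp_new_edge[of y j] nbb j by (metis linorder_neqE_nat)
    ultimately show "j \<in> {c - 1, d - 1}" using predicted_in_phase[OF d, of j] j by force
  qed
  then have "card {j. Suc j < l \<and> \<not> new_edge y j \<and> \<not> predicted y j} \<le> card {c - 1, d - 1}" by (intro card_mono) auto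
  also have "\<dots> \<le> 2" by (simp add: card_insert_if)
  finally show ?thesis .
qed

end

text \<open>Up to its first non-fresh step the walk is a path, so by \<open>fresh_next_new\<close>
  that step uses a new edge and is the one permitted boundary step. It cannot end at either of the
  last two path vertices, hence the cycle length is at least 3.\<close>

lemma unicyclic_unpredicted:
  assumes nb: "nbwalk 0 l y" and b1: "card {i. i < l \<and> boundary_step y i} \<le> 1"
  shows "card {j. Suc j < l \<and> \<not> new_edge y j \<and> \<not> predicted y j} \<le> 2"
proof (cases "\<exists>i<l. \<not> fresh y i")
  case False
  then have "{j. Suc j < l \<and> \<not> new_edge y j \<and> \<not> predicted y j} = {}" using fresh_imp_new_edge[of y] by auto
  then show ?thesis by (simp only: card.empty)
next
  case True
  define b where "b = (LEAST i. i < l \<and> \<not> fresh y i)"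
  have b: "b < l" "\<not> fresh y b" using LeastI_ex[of "\<lambda>i. i < l \<and> \<not> fresh y i"] True by (auto simp: b_def)
  have fr: "fresh y i" if "i < b" for i
    using not_less_Least[of i "\<lambda>i. i < l \<and> \<not> fresh y i"] that b by (auto simp: b_def)
  have ne: "\<And>i. i < l \<Longrightarrow> y i \<noteq> y (Suc i)" and nn: "\<And>i. Suc i < l \<Longrightarrow> y i \<noteq> y (i+2)"
    using nb by (auto simp: nbwalk_def)
  have "b \<noteq> 0" using b ne[of 0] by (intro notI) (auto simp: fresh_def)
  then obtain b' where b': "b = Suc b'" by (cases b) auto
  have nbb: "new_edge y b" using fresh_next_new[of y b'] fr[of b'] nn[of b'] ne[of b] b b' by auto
  obtain p where p: "p \<le> b" "y (Suc b) = y p" using b by (auto simp: fresh_def)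
  have "p \<noteq> b" using p ne[of b] b by auto
  moreover have "p \<noteq> b'" using p nn[of b'] b b' by auto
  ultimately have "p + 2 \<le> b" using p b' by auto
  have "\<not> boundary_step y i" if "i < l" "b < i" for i
  proof
    assume "boundary_step y i"
    then have "{b, i} \<subseteq> {i. i < l \<and> boundary_step y i}" using that b nbb by (auto simp: boundary_step_def)
    then have "card {b, i} \<le> card {i. i < l \<and> boundary_step y i}" by (intro card_mono) auto
    then show False using that b1 by simp
  qed
  then interpret unicyclic_walk y l b p
    by unfold_locales (use nb b p \<open>p + 2 \<le> b\<close> fr nbb in auto)
  show ?thesis by (rule unpredicted_card)
qed

section \<open>Cutting a walk into short windows\<close>

lemma step_edge_shift: "step_edge (\<lambda>i. x (s + i)) j = step_edge x (s + j)"
  by (simp add: step_edge_def)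

text \<open>A latest traversal found inside the window is also the latest one in the whole walk. The
  converse can fail, so looking at windows only overcounts mispredictions.\<close>

lemma predicted_shift:
  assumes "predicted (\<lambda>i. x (s + i)) j" shows "predicted x (s + j)"
proof -
  let ?y = "\<lambda>i. x (s + i)"
  obtain a where a: "last_traversal ?y j a" "if ?y a = ?y j then ?y (j+2) = ?y (a+2) else 0 < a \<and> ?y (j+2) = ?y (a-1)"
    using assms unfolding predicted_def by blast
  have "last_traversal x (s + j) (s + a)"
    unfolding last_traversal_def
  proof (intro conjI allI impI)
    show "s + a < s + j" "step_edge x (s + a) = step_edge x (s + j)" using a(1) by (auto simp: last_traversal_def step_edge_shift)
    fix b assume b: "s + a < b \<and> b < s + j"
    then have "a < b - s \<and> b - s < j" by linarith
    then have "step_edge ?y (b - s) \<noteq> step_edge ?y j" using a(1) by (auto simp: last_traversal_def)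
    then show "step_edge x b \<noteq> step_edge x (s + j)" using b by (simp add: step_edge_shift)
  qed
  then show ?thesis using a(2) unfolding predicted_def by (intro exI[of _ "s + a"]) (auto split: if_splits)
qed

text \<open>An edge new to the window may be old for the whole walk. Then the step discovers, within
  the window, a branch vertex of the full trace, which happens once per such vertex, or it closes
  the single cycle of the window. The other mispredictions are at most two by
  \<open>unicyclic_unpredicted\<close>.\<close>

lemma card_mispredicted_window:
  fixes x :: "nat \<Rightarrow> 'v" and s :: nat
  defines "y \<equiv> \<lambda>i. x (s + i)"
  assumes nb: "nbwalk h L x" and nby: "nbwalk 0 l y" and b1: "card {i. i < l \<and> boundary_step y i} \<le> 1"
  shows "card {j. Suc j < l \<and> mispredicted h L x (s + j)} \<le> card (branch L x) + 3"
proof -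
  let ?A = "{j. Suc j < l \<and> fresh y j \<and> y (Suc j) \<in> branch L x}"
  let ?B = "{j. j < l \<and> boundary_step y j}"
  let ?C = "{j. Suc j < l \<and> \<not> new_edge y j \<and> \<not> predicted y j}"
  have finbr: "finite (branch L x)" by (simp add: branch_def)
  have fin: "finite ?A" "finite ?B" "finite ?C" by (rule finite_subset[of _ "{..<l}"], auto)+
  have "{j. Suc j < l \<and> mispredicted h L x (s + j)} \<subseteq> ?A \<union> ?B \<union> ?C"
  proof
    fix j assume "j \<in> {j. Suc j < l \<and> mispredicted h L x (s + j)}"
    then have j: "Suc j < l" "mispredicted h L x (s + j)" by auto
    then have "y (Suc j) \<in> branch L x"
      using mispredicted_branch[OF nb j(2)] by (auto simp: branch_def y_def mispredicted_def)
    moreover have "\<not> predicted y j" using predicted_shift[of x s j] j by (auto simp: mispredicted_def y_def)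
    ultimately show "j \<in> ?A \<union> ?B \<union> ?C" using j by (auto simp: boundary_step_def)
  qed
  then have "card {j. Suc j < l \<and> mispredicted h L x (s + j)} \<le> card (?A \<union> ?B \<union> ?C)" using fin by (intro card_mono) auto
  also have "\<dots> \<le> card ?A + card ?B + card ?C"
    by (intro order_trans[OF card_Un_le] add_mono order_refl)
  also have "card ?A \<le> card (branch L x)"
  proof (rule card_inj_on_le[of "y \<circ> Suc"])
    have "\<not> i < j" if "fresh y j" "y (Suc i) = y (Suc j)" for i j
      using that unfolding fresh_def by (metis Suc_leI atMost_iff image_eqI)
    then show "inj_on (y \<circ> Suc) ?A" by (intro inj_onI) (metis (mono_tags, lifting) comp_apply linorder_neqE_nat mem_Collect_eq)
  qed (use finbr in auto)
  also have "card ?C \<le> 2" by (rule unicyclic_unpredicted[OF nby b1])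
  finally show ?thesis using b1 by linarith
qed

text \<open>\<open>l dvd h\<close> puts the joint on a window boundary, so every window is a plain
  non-backtracking walk. The last step of a window has its successor in the next window and is given
  up, hence 4 in place of 3.\<close>

lemma card_mispredicted_windows:
  assumes nb: "nbwalk h L x" and dvd: "l dvd h" "L = 2 * h" "0 < l"
    and win: "\<And>s. s + l \<le> L \<Longrightarrow> card (step_edge x ` {s..<s + l}) \<le> card (x ` {s..s + l})"
  shows "card {j. mispredicted h L x j} \<le> (L div l) * (card (branch L x) + 4)"
proof -
  let ?W = "\<lambda>w. (\<lambda>j. w * l + j) ` {j. Suc j < l \<and> mispredicted h L x (w * l + j)} \<union> {w * l + (l - 1)}"
  have ldL: "l dvd L" using dvd by simp
  have "{j. mispredicted h L x j} \<subseteq> (\<Union>w<L div l. ?W w)"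
  proof
    fix j assume j: "j \<in> {j. mispredicted h L x j}"
    then have "j < L" by (auto simp: mispredicted_def)
    define w where "w = j div l"
    have w: "w < L div l" "j = w * l + j mod l" "j mod l < l"
      using \<open>j < L\<close> ldL dvd by (auto simp: w_def less_mult_imp_div_less elim!: dvdE)
    have "j \<in> ?W w"
    proof (cases "Suc (j mod l) < l")
      case True
      then show ?thesis using j w by (intro UnI1 image_eqI[of _ _ "j mod l"]) auto
    next
      case False
      then have "j mod l = l - 1" using w by simp
      then show ?thesis using w by auto
    qed
    then show "j \<in> (\<Union>w<L div l. ?W w)" using w by auto
  qed
  moreover have finW: "finite (?W w)" for w
    by (rule finite_subset[of _ "(\<lambda>j. w * l + j) ` {..l}"]) auto
  ultimately have "card {j. mispredicted h L x j} \<le> card (\<Union>w<L div l. ?W w)" by (intro card_mono) auto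
  also have "\<dots> \<le> (\<Sum>w<L div l. card (?W w))" by (rule card_UN_le) simp
  also have "\<dots> \<le> (\<Sum>w<L div l. card (branch L x) + 4)"
  proof (rule sum_mono)
    fix w assume "w \<in> {..<L div l}"
    then have "(w + 1) * l \<le> L" using ldL by (metis Suc_eq_plus1 Suc_leI dvd_div_mult_self lessThan_iff mult_le_mono1)
    then have wl: "w * l + l \<le> L" by simp
    let ?y = "\<lambda>i. x (w * l + i)"
    have "w * l + Suc i \<noteq> h" if "Suc i < l" for i
    proof
      assume "w * l + Suc i = h"
      then have "l dvd Suc i" using dvd by (metis dvd_add_right_iff dvd_triv_right)
      then show False using that by (auto dest: dvd_imp_le)
    qed
    then have nby: "nbwalk 0 l ?y" using nb wl unfolding nbwalk_def by auto
    have e1: "step_edge ?y ` {..<l} = step_edge x ` {w * l..<w * l + l}"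
    proof -
      have "{w * l..<w * l + l} = (\<lambda>i. w * l + i) ` {..<l}"
        by (simp add: lessThan_atLeast0 add.commute)
      then show ?thesis by (simp add: image_image step_edge_shift)
    qed
    have e2: "?y ` {..l} = x ` {w * l..w * l + l}"
    proof -
      have "{w * l..w * l + l} = (\<lambda>i. w * l + i) ` {..l}"
        by (simp add: atMost_atLeast0 add.commute)
      then show ?thesis by (simp add: image_image)
    qed
    have "card {i. i < l \<and> boundary_step ?y i} \<le> 1"
      using card_boundary_step[of l ?y] win[OF wl] unfolding e1 e2 by linarith
    then have "card {j. Suc j < l \<and> mispredicted h L x (w * l + j)} \<le> card (branch L x) + 3"
      by (rule card_mispredicted_window[OF nb nby])
    moreover have "card (?W w) \<le> card ((\<lambda>j. w * l + j) ` {j. Suc j < l \<and> mispredicted h L x (w * l + j)}) + card {w * l + (l - 1)}"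
      by (rule card_Un_le)
    moreover have "card ((\<lambda>j. w * l + j) ` {j. Suc j < l \<and> mispredicted h L x (w * l + j)}) \<le> card {j. Suc j < l \<and> mispredicted h L x (w * l + j)}"
      by (rule card_image_le) (rule finite_subset[of _ "{..<l}"], auto)
    ultimately show "card (?W w) \<le> card (branch L x) + 4" by simp
  qed
  finally show ?thesis by simp
qed

lemma annotated_bound_sparse:
  assumes nb: "nbwalk h L x" and L: "L = 2 * h" "0 < h" "l dvd h" "0 < l" and cl: "x L = x 0"
    and win: "\<And>s. s + l \<le> L \<Longrightarrow> card (step_edge x ` {s..<s + l}) \<le> card (x ` {s..s + l})"
    and g: "card (step_edge x ` {..<L}) + 1 \<le> card (x ` {..L}) + g"
  shows "card {i. i < L \<and> annotated x i} \<le> 2 * g + 4 + (L div l) * (2 * g + 4)"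
proof -
  have "card {i. i < L \<and> boundary_step x i} \<le> g" using card_boundary_step[of L x] g by simp
  moreover have "card (branch L x) \<le> 2 * g" using branch_bounds(1)[OF nb L(1,2) cl] g by linarith
  then have "card {j. mispredicted h L x j} \<le> (L div l) * (2 * g + 4)"
    using card_mispredicted_windows[OF nb L(3,1,4) win] by (meson add_le_mono1 mult_le_mono2 order_trans)
  ultimately show ?thesis using card_annotated_le[OF nb] by linarith
qed

section \<open>Counting walks by a Kraft inequality\<close>

text \<open>The extensions of a prefix multiply its weight by at most \<open>B\<close> in total, so
  the sum grows by at most this factor per step.\<close>

lemma kraft_sum:
  fixes W :: "nat \<Rightarrow> 'v list set" and wt :: "'v list \<Rightarrow> real" and B :: real
  assumes fin: "finite (W 0)" and nonneg: "\<And>zs. 0 \<le> wt zs" and B: "0 \<le> B"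
    and step: "\<And>n xs. n < N \<Longrightarrow> xs \<in> W (Suc n) \<Longrightarrow> butlast xs \<in> W n"
    and len: "\<And>n xs. xs \<in> W n \<Longrightarrow> length xs = Suc n"
    and loc: "\<And>n ys. n < N \<Longrightarrow> ys \<in> W n \<Longrightarrow>
      finite {y. ys @ [y] \<in> W (Suc n)} \<and> (\<Sum>y | ys @ [y] \<in> W (Suc n). wt (ys @ [y])) \<le> B"
  shows "n \<le> N \<Longrightarrow> finite (W n) \<and> (\<Sum>xs\<in>W n. \<Prod>i<n. wt (take (i + 2) xs)) \<le> card (W 0) * B ^ n"
proof (induction n)
  case 0
  then show ?case using fin by simp
next
  case (Suc n)
  let ?P = "\<lambda>n xs. \<Prod>i<n. wt (take (i + 2) xs)"
  let ?S = "SIGMA ys:W n. {y. ys @ [y] \<in> W (Suc n)}"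
  let ?f = "\<lambda>(ys, y). ys @ [y]"
  have nN: "n < N" using Suc.prems by simp
  have IH: "finite (W n)" "(\<Sum>xs\<in>W n. ?P n xs) \<le> card (W 0) * B ^ n" using Suc by auto
  have finS: "finite ?S" using IH loc[OF nN] by auto
  have im: "?f ` ?S = W (Suc n)"
  proof
    show "W (Suc n) \<subseteq> ?f ` ?S"
    proof
      fix xs assume xs: "xs \<in> W (Suc n)"
      have "xs \<noteq> []" using len[OF xs] by auto
      then obtain ys y where e: "xs = ys @ [y]" by (metis rev_exhaust)
      then have "ys \<in> W n" using step[OF nN xs] by simp
      then show "xs \<in> ?f ` ?S" using xs e by (intro image_eqI[of _ _ "(ys, y)"]) auto
    qed
  qed auto
  have inj: "inj_on ?f ?S" by (auto simp: inj_on_def)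
  have "(\<Sum>xs\<in>W (Suc n). ?P (Suc n) xs) = (\<Sum>p\<in>?S. ?P (Suc n) (?f p))"
    by (subst im[symmetric], subst sum.reindex[OF inj]) (simp add: comp_def)
  also have "\<dots> = (\<Sum>(ys,y)\<in>?S. ?P n ys * wt (ys @ [y]))"
  proof (intro sum.cong refl, clarify)
    fix ys y assume "ys \<in> W n"
    then have l: "length ys = Suc n" by (rule len)
    have "?P n (ys @ [y]) = ?P n ys" using l by (intro prod.cong) auto
    then show "?P (Suc n) (ys @ [y]) = ?P n ys * wt (ys @ [y])" using l by simp
  qed
  also have "\<dots> = (\<Sum>ys\<in>W n. \<Sum>y | ys @ [y] \<in> W (Suc n). ?P n ys * wt (ys @ [y]))"
    using IH(1) loc[OF nN] by (subst sum.Sigma) auto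
  also have "\<dots> \<le> (\<Sum>ys\<in>W n. ?P n ys * B)"
    unfolding sum_distrib_left[symmetric]
    by (intro sum_mono mult_left_mono) (use loc[OF nN] nonneg in \<open>auto intro: prod_nonneg\<close>)
  also have "\<dots> = (\<Sum>ys\<in>W n. ?P n ys) * B" by (simp add: sum_distrib_right)
  also have "\<dots> \<le> card (W 0) * B ^ n * B" using IH(2) B by (rule mult_right_mono)
  finally show ?case using im finS by (metis (no_types, lifting) finite_imageI mult.assoc power_Suc2)
qed

lemma fresh_cong: "(\<And>j. j \<le> Suc i \<Longrightarrow> x j = x' j) \<Longrightarrow> fresh x i = fresh x' i"
  unfolding fresh_def by (metis (no_types, lifting) atMost_iff image_cong le_Suc_eq order_refl)

lemma last_traversal_cong: assumes "\<And>k. k \<le> Suc j \<Longrightarrow> x k = x' k" shows "last_traversal x j a = last_traversal x' j a"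
proof -
  have "step_edge x k = step_edge x' k" if "k \<le> j" for k using assms that by (auto simp: step_edge_def)
  then show ?thesis unfolding last_traversal_def by (metis le_less)
qed

lemma predicted_cong: assumes "\<And>k. k \<le> Suc (Suc j) \<Longrightarrow> x k = x' k" shows "predicted x j = predicted x' j"
proof -
  have l: "last_traversal x j a = last_traversal x' j a" for a by (rule last_traversal_cong) (use assms in auto)
  have e: "(if x a = x j then x (j+2) = x (a+2) else 0 < a \<and> x (j+2) = x (a-1)) =
    (if x' a = x' j then x' (j+2) = x' (a+2) else 0 < a \<and> x' (j+2) = x' (a-1))" if "last_traversal x j a" for a
    using that assms[of a] assms[of j] assms[of "j+2"] assms[of "a+2"] assms[of "a-1"] by (auto simp: last_traversal_def)
  show ?thesis unfolding predicted_def using l e by (metis (no_types, lifting))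
qed

text \<open>A prediction is computed from the vertices up to time \<open>j + 1\<close>, so a prefix
  has at most one predicted extension. This is what allows such a step the full weight 1.\<close>

lemma predicted_unique:
  assumes "predicted x j" "predicted x' j" "\<And>k. k \<le> Suc j \<Longrightarrow> x k = x' k"
  shows "x (j + 2) = x' (j + 2)"
proof -
  obtain a where a: "last_traversal x j a" "if x a = x j then x (j+2) = x (a+2) else 0 < a \<and> x (j+2) = x (a-1)"
    using assms(1) by (auto simp: predicted_def)
  obtain b where b: "last_traversal x' j b" "if x' b = x' j then x' (j+2) = x' (b+2) else 0 < b \<and> x' (j+2) = x' (b-1)"
    using assms(2) by (auto simp: predicted_def)
  have "last_traversal x j b" using b(1) last_traversal_cong[of j x x'] assms(3) by blast
  then have "a = b" using a(1) last_traversal_unique by metis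
  moreover have "a < j" using a by (simp add: last_traversal_def)
  ultimately show ?thesis using a b assms(3)[of a] assms(3)[of j] assms(3)[of "a+2"] assms(3)[of "a-1"] by (auto split: if_splits)
qed

lemma fresh_not_predicted: "fresh x j \<Longrightarrow> \<not> predicted x j"
  using fresh_imp_new_edge[of x j] by (auto simp: predicted_def last_traversal_def new_edge_def)

section \<open>Step weights in a bipartite graph with bounded degrees\<close>

locale bipartite_bounded =
  fixes E :: "'v \<Rightarrow> 'v \<Rightarrow> bool" and sd :: "'v \<Rightarrow> bool" and q r :: nat and h L :: nat
  assumes sym: "E x y \<Longrightarrow> E y x" and side: "E x y \<Longrightarrow> sd x \<noteq> sd y"
    and fin: "finite {y. E x y}"
    and deg: "card {y. E x y} \<le> Suc (if sd x then q else r)"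
    and r: "1 \<le> r" "r \<le> q" and L: "1 \<le> L"
begin

definition branching :: "'v \<Rightarrow> nat" where "branching x = (if sd x then q else r)"

lemma branching: "1 \<le> branching x" "card {y. E x y} \<le> Suc (branching x)" using r deg by (auto simp: branching_def)

text \<open>The vertex was discovered by the preceding step: going back is not fresh and no
  prediction exists, so weight 1 can be shared among at most \<open>branching\<close> fresh
  successors.\<close>

definition continuing :: "(nat \<Rightarrow> 'v) \<Rightarrow> nat \<Rightarrow> bool" where
  "continuing x i \<longleftrightarrow> i \<noteq> 0 \<and> i \<noteq> h \<and> fresh x (i - 1)"

text \<open>The reciprocals of code lengths: at each prefix the weights of the possible next steps add up to
  at most \<open>1 + 3 / L\<close>.\<close>
definition step_weight :: "(nat \<Rightarrow> 'v) \<Rightarrow> nat \<Rightarrow> real" where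
  "step_weight x i = (if fresh x i then (if continuing x i then 1 / branching (x i) else 1 / (L * branching (x i)))
     else if annotated x i then 1 / (real L)\<^sup>2 else 1)"

definition walks :: "'v set \<Rightarrow> nat \<Rightarrow> 'v list set" where
  "walks R n = {xs. length xs = Suc n \<and> xs ! 0 \<in> R \<and> (\<forall>i<n. E (xs ! i) (xs ! Suc i)) \<and> nbwalk h n (nth xs)}"

lemma step_weight_pos: "0 < step_weight x i"
  using L branching(1)[of "x i"] by (auto simp: step_weight_def intro!: mult_pos_pos)

lemma annotated_cong: "(\<And>j. j \<le> Suc i \<Longrightarrow> x j = x' j) \<Longrightarrow> annotated x i = annotated x' i"
  unfolding annotated_def using fresh_cong[of i x x'] predicted_cong[of _ x x'] by auto

lemma step_weight_cong: assumes "\<And>j. j \<le> Suc i \<Longrightarrow> x j = x' j" shows "step_weight x i = step_weight x' i"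
proof -
  have "continuing x i = continuing x' i" unfolding continuing_def using fresh_cong[of "i - 1" x x'] assms by (cases i) auto
  then show ?thesis using assms[of i] annotated_cong[OF assms] fresh_cong[OF assms] by (simp add: step_weight_def)
qed

text \<open>Annotated successors are visited vertices, at most L of them, and contribute 1 / L. In a
  continuing step the fresh ones share 1 and nothing is predicted. Otherwise the predicted one takes
  1 and the fresh ones at most 2 / L, since a vertex has at most \<open>branching + 1\<close>, hence
  at most \<open>2 * branching\<close>, neighbours.\<close>

lemma local_sum:
  assumes n: "n < L" and ys: "ys \<in> walks R n"
  shows "finite {y. ys @ [y] \<in> walks R (Suc n)} \<and>
    (\<Sum>y | ys @ [y] \<in> walks R (Suc n). step_weight (nth (ys @ [y])) n) \<le> 1 + 3 / L"
proof -
  let ?Y = "{y. ys @ [y] \<in> walks R (Suc n)}"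
  let ?x = "\<lambda>y. nth (ys @ [y])"
  have len: "length ys = Suc n" using ys by (simp add: walks_def)
  define z where "z = ys ! n"
  have Yn: "?Y \<subseteq> {y. E z y}"
  proof
    fix y assume "y \<in> ?Y"
    then have "E ((ys @ [y]) ! n) ((ys @ [y]) ! Suc n)" unfolding walks_def by blast
    then show "y \<in> {y. E z y}" using len by (simp add: z_def nth_append)
  qed
  then have finY: "finite ?Y" using fin finite_subset by blast
  have fr: "fresh (?x y) n \<longleftrightarrow> y \<notin> set ys" for y
  proof -
    have "?x y ` {..n} = nth ys ` {..n}" using len by (intro image_cong) (auto simp: nth_append)
    moreover have "{..n} = {0..<Suc n}" by auto
    moreover have "nth ys ` {0..<Suc n} = set ys" using nth_image[of "Suc n" ys] len by simp
    ultimately have "?x y ` {..n} = set ys" by metis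
    then show ?thesis using len by (simp add: fresh_def nth_append)
  qed
  have xz: "?x y n = z" for y using len by (simp add: z_def nth_append)
  let ?F = "{y \<in> ?Y. y \<notin> set ys}" and ?A = "{y \<in> ?Y. y \<in> set ys \<and> annotated (?x y) n}"
    and ?Q = "{y \<in> ?Y. y \<in> set ys \<and> \<not> annotated (?x y) n}"
  have split: "(\<Sum>y\<in>?Y. step_weight (?x y) n) = (\<Sum>y\<in>?F. step_weight (?x y) n) + (\<Sum>y\<in>?A. step_weight (?x y) n) + (\<Sum>y\<in>?Q. step_weight (?x y) n)"
  proof -
    have "?Y = (?F \<union> ?A) \<union> ?Q" by blast
    then have "(\<Sum>y\<in>?Y. step_weight (?x y) n) = (\<Sum>y\<in>(?F \<union> ?A) \<union> ?Q. step_weight (?x y) n)"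
      by (rule sum.cong) (rule refl)
    also have "\<dots> = (\<Sum>y\<in>?F \<union> ?A. step_weight (?x y) n) + (\<Sum>y\<in>?Q. step_weight (?x y) n)"
      using finY by (intro sum.union_disjoint) auto
    also have "(\<Sum>y\<in>?F \<union> ?A. step_weight (?x y) n) = (\<Sum>y\<in>?F. step_weight (?x y) n) + (\<Sum>y\<in>?A. step_weight (?x y) n)"
      using finY by (intro sum.union_disjoint) auto
    finally show ?thesis .
  qed
  have Lp: "0 < real L" using L by simp
  have "(\<Sum>y\<in>?A. step_weight (?x y) n) = (\<Sum>y\<in>?A. 1 / (real L)\<^sup>2)"
    by (intro sum.cong refl) (auto simp: step_weight_def fr)
  also have "\<dots> = card ?A / (real L)\<^sup>2" by simp
  also have "\<dots> \<le> real L / (real L)\<^sup>2"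
  proof (intro divide_right_mono)
    have "card ?A \<le> card (set ys)" by (intro card_mono) auto
    also have "\<dots> \<le> L" using card_length[of ys] len n by simp
    finally show "real (card ?A) \<le> real L" by simp
  qed simp
  also have "\<dots> = 1 / L" using Lp by (simp add: power2_eq_square)
  finally have A: "(\<Sum>y\<in>?A. step_weight (?x y) n) \<le> 1 / L" .
  have Q1: "\<exists>j. n = Suc j \<and> predicted (?x y) j" if "y \<in> ?Q" for y
    using that fr[of y] by (auto simp: annotated_def)
  have "y = y'" if yQ: "y \<in> ?Q" and yQ': "y' \<in> ?Q" for y y'
  proof -
    obtain j where j: "n = Suc j" "predicted (?x y) j" using Q1[OF yQ] by blast
    then have "predicted (?x y') j" using Q1[OF yQ'] by auto
    then have "?x y (j + 2) = ?x y' (j + 2)"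
      by (rule predicted_unique[OF j(2)]) (use len j in \<open>simp add: nth_append\<close>)
    then show ?thesis using len j by (simp add: nth_append)
  qed
  then have "\<forall>y\<in>?Q. \<forall>y'\<in>?Q. y = y'" by blast
  moreover have "finite ?Q" using finY by (rule finite_subset[rotated]) blast
  ultimately have cQ: "card ?Q \<le> 1" unfolding One_nat_def by (subst card_le_Suc0_iff_eq)
  have Q: "(\<Sum>y\<in>?Q. step_weight (?x y) n) \<le> card ?Q"
    using sum_bounded_above[of ?Q "\<lambda>y. step_weight (?x y) n" 1] by (auto simp: step_weight_def fr)
  have dz: "0 < real (branching z)" using branching(1)[of z] by simp
  have contc: "continuing (?x y) n = continuing (nth ys) n" for y
    unfolding continuing_def using fresh_cong[of "n - 1" "?x y" "nth ys"] len by (cases n) (auto simp: nth_append)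
  have "(\<Sum>y\<in>?Y. step_weight (?x y) n) \<le> 1 + 3 / L"
  proof (cases "continuing (nth ys) n")
    case True
    then obtain m where m: "n = Suc m" "n \<noteq> h" "fresh (nth ys) m" by (cases n) (auto simp: continuing_def)
    have "?Q = {}"
    proof (rule ccontr)
      assume "?Q \<noteq> {}"
      then obtain y where "y \<in> ?Q" by blast
      then have "predicted (?x y) m" using Q1 m by auto
      then have "\<not> fresh (?x y) m" using fresh_not_predicted by blast
      then show False using m fresh_cong[of m "?x y" "nth ys"] len by (auto simp: nth_append)
    qed
    then have Q0: "(\<Sum>y\<in>?Q. step_weight (?x y) n) = 0" by (simp only: sum.empty)
    have Fsub: "?F \<subseteq> {y. E z y} - {ys ! m}"
    proof -
      have "y \<noteq> ys ! m" if "y \<notin> set ys" for y using that len m by auto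
      then show ?thesis using Yn by blast
    qed
    have zm: "E z (ys ! m)" using ys m sym by (auto simp: walks_def z_def)
    have "card ?F \<le> card ({y. E z y} - {ys ! m})" using fin Fsub by (intro card_mono) auto
    also have "\<dots> \<le> branching z" using zm branching(2)[of z] fin[of z] by (simp add: card_Diff_singleton)
    finally have "card ?F \<le> branching z" .
    have "(\<Sum>y\<in>?F. step_weight (?x y) n) = (\<Sum>y\<in>?F. 1 / branching z)"
      by (intro sum.cong refl) (use True in \<open>auto simp: step_weight_def fr contc xz\<close>)
    also have "\<dots> = card ?F / branching z" by simp
    also have "\<dots> \<le> 1" using \<open>card ?F \<le> branching z\<close> dz by simp
    finally have "(\<Sum>y\<in>?F. step_weight (?x y) n) \<le> 1" .
    moreover have "1 / real L \<le> 3 / L" using Lp by (simp add: divide_right_mono)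
    ultimately show ?thesis using split A Q0 by linarith
  next
    case False
    have "card ?F \<le> card {y. E z y}" using fin Yn by (intro card_mono) auto
    also have "\<dots> \<le> 2 * branching z" using branching[of z] by linarith
    finally have cF: "card ?F \<le> 2 * branching z" .
    have "(\<Sum>y\<in>?F. step_weight (?x y) n) = (\<Sum>y\<in>?F. 1 / (L * branching z))"
      by (intro sum.cong refl) (use False in \<open>auto simp: step_weight_def fr contc xz\<close>)
    also have "\<dots> = card ?F / (L * branching z)" by simp
    also have "\<dots> \<le> 2 * real (branching z) / (L * branching z)" using cF dz Lp by (intro divide_right_mono) (simp_all flip: of_nat_mult)
    also have "\<dots> = 2 / L" using dz Lp by simp
    finally have "(\<Sum>y\<in>?F. step_weight (?x y) n) \<le> 2 / L" .
    moreover have "(\<Sum>y\<in>?Q. step_weight (?x y) n) \<le> 1" using Q cQ by linarith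
    moreover have "3 / real L = 2 / L + 1 / L" by (simp add: add_divide_distrib[symmetric])
    ultimately show ?thesis using split A by linarith
  qed
  then show ?thesis using finY by blast
qed

lemma walks_kraft:
  assumes "finite R"
  shows "finite (walks R L) \<and> (\<Sum>xs\<in>walks R L. \<Prod>i<L. step_weight (nth xs) i) \<le> card R * exp 3"
proof -
  define wt where "wt zs = step_weight (nth zs) (length zs - 2)" for zs
  have len: "length xs = Suc n" if "xs \<in> walks R n" for n xs using that by (simp add: walks_def)
  have W0: "walks R 0 = (\<lambda>v. [v]) ` R"
    by (auto simp: walks_def nbwalk_def length_Suc_conv)
  have fin0: "finite (walks R 0)" using W0 assms by simp
  have step: "butlast xs \<in> walks R n" if "xs \<in> walks R (Suc n)" for n xs
  proof -
    have l: "length xs = Suc (Suc n)" using that by (rule len)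
    have nth: "butlast xs ! i = xs ! i" if "i \<le> n" for i using that l by (simp add: nth_butlast)
    show ?thesis using that l nth unfolding walks_def nbwalk_def by auto
  qed
  have loc: "finite {y. ys @ [y] \<in> walks R (Suc n)} \<and> (\<Sum>y | ys @ [y] \<in> walks R (Suc n). wt (ys @ [y])) \<le> 1 + 3 / L"
    if "n < L" "ys \<in> walks R n" for n ys
    using local_sum[OF that] len[OF that(2)] by (simp add: wt_def)
  have k: "finite (walks R L) \<and> (\<Sum>xs\<in>walks R L. \<Prod>i<L. wt (take (i + 2) xs)) \<le> card (walks R 0) * (1 + 3 / L) ^ L"
    by (rule kraft_sum[where N = L and n = L and W = "walks R" and B = "1 + 3 / real L"]) (use fin0 step len loc step_weight_pos in \<open>auto simp: wt_def intro: less_imp_le\<close>)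
  have "(\<Sum>xs\<in>walks R L. \<Prod>i<L. wt (take (i + 2) xs)) = (\<Sum>xs\<in>walks R L. \<Prod>i<L. step_weight (nth xs) i)"
  proof (intro sum.cong prod.cong refl)
    fix xs i assume "xs \<in> walks R L" "i \<in> {..<L}"
    then have "length xs = Suc L" "i < L" using len by auto
    then have "length (take (i + 2) xs) - 2 = i" by simp
    then show "wt (take (i + 2) xs) = step_weight (nth xs) i" unfolding wt_def
      by (auto intro!: step_weight_cong)
  qed
  moreover have "card (walks R 0) = card R" unfolding W0 by (rule card_image) (auto simp: inj_on_def)
  moreover have "(1 + 3 / real L) ^ L \<le> exp (3 / real L) ^ L" by (intro power_mono) auto
  moreover have "exp (3 / real L) ^ L = exp 3" using L by (simp flip: exp_of_nat_mult)
  ultimately show ?thesis using k by (metis (no_types, lifting) mult_left_mono of_nat_0_le_iff order_trans)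
qed

definition branching_ratio :: real where "branching_ratio = sqrt (q / r)"
definition branching_mean :: real where "branching_mean = sqrt (q * r)"

lemma branching_ratio: "1 \<le> branching_ratio" "branching_ratio * branching_mean = q" "branching_mean = r * branching_ratio" "1 \<le> branching_mean"
proof -
  have rp: "0 < real r" using r by simp
  show "1 \<le> branching_ratio" unfolding branching_ratio_def using r rp by simp
  show "branching_ratio * branching_mean = q" unfolding branching_ratio_def branching_mean_def real_sqrt_mult[symmetric] using rp by (simp add: real_sqrt_mult_self)
  have "real q * real r = (real r)\<^sup>2 * (q / r)" using rp by (simp add: power2_eq_square)
  then have "branching_mean = sqrt ((real r)\<^sup>2 * (q / r))" unfolding branching_mean_def by simp
  also have "\<dots> = r * branching_ratio" unfolding branching_ratio_def by (subst real_sqrt_mult) simp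
  finally show "branching_mean = r * branching_ratio" .
  show "1 \<le> branching_mean" unfolding branching_mean_def using r by (simp flip: of_nat_mult)
qed

text \<open>Fresh steps from the two sides cost \<open>q\<close> and \<open>r\<close> in alternation; the factor
  \<open>branching_ratio\<close> on the left records an unmatched step of the cheaper kind in the current run.\<close>
lemma cost_bound:
  assumes E: "\<And>i. i < n \<Longrightarrow> E (x i) (x (Suc i))"
  shows "(\<Prod>i<n. 1 / step_weight x i) * (if n \<noteq> 0 \<and> fresh x (n - 1) \<and> sd (x n) then branching_ratio else 1)
    \<le> branching_mean ^ card {i. i < n \<and> fresh x i} * (branching_ratio * L) ^ card {i. i < n \<and> fresh x i \<and> \<not> continuing x i}
       * ((real L)\<^sup>2) ^ card {i. i < n \<and> annotated x i}"
  using assms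
proof (induction n)
  case 0
  then show ?case by simp
next
  case (Suc n)
  have ins: "card {i. i < Suc n \<and> P i} = (if P n then Suc (card {i. i < n \<and> P i}) else card {i. i < n \<and> P i})" for P
  proof -
    have "{i. i < Suc n \<and> P i} = (if P n then insert n {i. i < n \<and> P i} else {i. i < n \<and> P i})"
      by (auto simp: less_Suc_eq)
    then show ?thesis by simp
  qed
  let ?rhs = "branching_mean ^ card {i. i < n \<and> fresh x i} * (branching_ratio * L) ^ card {i. i < n \<and> fresh x i \<and> \<not> continuing x i}
       * ((real L)\<^sup>2) ^ card {i. i < n \<and> annotated x i}"
  let ?b = "if n \<noteq> 0 \<and> fresh x (n - 1) \<and> sd (x n) then branching_ratio else 1"
  let ?c = "\<Prod>i<n. 1 / step_weight x i"
  have IH: "?c * ?b \<le> ?rhs" using Suc by simp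
  have b1: "1 \<le> ?b" using branching_ratio by simp
  have cpos: "0 \<le> ?c" by (intro prod_nonneg) (auto intro: less_imp_le step_weight_pos)
  have c: "?c \<le> ?rhs" using IH b1 cpos using mult_left_mono[OF b1 cpos] by linarith
  have rhs: "0 \<le> ?rhs" using c cpos by linarith
  have side': "sd (x (Suc n)) = (\<not> sd (x n))" using side[of "x n" "x (Suc n)"] Suc.prems[of n] by auto
  have Lp: "1 \<le> real L" using L by simp
  have r0: "0 < real r" using r by simp
  consider (continuing) "fresh x n" "continuing x n" | (start) "fresh x n" "\<not> continuing x n"
    | (ann) "\<not> fresh x n" "annotated x n" | (pred) "\<not> fresh x n" "\<not> annotated x n" by blast
  then show ?case
  proof cases
    case continuing
    have na: "\<not> annotated x n" using continuing by (simp add: annotated_def)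
    have key: "branching (x n) * (if sd (x (Suc n)) then branching_ratio else 1) = branching_mean * ?b"
      using continuing side' branching_ratio by (auto simp: branching_def continuing_def mult.commute)
    have "?c * (1 / step_weight x n) * (if sd (x (Suc n)) then branching_ratio else 1) = ?c * ?b * branching_mean"
      using continuing key by (simp add: step_weight_def mult.assoc mult.commute)
    also have "\<dots> \<le> ?rhs * branching_mean" using IH branching_ratio by (intro mult_right_mono) auto
    finally show ?thesis using continuing na by (simp add: ins mult_ac)
  next
    case start
    have na: "\<not> annotated x n" using start by (simp add: annotated_def)
    have key: "branching (x n) * (if sd (x (Suc n)) then branching_ratio else 1) \<le> branching_mean * branching_ratio"
    proof (cases "sd (x n)")
      case True
      then show ?thesis using side' branching_ratio(2) by (simp add: branching_def mult.commute)
    next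
      case False
      have "branching_mean * 1 \<le> branching_mean * branching_ratio" using branching_ratio by (intro mult_left_mono) auto
      then show ?thesis using False side' branching_ratio(3) by (simp add: branching_def)
    qed
    have "?c * (1 / step_weight x n) * (if sd (x (Suc n)) then branching_ratio else 1) = ?c * (L * (branching (x n) * (if sd (x (Suc n)) then branching_ratio else 1)))"
      using start by (simp add: step_weight_def mult.assoc)
    also have "\<dots> \<le> ?rhs * (L * (branching_mean * branching_ratio))"
    proof (rule mult_mono[OF c _ rhs])
      show "L * (branching (x n) * (if sd (x (Suc n)) then branching_ratio else 1)) \<le> L * (branching_mean * branching_ratio)"
        by (rule mult_left_mono[OF key]) simp
      show "0 \<le> L * (branching (x n) * (if sd (x (Suc n)) then branching_ratio else 1))" using branching_ratio(1) by simp
    qed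
    finally show ?thesis using start na by (simp add: ins mult_ac)
  next
    case ann
    have "?c * (1 / step_weight x n) = ?c * (real L)\<^sup>2" using ann by (simp add: step_weight_def)
    also have "\<dots> \<le> ?rhs * (real L)\<^sup>2" using c by (intro mult_right_mono) auto
    finally show ?thesis using ann by (simp add: ins mult_ac)
  next
    case pred
    then show ?thesis using c by (simp add: ins step_weight_def)
  qed
qed

text \<open>Nothing is predicted right after a fresh step, so a run of fresh steps can end only with
  an annotated step. The two extra terms account for a run still open at \<open>n\<close> and for
  the restart at the joint.\<close>

lemma starts_bound:
  "card {i. i < n \<and> fresh x i \<and> \<not> continuing x i} \<le> card {i. i < n \<and> annotated x i}
     + (if n \<noteq> 0 \<and> fresh x (n - 1) then 1 else 0) + (if h < n then 1 else 0)"
proof (induction n)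
  case 0
  then show ?case by simp
next
  case (Suc n)
  have ins: "card {i. i < Suc n \<and> P i} = (if P n then Suc (card {i. i < n \<and> P i}) else card {i. i < n \<and> P i})" for P
  proof -
    have "{i. i < Suc n \<and> P i} = (if P n then insert n {i. i < n \<and> P i} else {i. i < n \<and> P i})"
      by (auto simp: less_Suc_eq)
    then show ?thesis by simp
  qed
  have "annotated x n" if "n \<noteq> 0" "fresh x (n - 1)" "\<not> fresh x n"
    using that fresh_not_predicted[of x "n - 1"] by (auto simp: annotated_def)
  moreover have "\<not> annotated x n" if "fresh x n" using that by (simp add: annotated_def)
  ultimately show ?case using Suc unfolding ins by (cases "h = n") (auto simp: continuing_def split: if_splits)
qed

lemma total_cost:
  assumes E: "\<And>i. i < L \<Longrightarrow> E (x i) (x (Suc i))"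
  shows "(\<Prod>i<L. 1 / step_weight x i) \<le> branching_mean ^ card {i. i < L \<and> fresh x i} * (branching_ratio * real L ^ 3) ^ (card {i. i < L \<and> annotated x i} + 2)"
proof -
  let ?F = "card {i. i < L \<and> fresh x i}" and ?R = "card {i. i < L \<and> fresh x i \<and> \<not> continuing x i}"
    and ?A = "card {i. i < L \<and> annotated x i}"
  have Lp: "1 \<le> real L" using L by simp
  have cpos: "0 \<le> (\<Prod>i<L. 1 / step_weight x i)" by (intro prod_nonneg) (auto intro: less_imp_le step_weight_pos)
  have kL: "1 \<le> branching_ratio * real L" using branching_ratio(1) Lp by (metis mult_mono' mult_1 zero_le_one)
  have "(\<Prod>i<L. 1 / step_weight x i) * 1 \<le> (\<Prod>i<L. 1 / step_weight x i) * (if L \<noteq> 0 \<and> fresh x (L - 1) \<and> sd (x L) then branching_ratio else 1)"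
    using branching_ratio(1) cpos by (intro mult_left_mono) auto
  also have "\<dots> \<le> branching_mean ^ ?F * (branching_ratio * L) ^ ?R * ((real L)\<^sup>2) ^ ?A" by (rule cost_bound[of L x, OF E])
  also have "\<dots> \<le> branching_mean ^ ?F * (branching_ratio * L) ^ (?A + 2) * ((real L)\<^sup>2) ^ (?A + 2)"
  proof (intro mult_mono power_increasing order_refl)
    show "?R \<le> ?A + 2" using starts_bound[of L x] by (auto split: if_splits)
  qed (use kL Lp branching_ratio in auto)
  also have "\<dots> = branching_mean ^ ?F * (branching_ratio * real L ^ 3) ^ (?A + 2)"
    by (simp add: power_mult_distrib[symmetric] power2_eq_square power3_eq_cube mult_ac)
  finally show ?thesis by simp
qed

text \<open>A walk of cost at most M has weight at least 1 / M in the Kraft sum, so there are at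
  most M times that sum of them.\<close>

theorem walk_count:
  assumes R: "finite R" and X: "X \<subseteq> walks R L" and M: "0 < M"
    and cost: "\<And>xs. xs \<in> X \<Longrightarrow> branching_mean ^ card {i. i < L \<and> fresh (nth xs) i} *
      (branching_ratio * real L ^ 3) ^ (card {i. i < L \<and> annotated (nth xs) i} + 2) \<le> M"
  shows "real (card X) \<le> exp 3 * card R * M"
proof -
  have finW: "finite (walks R L)" using walks_kraft[OF R] by blast
  have "card X / M = (\<Sum>xs\<in>X. 1 / M)" by simp
  also have "\<dots> \<le> (\<Sum>xs\<in>X. \<Prod>i<L. step_weight (nth xs) i)"
  proof (rule sum_mono)
    fix xs assume xs: "xs \<in> X"
    have "(\<Prod>i<L. 1 / step_weight (nth xs) i) \<le> M"
      by (rule order_trans[OF total_cost cost[OF xs]]) (use xs X in \<open>auto simp: walks_def\<close>)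
    moreover have "0 < (\<Prod>i<L. step_weight (nth xs) i)" by (intro prod_pos) (auto intro: step_weight_pos)
    ultimately show "1 / M \<le> (\<Prod>i<L. step_weight (nth xs) i)" using M by (simp add: prod_dividef field_simps)
  qed
  also have "\<dots> \<le> (\<Sum>xs\<in>walks R L. \<Prod>i<L. step_weight (nth xs) i)"
    using X finW by (intro sum_mono2) (auto intro!: prod_nonneg intro: less_imp_le step_weight_pos)
  also have "\<dots> \<le> card R * exp 3" using walks_kraft[OF R] by blast
  finally show ?thesis using M by (simp add: field_simps)
qed

end

section \<open>Closed walks without singly traversed edges, in the two regimes\<close>

context bipartite_bounded
begin

definition closed_walks :: "'v set \<Rightarrow> 'v list set" where
  "closed_walks R = {xs \<in> walks R L. xs ! L = xs ! 0 \<and> singleton_free L (nth xs)}"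

definition step_cost :: real where "step_cost = branching_ratio * real L ^ 3"

lemma step_cost: "1 \<le> step_cost"
proof -
  have "1 \<le> real L ^ 3" using L by simp
  then show ?thesis unfolding step_cost_def using branching_ratio(1) mult_mono[of 1 branching_ratio 1 "real L ^ 3"] by simp
qed

lemma closed_walk_facts:
  assumes xs: "xs \<in> closed_walks R" and Lh: "L = 2 * h"
  shows "nbwalk h L (nth xs)" "(nth xs) L = (nth xs) 0" "singleton_free L (nth xs)"
    "card (step_edge (nth xs) ` {..<L}) \<le> h"
    "Suc (card {i. i < L \<and> fresh (nth xs) i}) = card (nth xs ` {..L})"
    "card (nth xs ` {..L}) \<le> Suc (card (step_edge (nth xs) ` {..<L}))"
proof -
  show *: "nbwalk h L (nth xs)" "(nth xs) L = (nth xs) 0" "singleton_free L (nth xs)"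
    using xs by (auto simp: closed_walks_def walks_def)
  show "card (step_edge (nth xs) ` {..<L}) \<le> h" using card_third[OF *(3)] Lh by linarith
  show "Suc (card {i. i < L \<and> fresh (nth xs) i}) = card (nth xs ` {..L})" by (simp add: card_vertices_fresh)
  show "card (nth xs ` {..L}) \<le> Suc (card (step_edge (nth xs) ` {..<L}))" using card_boundary_step[of L "nth xs"] by linarith
qed

text \<open>Fresh steps, independent cycles and edges missing from \<open>h\<close> add up to
  exactly \<open>h\<close>. A cycle brings 8 annotations and a missing edge 2, and
  \<open>step_cost ^ 8 \<le> branching_mean\<close> lets the displaced fresh step pay for them; 6
  annotations remain.\<close>

theorem closed_walks_dense:
  assumes R: "finite R" and Lh: "L = 2 * h" and big: "step_cost ^ 8 \<le> branching_mean"
  shows "real (card (closed_walks R)) \<le> exp 3 * card R * (branching_mean ^ h * step_cost ^ 6)"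
proof (rule walk_count[OF R])
  have h0: "0 < h" using Lh L by simp
  show "closed_walks R \<subseteq> walks R L" by (auto simp: closed_walks_def)
  show "0 < branching_mean ^ h * step_cost ^ 6" using step_cost branching_ratio(4) by (intro mult_pos_pos zero_less_power) auto
  fix xs assume xs: "xs \<in> closed_walks R"
  note f = closed_walk_facts[OF xs Lh]
  let ?e = "card (step_edge (nth xs) ` {..<L})" and ?v = "card (nth xs ` {..L})"
    and ?F = "card {i. i < L \<and> fresh (nth xs) i}" and ?A = "card {i. i < L \<and> annotated (nth xs) i}"
  have "?A + 2 * ?e \<le> 8 * (?e + 1 - ?v) + L + 4" by (rule annotated_bound_dense[OF f(1) Lh h0 f(2,3)])
  then have A: "?A + 2 \<le> 8 * (?e + 1 - ?v) + 2 * (h - ?e) + 6" using Lh f(4) by linarith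
  have g2: "step_cost\<^sup>2 \<le> branching_mean" using power_increasing[of 2 8 step_cost] step_cost big by simp
  have "branching_mean ^ ?F * step_cost ^ (?A + 2) \<le> branching_mean ^ ?F * step_cost ^ (8 * (?e + 1 - ?v) + 2 * (h - ?e) + 6)"
    using step_cost branching_ratio(4) A by (intro mult_left_mono power_increasing) auto
  also have "\<dots> = branching_mean ^ ?F * ((step_cost ^ 8) ^ (?e + 1 - ?v) * (step_cost\<^sup>2) ^ (h - ?e) * step_cost ^ 6)"
    by (simp add: power_add power_mult)
  also have "\<dots> \<le> branching_mean ^ ?F * (branching_mean ^ (?e + 1 - ?v) * branching_mean ^ (h - ?e) * step_cost ^ 6)"
    using step_cost branching_ratio(4) big g2 by (intro mult_left_mono mult_mono power_mono order_refl) auto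
  also have "\<dots> = branching_mean ^ (?F + (?e + 1 - ?v) + (h - ?e)) * step_cost ^ 6" by (simp add: power_add)
  also have "?F + (?e + 1 - ?v) + (h - ?e) = h" using f(4,5,6) by linarith
  finally show "branching_mean ^ ?F * (branching_ratio * real L ^ 3) ^ (?A + 2) \<le> branching_mean ^ h * step_cost ^ 6" by (simp add: step_cost_def)
qed

definition cycle_sparse_cycles :: "nat \<Rightarrow> nat \<Rightarrow> bool" where
  "cycle_sparse_cycles n g \<longleftrightarrow> (\<forall>x. (\<forall>i<n. E (x i) (x (Suc i))) \<longrightarrow> card (step_edge x ` {..<n}) + 1 \<le> card (x ` {..n}) + g)"

text \<open>No trade against fresh steps takes place here: they are bounded by \<open>h\<close>, and
  all annotations are paid in full. The exponent will be of order (ln n)^(3/4), with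
  \<open>L div l\<close> of order sqrt (ln n) and \<open>g\<close> about (ln n)^(1/4).\<close>

theorem closed_walks_sparse:
  assumes R: "finite R" and Lh: "L = 2 * h" "l dvd h" "0 < l"
    and g: "cycle_sparse_cycles L g" and g1: "cycle_sparse_cycles l 1"
  shows "real (card (closed_walks R)) \<le> exp 3 * card R * (branching_mean ^ h * step_cost ^ (2 * g + 6 + (L div l) * (2 * g + 4)))"
proof (rule walk_count[OF R])
  have h0: "0 < h" using Lh L by simp
  show "closed_walks R \<subseteq> walks R L" by (auto simp: closed_walks_def)
  show "0 < branching_mean ^ h * step_cost ^ (2 * g + 6 + (L div l) * (2 * g + 4))" using step_cost branching_ratio(4) by (intro mult_pos_pos zero_less_power) auto
  fix xs assume xs: "xs \<in> closed_walks R"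
  note f = closed_walk_facts[OF xs Lh(1)]
  let ?F = "card {i. i < L \<and> fresh (nth xs) i}" and ?A = "card {i. i < L \<and> annotated (nth xs) i}"
  have E: "E (xs ! i) (xs ! Suc i)" if "i < L" for i using xs that by (auto simp: closed_walks_def walks_def)
  have win: "card (step_edge (nth xs) ` {s..<s + l}) \<le> card (nth xs ` {s..s + l})" if "s + l \<le> L" for s
  proof -
    let ?y = "\<lambda>i. xs ! (s + i)"
    have "card (step_edge ?y ` {..<l}) + 1 \<le> card (?y ` {..l}) + 1"
      using g1 E that unfolding cycle_sparse_cycles_def by (elim allE[of _ ?y]) auto
    moreover have "step_edge ?y ` {..<l} = step_edge (nth xs) ` {s..<s + l}"
    proof -
      have "{s..<s + l} = (\<lambda>i. s + i) ` {..<l}" by (simp add: lessThan_atLeast0 add.commute)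
      then show ?thesis by (simp add: image_image step_edge_shift)
    qed
    moreover have "?y ` {..l} = nth xs ` {s..s + l}"
    proof -
      have "{s..s + l} = (\<lambda>i. s + i) ` {..l}" by (simp add: atMost_atLeast0 add.commute)
      then show ?thesis by (simp add: image_image)
    qed
    ultimately show ?thesis by simp
  qed
  have gv: "card (step_edge (nth xs) ` {..<L}) + 1 \<le> card (nth xs ` {..L}) + g"
    using g E unfolding cycle_sparse_cycles_def by blast
  have "?A \<le> 2 * g + 4 + (L div l) * (2 * g + 4)"
    by (rule annotated_bound_sparse[OF f(1) Lh(1) h0 Lh(2,3) f(2) win gv])
  then have A: "?A + 2 \<le> 2 * g + 6 + (L div l) * (2 * g + 4)" by simp
  have F: "?F \<le> h" using f(4,5,6) by linarith
  have "branching_mean ^ ?F * step_cost ^ (?A + 2) \<le> branching_mean ^ h * step_cost ^ (2 * g + 6 + (L div l) * (2 * g + 4))"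
    using step_cost branching_ratio(4) A F by (intro mult_mono power_increasing) auto
  then show "branching_mean ^ ?F * (branching_ratio * real L ^ 3) ^ (?A + 2) \<le> branching_mean ^ h * step_cost ^ (2 * g + 6 + (L div l) * (2 * g + 4))"
    by (simp add: step_cost_def)
qed

end

section \<open>Non-backtracking walk sums of a signed graph\<close>

lemma cauchy_schwarz_sum:
  fixes f g :: "'a \<Rightarrow> real"
  assumes "finite S"
  shows "(\<Sum>x\<in>S. f x * g x)\<^sup>2 \<le> (\<Sum>x\<in>S. (f x)\<^sup>2) * (\<Sum>x\<in>S. (g x)\<^sup>2)"
proof -
  have "0 \<le> (\<Sum>x\<in>S. \<Sum>y\<in>S. (f x * g y - f y * g x)\<^sup>2)" by (intro sum_nonneg) auto
  also have "\<dots> = (\<Sum>x\<in>S. \<Sum>y\<in>S. (f x)\<^sup>2 * (g y)\<^sup>2 + (f y)\<^sup>2 * (g x)\<^sup>2 - 2 * ((f x * g x) * (f y * g y)))"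
    by (intro sum.cong refl) (simp add: power2_eq_square algebra_simps)
  also have "\<dots> = (\<Sum>x\<in>S. \<Sum>y\<in>S. (f x)\<^sup>2 * (g y)\<^sup>2) + (\<Sum>x\<in>S. \<Sum>y\<in>S. (f y)\<^sup>2 * (g x)\<^sup>2)
     - 2 * (\<Sum>x\<in>S. \<Sum>y\<in>S. (f x * g x) * (f y * g y))"
    by (simp add: sum.distrib sum_subtractf sum_distrib_left)
  also have "(\<Sum>x\<in>S. \<Sum>y\<in>S. (f y)\<^sup>2 * (g x)\<^sup>2) = (\<Sum>x\<in>S. \<Sum>y\<in>S. (f x)\<^sup>2 * (g y)\<^sup>2)" by (rule sum.swap)
  also have "(\<Sum>x\<in>S. \<Sum>y\<in>S. (f x)\<^sup>2 * (g y)\<^sup>2) = (\<Sum>x\<in>S. (f x)\<^sup>2) * (\<Sum>x\<in>S. (g x)\<^sup>2)" by (simp add: sum_product)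
  also have "(\<Sum>x\<in>S. \<Sum>y\<in>S. (f x * g x) * (f y * g y)) = (\<Sum>x\<in>S. f x * g x)\<^sup>2" by (simp add: sum_product power2_eq_square)
  finally show ?thesis by simp
qed

fun nonback :: "'v list \<Rightarrow> bool" where
  "nonback (x # y # z # zs) \<longleftrightarrow> x \<noteq> z \<and> nonback (y # z # zs)"
| "nonback _ \<longleftrightarrow> True"

fun weight :: "('v \<Rightarrow> 'v \<Rightarrow> real) \<Rightarrow> 'v list \<Rightarrow> real" where
  "weight a (x # y # zs) = a x y * weight a (y # zs)"
| "weight a _ = 1"

lemma nonback_nth: "nonback xs \<longleftrightarrow> (\<forall>i. i + 2 < length xs \<longrightarrow> xs ! i \<noteq> xs ! (i + 2))"
proof (induction xs rule: nonback.induct)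
  case (1 x y z zs)
  have "(\<forall>i. i + 2 < length (x # y # z # zs) \<longrightarrow> (x # y # z # zs) ! i \<noteq> (x # y # z # zs) ! (i + 2)) \<longleftrightarrow>
    x \<noteq> z \<and> (\<forall>i. Suc i + 2 < length (x # y # z # zs) \<longrightarrow> (x # y # z # zs) ! Suc i \<noteq> (x # y # z # zs) ! (Suc i + 2))"
  proof (intro iffI conjI allI impI)
    fix i assume *: "x \<noteq> z \<and> (\<forall>i. Suc i + 2 < length (x # y # z # zs) \<longrightarrow> (x # y # z # zs) ! Suc i \<noteq> (x # y # z # zs) ! (Suc i + 2))"
      and i: "i + 2 < length (x # y # z # zs)"
    show "(x # y # z # zs) ! i \<noteq> (x # y # z # zs) ! (i + 2)"
    proof (cases i)
      case (Suc j)
      then show ?thesis using * i by blast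
    qed (use * in simp)
  next
    assume *: "\<forall>i. i + 2 < length (x # y # z # zs) \<longrightarrow> (x # y # z # zs) ! i \<noteq> (x # y # z # zs) ! (i + 2)"
    show "x \<noteq> z" using *[rule_format, of 0] by simp
    fix i assume "Suc i + 2 < length (x # y # z # zs)"
    then show "(x # y # z # zs) ! Suc i \<noteq> (x # y # z # zs) ! (Suc i + 2)" using * by blast
  qed
  then show ?case using 1 by simp
qed auto

lemma weight_nth: "weight a xs = (\<Prod>i<length xs - 1. a (xs ! i) (xs ! Suc i))"
proof (induction a xs rule: weight.induct)
  case (1 a x y zs)
  have "(\<Prod>i<length (x # y # zs) - 1. a ((x # y # zs) ! i) ((x # y # zs) ! Suc i)) =
    a x y * (\<Prod>i<length zs. a ((y # zs) ! i) ((y # zs) ! Suc i))"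
    by (simp add: prod.lessThan_Suc_shift del: prod.lessThan_Suc)
  then show ?case using 1 by simp
qed auto

text \<open>The identity a^3 = a, that is a \<in> {0, 1, -1}, lets an edge run back and forth be
  cancelled against a further use of the same edge.\<close>

locale weighted_graph =
  fixes V :: "'v set" and a :: "'v \<Rightarrow> 'v \<Rightarrow> real" and D :: "'v \<Rightarrow> real"
  assumes finV: "finite V" and sym: "a x y = a y x"
    and cube: "a x y * a x y * a x y = a x y"
    and degree: "x \<in> V \<Longrightarrow> (\<Sum>y\<in>V. a x y * a x y) = D x"
begin

text \<open>The lists need not follow edges; a non-edge makes the weight vanish. So the index sets
  do not depend on \<open>a\<close>, and sums over several matrices can be interchanged with sums
  over walks.\<close>

definition nb_lists :: "nat \<Rightarrow> 'v \<Rightarrow> 'v list set" where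
  "nb_lists k x = {xs. length xs = Suc k \<and> set xs \<subseteq> V \<and> hd xs = x \<and> nonback xs}"

lemma finite_nb_lists: "finite (nb_lists k x)"
  by (rule finite_subset[OF _ finite_lists_length_eq[OF finV, of "Suc k"]]) (auto simp: nb_lists_def)

definition nbsum :: "nat \<Rightarrow> ('v \<Rightarrow> real) \<Rightarrow> 'v \<Rightarrow> real" where
  "nbsum k f x = (\<Sum>xs\<in>nb_lists k x. weight a xs * f (last xs))"

lemma nb_lists_0: "nb_lists 0 x = (if x \<in> V then {[x]} else {})"
  by (auto simp: nb_lists_def length_Suc_conv)

lemma nbsum_0: "x \<in> V \<Longrightarrow> nbsum 0 f x = f x"
  by (simp add: nbsum_def nb_lists_0)

lemma nb_lists_Cons: "nb_lists (Suc k) x = (if x \<in> V then (\<lambda>xs. x # xs) ` (\<Union>y\<in>V. {xs \<in> nb_lists k y. k = 0 \<or> xs ! 1 \<noteq> x}) else {})"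
proof -
  have "xs \<in> nb_lists (Suc k) x \<longleftrightarrow> x \<in> V \<and> (\<exists>y\<in>V. \<exists>zs. xs = x # zs \<and> zs \<in> nb_lists k y \<and> (k = 0 \<or> zs ! 1 \<noteq> x))" for xs
  proof (cases xs)
    case (Cons b zs)
    then show ?thesis
      by (cases zs; cases "tl zs") (auto simp: nb_lists_def)
  qed (auto simp: nb_lists_def)
  then show ?thesis by (intro Set.set_eqI) (simp only: image_iff UN_iff mem_Collect_eq, auto)
qed

lemma nbsum_Suc:
  assumes x: "x \<in> V"
  shows "nbsum (Suc k) f x = (\<Sum>y\<in>V. \<Sum>xs\<in>{xs \<in> nb_lists k y. k = 0 \<or> xs ! 1 \<noteq> x}. a x y * (weight a xs * f (last xs)))"
proof -
  let ?S = "\<lambda>y. {xs \<in> nb_lists k y. k = 0 \<or> xs ! 1 \<noteq> x}"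
  have "nbsum (Suc k) f x = (\<Sum>xs\<in>(\<Union>y\<in>V. ?S y). weight a (x # xs) * f (last (x # xs)))"
    unfolding nbsum_def nb_lists_Cons using x by (simp add: sum.reindex)
  also have "\<dots> = (\<Sum>y\<in>V. \<Sum>xs\<in>?S y. weight a (x # xs) * f (last (x # xs)))"

  proof (rule sum.UNION_disjoint[OF finV])
    show "\<forall>y\<in>V. finite (?S y)" using finite_nb_lists by simp
    show "\<forall>i\<in>V. \<forall>j\<in>V. i \<noteq> j \<longrightarrow> ?S i \<inter> ?S j = {}" by (auto simp: nb_lists_def)
  qed
  also have "\<dots> = (\<Sum>y\<in>V. \<Sum>xs\<in>?S y. a x y * (weight a xs * f (last xs)))"
  proof (rule sum.cong[OF refl], rule sum.cong[OF refl])
    fix y xs assume "xs \<in> ?S y"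
    then obtain zs where "xs = y # zs" by (cases xs) (auto simp: nb_lists_def)
    then show "weight a (x # xs) * f (last (x # xs)) = a x y * (weight a xs * f (last xs))" by simp
  qed
  finally show ?thesis .
qed

lemma nbsum_1: "x \<in> V \<Longrightarrow> nbsum 1 f x = (\<Sum>y\<in>V. a x y * f y)"
  using nbsum_Suc[of x 0 f] by (simp add: nb_lists_0)

lemma nbsum_split:
  assumes x: "x \<in> V"
  shows "(\<Sum>y\<in>V. a x y * nbsum (Suc k) f y) = nbsum (Suc (Suc k)) f x +
    (\<Sum>y\<in>V. \<Sum>xs\<in>{xs \<in> nb_lists (Suc k) y. xs ! 1 = x}. a x y * (weight a xs * f (last xs)))"
proof -
  have "(\<Sum>y\<in>V. a x y * nbsum (Suc k) f y) = (\<Sum>y\<in>V. \<Sum>xs\<in>nb_lists (Suc k) y. a x y * (weight a xs * f (last xs)))"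
    by (simp add: nbsum_def sum_distrib_left)
  also have "\<dots> = (\<Sum>y\<in>V. (\<Sum>xs\<in>{xs \<in> nb_lists (Suc k) y. xs ! 1 \<noteq> x}. a x y * (weight a xs * f (last xs))) +
      (\<Sum>xs\<in>{xs \<in> nb_lists (Suc k) y. xs ! 1 = x}. a x y * (weight a xs * f (last xs))))"
  proof (intro sum.cong refl)
    fix y
    have "nb_lists (Suc k) y = {xs \<in> nb_lists (Suc k) y. xs ! 1 \<noteq> x} \<union> {xs \<in> nb_lists (Suc k) y. xs ! 1 = x}" by blast
    then have "(\<Sum>xs\<in>nb_lists (Suc k) y. a x y * (weight a xs * f (last xs))) =
      (\<Sum>xs\<in>{xs \<in> nb_lists (Suc k) y. xs ! 1 \<noteq> x} \<union> {xs \<in> nb_lists (Suc k) y. xs ! 1 = x}. a x y * (weight a xs * f (last xs)))"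
      by (rule sum.cong) (rule refl)
    also have "\<dots> = (\<Sum>xs\<in>{xs \<in> nb_lists (Suc k) y. xs ! 1 \<noteq> x}. a x y * (weight a xs * f (last xs))) +
      (\<Sum>xs\<in>{xs \<in> nb_lists (Suc k) y. xs ! 1 = x}. a x y * (weight a xs * f (last xs)))"
      using finite_nb_lists by (intro sum.union_disjoint) auto
    finally show "(\<Sum>xs\<in>nb_lists (Suc k) y. a x y * (weight a xs * f (last xs))) = (\<Sum>xs\<in>{xs \<in> nb_lists (Suc k) y. xs ! 1 \<noteq> x}. a x y * (weight a xs * f (last xs))) +
      (\<Sum>xs\<in>{xs \<in> nb_lists (Suc k) y. xs ! 1 = x}. a x y * (weight a xs * f (last xs)))" .
  qed
  also have "\<dots> = nbsum (Suc (Suc k)) f x +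
    (\<Sum>y\<in>V. \<Sum>xs\<in>{xs \<in> nb_lists (Suc k) y. xs ! 1 = x}. a x y * (weight a xs * f (last xs)))"
    unfolding sum.distrib nbsum_Suc[OF x] by simp
  finally show ?thesis .
qed

text \<open>A walk from y whose next vertex is x, entered from x, is a walk from x with the factor
  (a x y)^2 in front. Summation over y gives \<open>D x\<close>, except that for k > 0 the next
  vertex of the remaining walk is omitted; by \<open>cube\<close> that omitted term equals the
  weight itself, hence \<open>D x - 1\<close>.\<close>

lemma back_term:
  assumes x: "x \<in> V"
  shows "(\<Sum>y\<in>V. \<Sum>xs\<in>{xs \<in> nb_lists (Suc k) y. xs ! 1 = x}. a x y * (weight a xs * f (last xs))) =
    (D x - (if k = 0 then 0 else 1)) * nbsum k f x"
proof -
  have im: "{xs \<in> nb_lists (Suc k) y. xs ! 1 = x} = (\<lambda>zs. y # zs) ` {zs \<in> nb_lists k x. k = 0 \<or> zs ! 1 \<noteq> y}" if "y \<in> V" for y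
  proof -
    have "xs \<in> nb_lists (Suc k) y \<and> xs ! 1 = x \<longleftrightarrow> (\<exists>zs. xs = y # zs \<and> zs \<in> nb_lists k x \<and> (k = 0 \<or> zs ! 1 \<noteq> y))" for xs
    proof (cases xs)
      case (Cons b zs)
      then show ?thesis using that
        by (cases zs; cases "tl zs") (auto simp: nb_lists_def)
    qed (auto simp: nb_lists_def)
    then show ?thesis by auto
  qed
  have "(\<Sum>y\<in>V. \<Sum>xs\<in>{xs \<in> nb_lists (Suc k) y. xs ! 1 = x}. a x y * (weight a xs * f (last xs))) =
    (\<Sum>y\<in>V. \<Sum>zs\<in>{zs \<in> nb_lists k x. k = 0 \<or> zs ! 1 \<noteq> y}. a x y * a x y * (weight a zs * f (last zs)))"
  proof (rule sum.cong[OF refl])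
    fix y assume y: "y \<in> V"
    have "(\<Sum>xs\<in>{xs \<in> nb_lists (Suc k) y. xs ! 1 = x}. a x y * (weight a xs * f (last xs))) =
      (\<Sum>zs\<in>{zs \<in> nb_lists k x. k = 0 \<or> zs ! 1 \<noteq> y}. a x y * (weight a (y # zs) * f (last (y # zs))))"
      unfolding im[OF y] by (simp add: sum.reindex)
    also have "\<dots> = (\<Sum>zs\<in>{zs \<in> nb_lists k x. k = 0 \<or> zs ! 1 \<noteq> y}. a x y * a x y * (weight a zs * f (last zs)))"
    proof (intro sum.cong refl)
      fix zs assume "zs \<in> {zs \<in> nb_lists k x. k = 0 \<or> zs ! 1 \<noteq> y}"
      then obtain ws where "zs = x # ws" by (cases zs) (auto simp: nb_lists_def)
      then show "a x y * (weight a (y # zs) * f (last (y # zs))) = a x y * a x y * (weight a zs * f (last zs))"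
        using sym[of x y] by simp
    qed
    finally show "(\<Sum>xs\<in>{xs \<in> nb_lists (Suc k) y. xs ! 1 = x}. a x y * (weight a xs * f (last xs))) =
      (\<Sum>zs\<in>{zs \<in> nb_lists k x. k = 0 \<or> zs ! 1 \<noteq> y}. a x y * a x y * (weight a zs * f (last zs)))" .
  qed
  also have "\<dots> = (\<Sum>y\<in>V. \<Sum>zs\<in>nb_lists k x. if k = 0 \<or> zs ! 1 \<noteq> y then a x y * a x y * (weight a zs * f (last zs)) else 0)"
    by (rule sum.cong[OF refl]) (rule sum.inter_filter[OF finite_nb_lists])
  also have "\<dots> = (\<Sum>zs\<in>nb_lists k x. \<Sum>y\<in>V. if k = 0 \<or> zs ! 1 \<noteq> y then a x y * a x y * (weight a zs * f (last zs)) else 0)"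
    by (rule sum.swap)
  also have "\<dots> = (\<Sum>zs\<in>nb_lists k x. (D x - (if k = 0 then 0 else 1)) * (weight a zs * f (last zs)))"
  proof (intro sum.cong refl)
    fix zs assume zs: "zs \<in> nb_lists k x"
    let ?w = "weight a zs * f (last zs)"
    show "(\<Sum>y\<in>V. if k = 0 \<or> zs ! 1 \<noteq> y then a x y * a x y * ?w else 0) = (D x - (if k = 0 then 0 else 1)) * ?w"
    proof (cases "k = 0")
      case True
      then show ?thesis using degree[OF x] by (simp flip: sum_distrib_right)
    next
      case False
      then obtain y' ws where e: "zs = x # y' # ws" using zs
        by (cases zs; cases "tl zs") (auto simp: nb_lists_def)
      then have y': "y' \<in> V" using zs by (auto simp: nb_lists_def)
      have "(\<Sum>y\<in>V. if k = 0 \<or> zs ! 1 \<noteq> y then a x y * a x y * ?w else 0) = (\<Sum>y\<in>V - {y'}. a x y * a x y * ?w)"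
        by (rule sum.mono_neutral_cong_right) (use finV False e in auto)
      also have "\<dots> = (\<Sum>y\<in>V. a x y * a x y * ?w) - a x y' * a x y' * ?w"
        using finV y' by (simp add: sum_diff1)
      also have "(\<Sum>y\<in>V. a x y * a x y * ?w) = D x * ?w" using degree[OF x] by (simp flip: sum_distrib_right)
      also have "a x y' * a x y' * ?w = ?w" using cube[of x y'] e by auto
      finally show ?thesis using False by (simp add: algebra_simps)
    qed
  qed
  finally show ?thesis by (simp add: nbsum_def sum_distrib_left)
qed

lemma nbsum_rec:
  assumes "x \<in> V"
  shows "nbsum (Suc (Suc k)) f x = (\<Sum>y\<in>V. a x y * nbsum (Suc k) f y) - (D x - (if k = 0 then 0 else 1)) * nbsum k f x"
  using nbsum_split[OF assms, where k = k and f = f] back_term[OF assms, where k = k and f = f] by simp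

definition nbpair :: "nat \<Rightarrow> 'v \<Rightarrow> 'v \<Rightarrow> real" where
  "nbpair k x y = (\<Sum>xs\<in>{xs \<in> nb_lists k x. last xs = y}. weight a xs)"

lemma nbsum_pair: "nbsum k f x = (\<Sum>y\<in>V. nbpair k x y * f y)"
proof -
  have "nbsum k f x = (\<Sum>y\<in>V. \<Sum>xs\<in>{xs \<in> nb_lists k x. last xs = y}. weight a xs * f (last xs))"
    unfolding nbsum_def
  proof (rule sum.group[symmetric])
    show "last ` nb_lists k x \<subseteq> V"
    proof
      fix y assume "y \<in> last ` nb_lists k x"
      then obtain xs where xs: "xs \<in> nb_lists k x" "y = last xs" by blast
      then have "xs \<noteq> []" by (auto simp: nb_lists_def)
      then show "y \<in> V" using xs last_in_set[of xs] by (auto simp: nb_lists_def)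
    qed
  qed (use finV finite_nb_lists in auto)
  also have "\<dots> = (\<Sum>y\<in>V. nbpair k x y * f y)"
    unfolding nbpair_def sum_distrib_right by (intro sum.cong refl) auto
  finally show ?thesis .
qed

lemma nbsum_square_le: "(nbsum k f x)\<^sup>2 \<le> (\<Sum>y\<in>V. (nbpair k x y)\<^sup>2) * (\<Sum>y\<in>V. (f y)\<^sup>2)"
  unfolding nbsum_pair by (rule cauchy_schwarz_sum[OF finV])

end

section \<open>Squared row norms as sums over closed walks\<close>

lemma weight_split: "h < length zs \<Longrightarrow> weight a zs = weight a (take (Suc h) zs) * weight a (drop h zs)"
proof (induction h arbitrary: zs)
  case 0
  then show ?case by (cases zs) auto
next
  case (Suc h)
  obtain x zs' where zs': "zs = x # zs'" using Suc.prems by (cases zs) auto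
  obtain y ws where "zs' = y # ws" using Suc.prems zs' by (cases zs') auto
  then have zs: "zs = x # y # ws" using zs' by simp
  have IH: "weight a (y # ws) = weight a (take (Suc h) (y # ws)) * weight a (drop h (y # ws))"
    by (rule Suc.IH) (use Suc.prems zs in simp)
  have "weight a zs = a x y * weight a (y # ws)" by (simp add: zs)
  also have "\<dots> = (a x y * weight a (take (Suc h) (y # ws))) * weight a (drop h (y # ws))"
    by (simp only: IH mult.assoc)
  also have "a x y * weight a (take (Suc h) (y # ws)) = weight a (take (Suc (Suc h)) zs)" by (simp add: zs)
  also have "drop h (y # ws) = drop (Suc h) zs" by (simp add: zs)
  finally show ?case .
qed

lemma weight_rev:
  assumes "\<And>x y. a x y = a y x" shows "weight a (rev xs) = weight a xs"
proof -
  let ?n = "length xs - 1"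
  have "weight a (rev xs) = (\<Prod>i<?n. a (rev xs ! i) (rev xs ! Suc i))" by (simp add: weight_nth)
  also have "\<dots> = (\<Prod>i<?n. a (xs ! (?n - Suc i)) (xs ! Suc (?n - Suc i)))"
  proof (rule prod.cong[OF refl])
    fix i assume "i \<in> {..<?n}"
    then have "rev xs ! i = xs ! Suc (?n - Suc i)" "rev xs ! Suc i = xs ! (?n - Suc i)"
      by (auto simp: rev_nth Suc_diff_Suc)
    then show "a (rev xs ! i) (rev xs ! Suc i) = a (xs ! (?n - Suc i)) (xs ! Suc (?n - Suc i))"
      using assms by metis
  qed
  also have "\<dots> = (\<Prod>i<?n. a (xs ! i) (xs ! Suc i))"
    by (rule prod.nat_diff_reindex[of "\<lambda>i. a (xs ! i) (xs ! Suc i)"])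
  finally show ?thesis by (simp add: weight_nth)
qed

context weighted_graph
begin

definition closedset :: "nat \<Rightarrow> 'v \<Rightarrow> 'v list set" where
  "closedset h x = {zs. length zs = Suc (2 * h) \<and> set zs \<subseteq> V \<and> zs ! 0 = x \<and> zs ! (2 * h) = x \<and>
     (\<forall>i. Suc i < 2 * h \<and> Suc i \<noteq> h \<longrightarrow> zs ! i \<noteq> zs ! (i + 2))}"

text \<open>Two walks from x with a common endpoint form one closed walk when the second is run
  backwards. Backtracking is possible only where they are joined, which is the origin of the
  exception in \<open>nbwalk\<close>.\<close>

lemma nbpair_square_sum:
  assumes x: "x \<in> V"
  shows "(\<Sum>y\<in>V. (nbpair h x y)\<^sup>2) = (\<Sum>zs\<in>closedset h x. weight a zs)"
proof -
  let ?P = "\<lambda>y. {xs \<in> nb_lists h x. last xs = y}"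
  let ?T = "{(xs, ys). xs \<in> nb_lists h x \<and> ys \<in> nb_lists h x \<and> last xs = last ys}"
  have finP: "finite (?P y)" for y using finite_nb_lists by simp
  have T: "?T = (\<Union>y\<in>V. ?P y \<times> ?P y)"
  proof -
    have lastV: "last xs \<in> V" if "xs \<in> nb_lists h x" for xs
    proof -
      have "xs \<noteq> []" using that by (auto simp: nb_lists_def)
      then show ?thesis using last_in_set[of xs] that by (auto simp: nb_lists_def)
    qed
    show ?thesis
    proof (rule Set.set_eqI)
      fix p :: "'v list \<times> 'v list"
      obtain xs ys where p: "p = (xs, ys)" by (cases p)
      show "p \<in> ?T \<longleftrightarrow> p \<in> (\<Union>y\<in>V. ?P y \<times> ?P y)"
        using lastV[of xs] unfolding p by (simp only: mem_Collect_eq case_prod_conv UN_iff mem_Sigma_iff) metis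
    qed
  qed
  have "(\<Sum>y\<in>V. (nbpair h x y)\<^sup>2) = (\<Sum>y\<in>V. \<Sum>(xs, ys)\<in>?P y \<times> ?P y. weight a xs * weight a ys)"
  proof (rule sum.cong[OF refl])
    fix y
    have "(nbpair h x y)\<^sup>2 = (\<Sum>xs\<in>?P y. \<Sum>ys\<in>?P y. weight a xs * weight a ys)"
      unfolding nbpair_def power2_eq_square by (rule sum_product)
    also have "\<dots> = (\<Sum>(xs, ys)\<in>?P y \<times> ?P y. weight a xs * weight a ys)"
      by (rule sum.cartesian_product[where g = "\<lambda>xs ys. weight a xs * weight a ys"])
    finally show "(nbpair h x y)\<^sup>2 = (\<Sum>(xs, ys)\<in>?P y \<times> ?P y. weight a xs * weight a ys)" .
  qed
  also have "\<dots> = (\<Sum>(xs, ys)\<in>?T. weight a xs * weight a ys)"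
    unfolding T
  proof (rule sum.UNION_disjoint[symmetric, OF finV])
    show "\<forall>y\<in>V. finite (?P y \<times> ?P y)" using finP by blast
    show "\<forall>i\<in>V. \<forall>j\<in>V. i \<noteq> j \<longrightarrow> (?P i \<times> ?P i) \<inter> (?P j \<times> ?P j) = {}" by blast
  qed
  also have "\<dots> = (\<Sum>zs\<in>closedset h x. weight a zs)"
  proof (rule sum.reindex_bij_witness[where i = "\<lambda>zs. (take (Suc h) zs, rev (drop h zs))" and j = "\<lambda>(xs, ys). xs @ tl (rev ys)"])
    fix p assume "p \<in> ?T"
    then obtain xs ys where p: "p = (xs, ys)" "xs \<in> nb_lists h x" "ys \<in> nb_lists h x" "last xs = last ys" by auto
    have l: "length xs = Suc h" "length ys = Suc h" using p by (auto simp: nb_lists_def)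
    have nz: "xs \<noteq> []" "ys \<noteq> []" using l by auto
    define zs where "zs = xs @ tl (rev ys)"
    have lz: "length zs = Suc (2 * h)" using l by (simp add: zs_def)
    have z1: "zs ! i = xs ! i" if "i \<le> h" for i using that l by (simp add: zs_def nth_append)
    have z2: "zs ! (h + i) = ys ! (h - i)" if "i \<le> h" for i
    proof (cases i)
      case 0
      then show ?thesis using z1[of h] l p(4) nz by (simp add: last_conv_nth)
    next
      case (Suc j)
      then show ?thesis using that l by (simp add: zs_def nth_append nth_tl rev_nth)
    qed
    have tk: "take (Suc h) zs = xs" using l by (simp add: zs_def)
    have dr: "rev (drop h zs) = ys"
    proof (rule nth_equalityI)
      show "length (rev (drop h zs)) = length ys" using lz l by simp
      fix i assume "i < length (rev (drop h zs))"
      then have i: "i \<le> h" using lz by simp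
      then have "rev (drop h zs) ! i = zs ! (h + (h - i))" using lz by (simp add: rev_nth)
      also have "\<dots> = ys ! i" using z2[of "h - i"] i by simp
      finally show "rev (drop h zs) ! i = ys ! i" .
    qed
    show "(case (case p of (xs, ys) \<Rightarrow> xs @ tl (rev ys)) of zs \<Rightarrow> (take (Suc h) zs, rev (drop h zs))) = p"
      using tk dr p by (simp add: zs_def)
    have hx: "xs ! 0 = x" "ys ! 0 = x" using p nz by (auto simp: nb_lists_def hd_conv_nth)
    have nbx: "xs ! i \<noteq> xs ! (i + 2)" "ys ! i \<noteq> ys ! (i + 2)" if "i + 2 \<le> h" for i
      using p l that unfolding nb_lists_def nonback_nth by auto
    have "zs \<in> closedset h x"
      unfolding closedset_def mem_Collect_eq
    proof (intro conjI allI impI)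
      show "length zs = Suc (2 * h)" by (rule lz)
      have "set (tl (rev ys)) \<subseteq> set ys" using list.set_sel(2)[of "rev ys"] nz by fastforce
      then show "set zs \<subseteq> V" using p by (auto simp: zs_def nb_lists_def)
      show "zs ! 0 = x" using z1[of 0] hx by simp
      show "zs ! (2 * h) = x" using z2[of h] hx by (simp add: mult_2)
      fix i assume i: "Suc i < 2 * h \<and> Suc i \<noteq> h"
      show "zs ! i \<noteq> zs ! (i + 2)"
      proof (cases "i + 2 \<le> h")
        case True
        then show ?thesis using z1[of i] z1[of "i + 2"] nbx(1)[of i] by simp
      next
        case False
        then obtain k where k: "i = h + k" using i by (metis Suc_leI add_2_eq_Suc' le_add_diff_inverse le_antisym not_less_eq_eq)
        then have kh: "k + 2 \<le> h" using i by simp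
        have "zs ! i = ys ! (h - k)" "zs ! (i + 2) = ys ! (h - (k + 2))"
          using z2[of k] z2[of "k + 2"] k kh by (auto simp: add.assoc)
        moreover have "h - k = (h - (k + 2)) + 2" using kh by simp
        ultimately show ?thesis using nbx(2)[of "h - (k + 2)"] kh by (metis diff_le_self le_add_diff_inverse2 add_leD2 le_add2)
      qed
    qed
    then show "(case p of (xs, ys) \<Rightarrow> xs @ tl (rev ys)) \<in> closedset h x" using p by (simp add: zs_def)
    have "weight a zs = weight a xs * weight a (drop h zs)" using weight_split[of h zs a] lz tk by simp
    also have "weight a (drop h zs) = weight a ys" using weight_rev[of a "drop h zs"] sym dr by metis
    finally show "weight a (case p of (xs, ys) \<Rightarrow> xs @ tl (rev ys)) = (case p of (xs, ys) \<Rightarrow> weight a xs * weight a ys)"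
      using p by (simp add: zs_def)
  next
    fix zs assume zs: "zs \<in> closedset h x"
    then have lz: "length zs = Suc (2 * h)" by (simp add: closedset_def)
    have "tl (rev (rev (drop h zs))) = drop (Suc h) zs" by (simp add: drop_Suc tl_drop)
    then show "(case (take (Suc h) zs, rev (drop h zs)) of (xs, ys) \<Rightarrow> xs @ tl (rev ys)) = zs" by simp
    let ?xs = "take (Suc h) zs" and ?ys = "rev (drop h zs)"
    have l: "length ?xs = Suc h" "length ?ys = Suc h" using lz by auto
    then have nz: "?xs \<noteq> []" "?ys \<noteq> []" by auto
    have y: "?ys ! i = zs ! (2 * h - i)" if "i \<le> h" for i
      using that lz by (simp add: rev_nth mult_2)
    have nb: "zs ! i \<noteq> zs ! (i + 2)" if "Suc i < 2 * h" "Suc i \<noteq> h" for i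
      using zs that by (simp add: closedset_def)
    have "?xs \<in> nb_lists h x"
      using zs l nz nb unfolding nb_lists_def nonback_nth
      by (auto simp: closedset_def hd_conv_nth dest: in_set_takeD)
    moreover have "?ys \<in> nb_lists h x"
    proof -
      have "hd ?ys = x" using y[of 0] zs nz by (simp add: hd_conv_nth closedset_def del: rev_is_Nil_conv)
      moreover have "?ys ! i \<noteq> ?ys ! (i + 2)" if "i + 2 < length ?ys" for i
      proof -
        have i: "i + 2 \<le> h" using that l by simp
        have e: "2 * h - i = (2 * h - (i + 2)) + 2" using i by simp
        have "Suc (2 * h - (i + 2)) < 2 * h" "Suc (2 * h - (i + 2)) \<noteq> h" using i by linarith+
        then have "zs ! (2 * h - (i + 2)) \<noteq> zs ! (2 * h - i)" using nb[of "2 * h - (i + 2)"] e by metis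
        then show ?thesis using y[of i] y[of "i+2"] i by simp
      qed
      moreover have "set ?ys \<subseteq> V" using zs by (auto simp: closedset_def dest: in_set_dropD)
      ultimately show ?thesis using l unfolding nb_lists_def nonback_nth by blast
    qed
    moreover have "last ?xs = last ?ys"
      using y[of h] l nz by (simp add: last_conv_nth del: rev_is_Nil_conv)
    ultimately show "(take (Suc h) zs, rev (drop h zs)) \<in> ?T" by blast
  qed
  finally show ?thesis .
qed

end

section \<open>Chebyshev recursion\<close>

text \<open>The first components are the polynomials for walks of even length and the second ones for walks
  of odd length, both started from a row.\<close>
fun cheb :: "real \<Rightarrow> real \<Rightarrow> real \<Rightarrow> nat \<Rightarrow> real \<times> real" where
  "cheb K q r 0 = (1, 1)"
| "cheb K q r (Suc j) = (let P = fst (cheb K q r j); P' = snd (cheb K q r j);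
     N = K * P' - (if j = 0 then q + 1 else q) * P in (N, N - r * P'))"

abbreviation chebP where "chebP K q r j \<equiv> fst (cheb K q r j)"
abbreviation chebQ where "chebQ K q r j \<equiv> snd (cheb K q r j)"

lemma chebP_Suc: "chebP K q r (Suc j) = K * chebQ K q r j - (if j = 0 then q + 1 else q) * chebP K q r j"
  and chebQ_Suc: "chebQ K q r (Suc j) = chebP K q r (Suc j) - r * chebQ K q r j"
  by (simp_all add: Let_def)

lemma chebP_1: "chebP K q r 1 = K - q - 1"
  by (simp add: Let_def)

declare cheb.simps(2) [simp del]

text \<open>Elimination of the odd components gives a Chebyshev recursion centred at q + r. The
  coefficient for \<open>j = 0\<close> differs because the first step of a walk has one choice more
  than the later ones.\<close>

lemma chebP_rec: "chebP K q r (Suc (Suc j)) = (K - q - r) * chebP K q r (Suc j)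
   - (if j = 0 then (q + 1) * r else q * r) * chebP K q r j"
proof -
  have "chebP K q r (Suc (Suc j)) = K * (chebP K q r (Suc j) - r * chebQ K q r j) - q * chebP K q r (Suc j)"
    using chebP_Suc[of K q r "Suc j"] unfolding chebQ_Suc by simp
  moreover have "K * chebQ K q r j = chebP K q r (Suc j) + (if j = 0 then q + 1 else q) * chebP K q r j"
    using chebP_Suc[of K q r j] by simp
  then have "r * (K * chebQ K q r j) = r * (chebP K q r (Suc j) + (if j = 0 then q + 1 else q) * chebP K q r j)" by simp
  ultimately show ?thesis by (auto simp: algebra_simps)
qed

text \<open>The roots of X^2 - (\<rho> + 1 / \<rho>) X + 1 are \<rho> and 1 / \<rho>. Subtracting 1
  / \<rho> times the preceding absolute value leaves a quantity \<open>d\<close> that grows at least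
  by the factor \<rho>. Only absolute values enter, so both ends of the spectrum are covered at
  once.\<close>

lemma cheb_growth:
  fixes K q r \<rho> :: real
  assumes qr: "1 \<le> r" "r \<le> q" and rho: "1 < \<rho>" and far: "(\<rho> + 1 / \<rho>) * sqrt (q * r) \<le> \<bar>K - q - r\<bar>"
  shows "sqrt (q * r) ^ (j + 2) * (\<rho> ^ j * (\<rho> - 1)) \<le> \<bar>chebP K q r (j + 2)\<bar>"
proof -
  define w where "w = sqrt (q * r)"
  have w2: "w * w = q * r" using qr by (simp add: w_def)
  have "r * r \<le> q * r" using qr by (intro mult_right_mono) auto
  then have wr: "r \<le> w" unfolding w_def using qr by (intro real_le_rsqrt) (simp add: power2_eq_square)
  then have w0: "0 < w" using qr by linarith
  define c where "c = \<rho> + 1 / \<rho>"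
  have c2: "2 \<le> c"
  proof -
    have "0 \<le> (\<rho> - 1)\<^sup>2 / \<rho>" using rho by simp
    also have "\<dots> = c - 2" unfolding c_def using rho by (simp add: field_simps power2_eq_square)
    finally show ?thesis by simp
  qed
  define z where "z = (K - q - r) / w"
  have zc: "c \<le> \<bar>z\<bar>" using far w0 by (simp add: z_def c_def w_def[symmetric] field_simps)
  define u where "u i = chebP K q r i / w ^ i" for i
  \<comment> \<open>This lower bound compensates the initial coefficient 1 + 1 / q. For negative z
    the shift (r - 1) / w works against it, but it is at most 1 - 1 / r while |z| is at least
    2.\<close>
  have u1: "1 + 1 / q \<le> \<bar>u 1\<bar>"
  proof -
    have "u 1 = z + (r - 1) / w" using w0 by (simp add: u_def chebP_1 z_def diff_divide_distrib add_divide_distrib del: One_nat_def)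
    moreover have "(r - 1) / w \<le> (r - 1) / r" using wr qr by (intro divide_left_mono) (auto intro: mult_pos_pos)
    moreover have "0 \<le> (r - 1) / w" using w0 qr by simp
    moreover have "(r - 1) / r = 1 - 1 / r" using qr by (simp add: field_simps)
    moreover have "1 / q \<le> 1 / r" using qr by (intro divide_left_mono) (auto intro: mult_pos_pos)
    ultimately show ?thesis using zc c2 by linarith
  qed
  have rec: "u (Suc (Suc i)) = z * u (Suc i) - (if i = 0 then 1 + 1 / q else 1) * u i" for i
  proof -
    have a: "(K - q - r) * chebP K q r (Suc i) / w ^ Suc (Suc i) = z * u (Suc i)"
      using w0 by (simp add: u_def z_def)
    have ww: "w ^ Suc (Suc i) = q * r * w ^ i" using w2 by (simp add: mult.assoc[symmetric])
    have b: "(if i = 0 then (q + 1) * r else q * r) * chebP K q r i / w ^ Suc (Suc i) = (if i = 0 then 1 + 1 / q else 1) * u i"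
      unfolding ww u_def using qr w0 by (auto simp: field_simps)
    show ?thesis unfolding u_def[of "Suc (Suc i)"] chebP_rec diff_divide_distrib a b ..
  qed
  define d where "d i = \<bar>u (Suc i)\<bar> - \<bar>u i\<bar> / \<rho>" for i
  have step: "c * \<bar>u (Suc i)\<bar> \<le> \<bar>z * u (Suc i)\<bar>" for i
    unfolding abs_mult using zc by (intro mult_right_mono) auto
  have d1: "\<rho> - 1 \<le> d 1"
  proof -
    have "u 0 = 1" by (simp add: u_def)
    have "u 2 = z * u 1 - (1 + 1 / q)" using rec[of 0] \<open>u 0 = 1\<close> by (simp add: numeral_2_eq_2)
    moreover have "0 \<le> 1 + 1 / q" using qr by simp
    ultimately have "c * \<bar>u 1\<bar> - (1 + 1 / q) \<le> \<bar>u 2\<bar>" using step[of 0] unfolding One_nat_def by arith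
    moreover have "c * \<bar>u 1\<bar> = \<rho> * \<bar>u 1\<bar> + \<bar>u 1\<bar> / \<rho>" by (simp add: c_def field_simps)
    moreover have "\<rho> * (1 + 1 / q) \<le> \<rho> * \<bar>u 1\<bar>" using u1 rho by (intro mult_left_mono) auto
    moreover have "\<rho> - 1 \<le> (\<rho> - 1) * (1 + 1 / q)" using rho qr by (simp add: mult_le_cancel_left1)
    moreover have "(\<rho> - 1) * (1 + 1 / q) = \<rho> * (1 + 1 / q) - (1 + 1 / q)" by (simp add: left_diff_distrib)
    ultimately show ?thesis by (simp add: d_def numeral_2_eq_2)
  qed
  have dstep: "\<rho> * d (Suc i) \<le> d (Suc (Suc i))" for i
  proof -
    have "c * \<bar>u (Suc (Suc i))\<bar> - \<bar>u (Suc i)\<bar> \<le> \<bar>u (Suc (Suc (Suc i)))\<bar>" using rec[of "Suc i"] step[of "Suc i"] by simp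
    moreover have "c * \<bar>u (Suc (Suc i))\<bar> = \<rho> * \<bar>u (Suc (Suc i))\<bar> + \<bar>u (Suc (Suc i))\<bar> / \<rho>" by (simp add: c_def field_simps)
    moreover have "\<rho> * (\<bar>u (Suc i)\<bar> / \<rho>) = \<bar>u (Suc i)\<bar>" using rho by simp
    ultimately show ?thesis by (simp add: d_def right_diff_distrib)
  qed
  have dj: "\<rho> ^ j * (\<rho> - 1) \<le> d (Suc j)" for j
  proof (induction j)
    case 0
    then show ?case using d1 by simp
  next
    case (Suc j)
    have "\<rho> ^ Suc j * (\<rho> - 1) = \<rho> * (\<rho> ^ j * (\<rho> - 1))" by simp
    also have "\<dots> \<le> \<rho> * d (Suc j)" using Suc rho by (intro mult_left_mono) auto
    also have "\<dots> \<le> d (Suc (Suc j))" by (rule dstep)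
    finally show ?case .
  qed
  have "\<rho> ^ j * (\<rho> - 1) \<le> \<bar>u (j + 2)\<bar>"
  proof -
    have "0 \<le> \<bar>u (Suc j)\<bar> / \<rho>" using rho by simp
    then show ?thesis using dj[of j] by (simp add: d_def)
  qed
  then have "w ^ (j + 2) * (\<rho> ^ j * (\<rho> - 1)) \<le> w ^ (j + 2) * \<bar>u (j + 2)\<bar>" using w0 by (intro mult_left_mono) auto
  also have "\<dots> = \<bar>chebP K q r (j + 2)\<bar>" using w0 by (simp add: u_def abs_divide del: power_Suc)
  finally show ?thesis by (simp add: w_def)
qed

context weighted_graph
begin

text \<open>As f lives on the rows, walk sums of even length live on the rows and those of odd
  length on the columns. There \<open>D\<close> equals q + 1 and r + 1, and \<open>nbsum_rec\<close>
  becomes the coupled recursion of \<open>cheb\<close>.\<close>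

lemma nbsum_eigen:
  fixes sd :: "'v \<Rightarrow> bool" and q r K :: real
  assumes D: "\<And>x. x \<in> V \<Longrightarrow> D x = (if sd x then q + 1 else r + 1)"
    and side: "\<And>x y. a x y \<noteq> 0 \<Longrightarrow> sd x \<noteq> sd y"
    and f0: "\<And>x. \<not> sd x \<Longrightarrow> f x = 0"
    and eig: "\<And>x. x \<in> V \<Longrightarrow> sd x \<Longrightarrow> (\<Sum>y\<in>V. a x y * (\<Sum>z\<in>V. a y z * f z)) = K * f x"
  shows "(\<forall>x\<in>V. nbsum (2 * j) f x = chebP K q r j * f x) \<and>
    (\<forall>x\<in>V. nbsum (2 * j + 1) f x = chebQ K q r j * (\<Sum>y\<in>V. a x y * f y))"
proof (induction j)
  case 0
  then show ?case using nbsum_0 nbsum_1 by simp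
next
  case (Suc j)
  let ?g = "\<lambda>x. \<Sum>y\<in>V. a x y * f y"
  have g0: "?g x = 0" if "sd x" for x
  proof (rule sum.neutral, rule ballI)
    fix y assume "y \<in> V" show "a x y * f y = 0" using side[of x y] f0[of y] that by (cases "a x y = 0") auto
  qed
  have ag: "(\<Sum>y\<in>V. a x y * ?g y) = K * f x" if x: "x \<in> V" for x
  proof (cases "sd x")
    case True
    then show ?thesis using eig x by simp
  next
    case False
    have "a x y * ?g y = 0" for y using side[of x y] g0[of y] False by (cases "a x y = 0") auto
    then have "(\<Sum>y\<in>V. a x y * ?g y) = 0" by (rule sum.neutral[OF ballI])
    then show ?thesis using f0 False by simp
  qed
  have even: "nbsum (2 * Suc j) f x = chebP K q r (Suc j) * f x" if x: "x \<in> V" for x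
  proof -
    have "nbsum (2 * Suc j) f x = (\<Sum>y\<in>V. a x y * nbsum (2 * j + 1) f y) - (D x - (if 2 * j = 0 then 0 else 1)) * nbsum (2 * j) f x"
      using nbsum_rec[OF x, of "2 * j" f] by simp
    also have "(\<Sum>y\<in>V. a x y * nbsum (2 * j + 1) f y) = (\<Sum>y\<in>V. chebQ K q r j * (a x y * ?g y))"
      using Suc by (intro sum.cong) auto
    also have "\<dots> = chebQ K q r j * (K * f x)" using ag[OF x] by (simp flip: sum_distrib_left)
    also have "(D x - (if 2 * j = 0 then 0 else 1)) * nbsum (2 * j) f x = (if j = 0 then q + 1 else q) * (chebP K q r j * f x)"
      using Suc x D[OF x] f0[of x] by auto
    finally show ?thesis by (simp add: chebP_Suc algebra_simps)
  qed
  have odd: "nbsum (2 * Suc j + 1) f x = chebQ K q r (Suc j) * ?g x" if x: "x \<in> V" for x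
  proof -
    have "nbsum (2 * Suc j + 1) f x = (\<Sum>y\<in>V. a x y * nbsum (2 * Suc j) f y) - (D x - 1) * nbsum (2 * j + 1) f x"
      using nbsum_rec[OF x, of "2 * j + 1" f] by simp
    also have "(\<Sum>y\<in>V. a x y * nbsum (2 * Suc j) f y) = (\<Sum>y\<in>V. chebP K q r (Suc j) * (a x y * f y))"
      using even by (intro sum.cong) auto
    also have "\<dots> = chebP K q r (Suc j) * ?g x" by (simp flip: sum_distrib_left)
    also have "(D x - 1) * nbsum (2 * j + 1) f x = r * (chebQ K q r j * ?g x)"
      using Suc x D[OF x] g0[of x] by auto
    finally show ?thesis unfolding chebQ_Suc by (simp add: left_diff_distrib mult.assoc)
  qed
  show ?case using even odd by blast
qed

text \<open>The operator norm of the walk matrix is at most its Frobenius norm, by Cauchy-Schwarz in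
  each row.\<close>

lemma eigen_frobenius:
  fixes sd :: "'v \<Rightarrow> bool" and q r K :: real
  assumes D: "\<And>x. x \<in> V \<Longrightarrow> D x = (if sd x then q + 1 else r + 1)"
    and side: "\<And>x y. a x y \<noteq> 0 \<Longrightarrow> sd x \<noteq> sd y"
    and f0: "\<And>x. \<not> sd x \<Longrightarrow> f x = 0"
    and eig: "\<And>x. x \<in> V \<Longrightarrow> sd x \<Longrightarrow> (\<Sum>y\<in>V. a x y * (\<Sum>z\<in>V. a y z * f z)) = K * f x"
    and nz: "x0 \<in> V" "f x0 \<noteq> 0"
  shows "(chebP K q r j)\<^sup>2 \<le> (\<Sum>x\<in>{x\<in>V. sd x}. \<Sum>zs\<in>closedset (2 * j) x. weight a zs)"
proof -
  let ?R = "{x\<in>V. sd x}"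
  have n: "(\<Sum>y\<in>V. (f y)\<^sup>2) = (\<Sum>y\<in>?R. (f y)\<^sup>2)"
    by (rule sum.mono_neutral_right) (use finV f0 in auto)
  have pos: "0 < (\<Sum>y\<in>V. (f y)\<^sup>2)"
    using sum_pos2[OF finV nz(1), of "\<lambda>y. (f y)\<^sup>2"] nz by simp
  have "(chebP K q r j)\<^sup>2 * (\<Sum>y\<in>V. (f y)\<^sup>2) = (\<Sum>x\<in>?R. (nbsum (2 * j) f x)\<^sup>2)"
    unfolding n sum_distrib_left
    by (intro sum.cong refl) (use nbsum_eigen[OF D side f0 eig, of j] in \<open>auto simp: power_mult_distrib\<close>)
  also have "\<dots> \<le> (\<Sum>x\<in>?R. (\<Sum>y\<in>V. (nbpair (2 * j) x y)\<^sup>2) * (\<Sum>y\<in>V. (f y)\<^sup>2))"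
    by (intro sum_mono nbsum_square_le)
  also have "\<dots> = (\<Sum>x\<in>?R. \<Sum>zs\<in>closedset (2 * j) x. weight a zs) * (\<Sum>y\<in>V. (f y)\<^sup>2)"
    unfolding sum_distrib_right[of _ ?R]
    by (rule sum.cong[OF refl]) (simp add: nbpair_square_sum)
  finally show ?thesis using pos by (meson mult_right_le_imp_le)
qed

end

section \<open>Signed biregular matrices\<close>

definition adj :: "real mat \<Rightarrow> nat + nat \<Rightarrow> nat + nat \<Rightarrow> real" where
  "adj A x y = (case x of
      Inl i \<Rightarrow> (case y of Inl _ \<Rightarrow> 0 | Inr j \<Rightarrow> if i < dim_row A \<and> j < dim_col A then A $$ (i, j) else 0)
    | Inr j \<Rightarrow> (case y of Inr _ \<Rightarrow> 0 | Inl i \<Rightarrow> if i < dim_row A \<and> j < dim_col A then A $$ (i, j) else 0))"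

lemma adj_simps [simp]:
  "adj A (Inl i) (Inl i') = 0" "adj A (Inr j) (Inr j') = 0"
  "adj A (Inl i) (Inr j) = (if i < dim_row A \<and> j < dim_col A then A $$ (i, j) else 0)"
  "adj A (Inr j) (Inl i) = (if i < dim_row A \<and> j < dim_col A then A $$ (i, j) else 0)"
  by (simp_all add: adj_def)

definition verts :: "nat \<Rightarrow> nat \<Rightarrow> (nat + nat) set" where
  "verts m n = {..<m} <+> {..<n}"

lemma finite_verts: "finite (verts m n)" by (simp add: verts_def)

lemma sum_verts: "(\<Sum>y\<in>verts m n. g y) = (\<Sum>i<m. g (Inl i)) + (\<Sum>j<n. g (Inr j))"
  for g :: "nat + nat \<Rightarrow> real"
  by (simp add: verts_def sum.Plus comp_def)

lemma adj_sym: "adj A x y = adj A y x"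
  by (cases x; cases y) auto

lemma adj_side: "adj A x y \<noteq> 0 \<Longrightarrow> isl x \<noteq> isl y"
  by (cases x; cases y) auto

lemma adj_verts: "A \<in> carrier_mat m n \<Longrightarrow> adj A x y \<noteq> 0 \<Longrightarrow> x \<in> verts m n \<and> y \<in> verts m n"
  by (cases x; cases y) (auto simp: verts_def split: if_splits)

lemma signed_biregularD:
  assumes "A \<in> signed_biregular m n s t"
  shows "A \<in> carrier_mat m n" "dim_row A = m" "dim_col A = n"
    "\<And>i j. i < m \<Longrightarrow> j < n \<Longrightarrow> A $$ (i, j) = 0 \<or> A $$ (i, j) = 1 \<or> A $$ (i, j) = - 1"
    "\<And>i. i < m \<Longrightarrow> card {j. j < n \<and> A $$ (i, j) \<noteq> 0} = s"
    "\<And>j. j < n \<Longrightarrow> card {i. i < m \<and> A $$ (i, j) \<noteq> 0} = t"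
  using assms by (auto simp: signed_biregular_def)

lemma sum_squares_signs:
  fixes g :: "nat \<Rightarrow> real"
  assumes "\<And>i. i < m \<Longrightarrow> g i = 0 \<or> g i = 1 \<or> g i = - 1"
  shows "(\<Sum>i<m. g i * g i) = card {i. i < m \<and> g i \<noteq> 0}"
proof -
  have "(\<Sum>i<m. g i * g i) = (\<Sum>i<m. if g i \<noteq> 0 then 1 else 0)"
  proof (rule sum.cong[OF refl])
    fix i assume "i \<in> {..<m}"
    then show "g i * g i = (if g i \<noteq> 0 then 1 else 0)" using assms[of i] by auto
  qed
  also have "\<dots> = card {i. i < m \<and> g i \<noteq> 0}" by (simp add: sum.If_cases Int_def)
  finally show ?thesis .
qed

lemma signed_weighted_graph:
  assumes A: "A \<in> signed_biregular m n s t"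
  shows "weighted_graph (verts m n) (adj A) (\<lambda>x. if isl x then real s else real t)"
proof
  note D = signed_biregularD[OF A]
  show "finite (verts m n)" by (rule finite_verts)
  show "adj A x y = adj A y x" for x y by (rule adj_sym)
  show "adj A x y * adj A x y * adj A x y = adj A x y" for x y
  proof -
    have "adj A x y = 0 \<or> adj A x y = 1 \<or> adj A x y = - 1"
      using D(4)[of "projl x" "projr y"] D(4)[of "projl y" "projr x"] by (cases x; cases y) (auto simp: D)
    then show ?thesis by auto
  qed
  show "(\<Sum>y\<in>verts m n. adj A x y * adj A x y) = (if isl x then real s else real t)" if "x \<in> verts m n" for x
  proof (cases x)
    case (Inl i)
    then have i: "i < m" using that by (auto simp: verts_def)
    have "(\<Sum>y\<in>verts m n. adj A x y * adj A x y) = (\<Sum>j<n. A $$ (i, j) * A $$ (i, j))"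
      unfolding sum_verts using Inl i D by (auto intro!: sum.cong)
    also have "\<dots> = card {j. j < n \<and> A $$ (i, j) \<noteq> 0}" by (rule sum_squares_signs) (use D(4) i in auto)
    finally show ?thesis using D(5)[OF i] Inl by simp
  next
    case (Inr j)
    then have j: "j < n" using that by (auto simp: verts_def)
    have "(\<Sum>y\<in>verts m n. adj A x y * adj A x y) = (\<Sum>i<m. A $$ (i, j) * A $$ (i, j))"
      unfolding sum_verts using Inr j D by (auto intro!: sum.cong)
    also have "\<dots> = card {i. i < m \<and> A $$ (i, j) \<noteq> 0}" by (rule sum_squares_signs) (use D(4) j in auto)
    finally show ?thesis using D(6)[OF j] Inr by simp
  qed
qed

lemma eigen_pair:
  assumes A: "A \<in> carrier_mat m n" and ev: "eigenvalue (A * transpose_mat A) K"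
  shows "\<exists>v\<in>carrier_vec m. v \<noteq> 0\<^sub>v m \<and>
    (\<forall>i<m. (\<Sum>j<n. A $$ (i, j) * (\<Sum>i'<m. A $$ (i', j) * v $ i')) = K * v $ i)"
proof -
  obtain v where v: "v \<in> carrier_vec m" "v \<noteq> 0\<^sub>v m" "(A * transpose_mat A) *\<^sub>v v = K \<cdot>\<^sub>v v"
    using ev A by (auto simp: eigenvalue_def eigenvector_def)
  have "(\<Sum>j<n. A $$ (i, j) * (\<Sum>i'<m. A $$ (i', j) * v $ i')) = K * v $ i" if i: "i < m" for i
  proof -
    have "K * v $ i = ((A * transpose_mat A) *\<^sub>v v) $ i" using v i by simp
    also have "(A * transpose_mat A) *\<^sub>v v = A *\<^sub>v (transpose_mat A *\<^sub>v v)"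
      by (rule assoc_mult_mat_vec[OF A _ v(1)]) (use A in auto)
    also have "(A *\<^sub>v (transpose_mat A *\<^sub>v v)) $ i = (\<Sum>j<n. A $$ (i, j) * (\<Sum>i'<m. A $$ (i', j) * v $ i'))"
      using A v(1) i by (auto simp: scalar_prod_def lessThan_atLeast0 intro!: sum.cong)
    finally show ?thesis by simp
  qed
  then show ?thesis using v by blast
qed

lemma nonzero_vec_index: "v \<in> carrier_vec m \<Longrightarrow> v \<noteq> 0\<^sub>v m \<Longrightarrow> \<exists>i<m. v $ i \<noteq> 0"
  by (rule ccontr) (auto intro!: eq_vecI)

lemma eigenvalue_gram_nonneg:
  assumes A: "A \<in> carrier_mat m n" and ev: "eigenvalue (A * transpose_mat A) K"
  shows "0 \<le> (K::real)"
proof -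
  obtain v where v: "v \<in> carrier_vec m" "v \<noteq> 0\<^sub>v m"
    "\<And>i. i < m \<Longrightarrow> (\<Sum>j<n. A $$ (i, j) * (\<Sum>i'<m. A $$ (i', j) * v $ i')) = K * v $ i"
    using eigen_pair[OF A ev] by blast
  obtain i0 where i0: "i0 < m" "v $ i0 \<noteq> 0" using nonzero_vec_index[OF v(1,2)] by blast
  let ?u = "\<lambda>j. \<Sum>i<m. A $$ (i, j) * v $ i"
  have "K * (\<Sum>i<m. v $ i * v $ i) = (\<Sum>i<m. (\<Sum>j<n. A $$ (i, j) * ?u j) * v $ i)"
    unfolding sum_distrib_left[of K]
  proof (rule sum.cong[OF refl])
    fix i assume "i \<in> {..<m}"
    then have "i < m" by simp
    then show "K * (v $ i * v $ i) = (\<Sum>j<n. A $$ (i, j) * ?u j) * v $ i" by (simp only: v(3) mult.assoc)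
  qed
  also have "\<dots> = (\<Sum>i<m. \<Sum>j<n. (A $$ (i, j) * v $ i) * ?u j)"
    unfolding sum_distrib_right by (intro sum.cong refl) (simp add: sum_distrib_left sum_distrib_right mult_ac)
  also have "\<dots> = (\<Sum>j<n. \<Sum>i<m. (A $$ (i, j) * v $ i) * ?u j)" by (rule sum.swap)
  also have "\<dots> = (\<Sum>j<n. ?u j * ?u j)" by (simp only: sum_distrib_right)
  finally have "0 \<le> K * (\<Sum>i<m. v $ i * v $ i)" by (simp add: sum_nonneg)
  moreover have "0 < (\<Sum>i<m. v $ i * v $ i)"
    using i0 by (intro sum_pos2[of _ i0]) (auto simp: zero_less_mult_iff linorder_neq_iff)
  ultimately show ?thesis by (simp add: zero_le_mult_iff)
qed

section \<open>The Frobenius norm forced by an outlying eigenvalue\<close>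

definition frobenius :: "nat \<Rightarrow> nat \<Rightarrow> nat \<Rightarrow> real mat \<Rightarrow> real" where
  "frobenius m n h A = (\<Sum>x\<in>{x \<in> verts m n. isl x}. \<Sum>zs\<in>weighted_graph.closedset (verts m n) h x. weight (adj A) zs)"

lemma frobenius_nonneg:
  assumes A: "A \<in> signed_biregular m n s t" shows "0 \<le> frobenius m n h A"
proof -
  interpret weighted_graph "verts m n" "adj A" "\<lambda>x. if isl x then real s else real t"
    by (rule signed_weighted_graph[OF A])
  show ?thesis unfolding frobenius_def
  proof (rule sum_nonneg)
    fix x assume "x \<in> {x \<in> verts m n. isl x}"
    then have "(\<Sum>zs\<in>closedset h x. weight (adj A) zs) = (\<Sum>y\<in>verts m n. (nbpair h x y)\<^sup>2)"
      using nbpair_square_sum[of x h] by simp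
    then show "0 \<le> (\<Sum>zs\<in>closedset h x. weight (adj A) zs)" by (simp add: sum_nonneg)
  qed
qed

lemma far_eigenvalue_frobenius:
  assumes A: "A \<in> signed_biregular m n s t" and st: "2 \<le> t" "t \<le> s" and rho: "1 < \<rho>"
    and ev: "eigenvalue (A * transpose_mat A) K"
    and far: "(\<rho> + 1 / \<rho>) * sqrt ((real s - 1) * (real t - 1)) \<le> \<bar>K - (real s - 1) - (real t - 1)\<bar>"
  shows "(sqrt ((real s - 1) * (real t - 1)) ^ (j + 2) * (\<rho> ^ j * (\<rho> - 1)))\<^sup>2 \<le> frobenius m n (2 * (j + 2)) A"
proof -
  interpret weighted_graph "verts m n" "adj A" "\<lambda>x. if isl x then real s else real t"
    by (rule signed_weighted_graph[OF A])
  note D = signed_biregularD[OF A]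
  obtain v where v: "v \<in> carrier_vec m" "v \<noteq> 0\<^sub>v m"
    "\<And>i. i < m \<Longrightarrow> (\<Sum>j<n. A $$ (i, j) * (\<Sum>i'<m. A $$ (i', j) * v $ i')) = K * v $ i"
    using eigen_pair[OF D(1) ev] by blast
  obtain i0 where i0: "i0 < m" "v $ i0 \<noteq> 0" using nonzero_vec_index[OF v(1,2)] by blast
  define f where "f x = (case x of Inl i \<Rightarrow> if i < m then v $ i else 0 | Inr j \<Rightarrow> 0)" for x :: "nat + nat"
  have inner: "(\<Sum>z\<in>verts m n. adj A (Inr j) z * f z) = (\<Sum>i'<m. A $$ (i', j) * v $ i')" if "j < n" for j
    unfolding sum_verts using that D by (auto simp: f_def intro!: sum.cong)
  have eig: "(\<Sum>y\<in>verts m n. adj A x y * (\<Sum>z\<in>verts m n. adj A y z * f z)) = K * f x"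
    if x: "x \<in> verts m n" "isl x" for x
  proof -
    obtain i where i: "x = Inl i" "i < m" using x by (auto simp: verts_def)
    have "(\<Sum>y\<in>verts m n. adj A x y * (\<Sum>z\<in>verts m n. adj A y z * f z)) =
      (\<Sum>j<n. A $$ (i, j) * (\<Sum>i'<m. A $$ (i', j) * v $ i'))"
      unfolding sum_verts[of _ m n, where g = "\<lambda>y. adj A x y * (\<Sum>z\<in>verts m n. adj A y z * f z)"]
      using i D by (auto simp: inner intro!: sum.cong)
    also have "\<dots> = K * f x" using v(3)[OF i(2)] i by (simp add: f_def)
    finally show ?thesis .
  qed
  have "(chebP K (real s - 1) (real t - 1) (j + 2))\<^sup>2 \<le>
     (\<Sum>x\<in>{x \<in> verts m n. isl x}. \<Sum>zs\<in>closedset (2 * (j + 2)) x. weight (adj A) zs)"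
    by (rule eigen_frobenius[where sd = isl and f = f and ?x0.0 = "Inl i0"])
      (use adj_side eig i0 in \<open>auto simp: f_def verts_def split: sum.splits\<close>)
  also have "\<dots> = frobenius m n (2 * (j + 2)) A" by (simp add: frobenius_def)
  finally have 1: "(chebP K (real s - 1) (real t - 1) (j + 2))\<^sup>2 \<le> frobenius m n (2 * (j + 2)) A" .
  have "sqrt ((real s - 1) * (real t - 1)) ^ (j + 2) * (\<rho> ^ j * (\<rho> - 1)) \<le> \<bar>chebP K (real s - 1) (real t - 1) (j + 2)\<bar>"
    by (rule cheb_growth) (use st rho far in auto)
  then have "(sqrt ((real s - 1) * (real t - 1)) ^ (j + 2) * (\<rho> ^ j * (\<rho> - 1)))\<^sup>2 \<le> \<bar>chebP K (real s - 1) (real t - 1) (j + 2)\<bar>\<^sup>2"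
    by (rule power_mono) (use st rho in auto)
  then show ?thesis using 1 by simp
qed

section \<open>Averaging over the signs\<close>

definition flip :: "nat \<Rightarrow> nat \<Rightarrow> real mat \<Rightarrow> real mat" where
  "flip i j A = mat (dim_row A) (dim_col A) (\<lambda>(k, l). if k = i \<and> l = j then - A $$ (k, l) else A $$ (k, l))"

lemma flip_flip: "A \<in> carrier_mat m n \<Longrightarrow> flip i j (flip i j A) = A"
  by (intro eq_matI) (auto simp: flip_def)

lemma adj_flip: "adj (flip i j A) x y = (if {x, y} = {Inl i, Inr j} then - adj A x y else adj A x y)"
  by (cases x; cases y) (auto simp: flip_def doubleton_eq_iff)

lemma adj_flip_zero: "adj (flip i j A) x y = 0 \<longleftrightarrow> adj A x y = 0"
  by (simp add: adj_flip)

lemma flip_signed_biregular: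
  assumes A: "A \<in> signed_biregular m n s t" shows "flip i j A \<in> signed_biregular m n s t"
proof -
  note D = signed_biregularD[OF A]
  have e: "flip i j A $$ (k, l) = (if k = i \<and> l = j then - A $$ (k, l) else A $$ (k, l))" if "k < m" "l < n" for k l
    using that D by (simp add: flip_def)
  have "{l. l < n \<and> flip i j A $$ (k, l) \<noteq> 0} = {l. l < n \<and> A $$ (k, l) \<noteq> 0}" if "k < m" for k
  proof -
    have "flip i j A $$ (k, l) \<noteq> 0 \<longleftrightarrow> A $$ (k, l) \<noteq> 0" if "l < n" for l using e[OF \<open>k < m\<close> that] by simp
    then show ?thesis by auto
  qed
  moreover have "{k. k < m \<and> flip i j A $$ (k, l) \<noteq> 0} = {k. k < m \<and> A $$ (k, l) \<noteq> 0}" if "l < n" for l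
  proof -
    have "flip i j A $$ (k, l) \<noteq> 0 \<longleftrightarrow> A $$ (k, l) \<noteq> 0" if "k < m" for k using e[OF that \<open>l < n\<close>] by simp
    then show ?thesis by auto
  qed
  moreover have "flip i j A $$ (k, l) \<in> {0, 1, - 1}" if "k < m" "l < n" for k l
    using D(4)[OF that] e[OF that] by auto
  moreover have "flip i j A \<in> carrier_mat m n" by (simp add: flip_def D)
  ultimately show ?thesis using D(5,6) unfolding signed_biregular_def by simp
qed

text \<open>The part of sign symmetry that survives conditioning on the support; later the average
  runs over the matrices with cycle-sparse support only.\<close>

definition flip_closed :: "nat \<Rightarrow> nat \<Rightarrow> real mat set \<Rightarrow> bool" where
  "flip_closed m n G \<longleftrightarrow> (\<forall>A\<in>G. \<forall>i<m. \<forall>j<n. flip i j A \<in> G)"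

text \<open>Flipping the sign of the entry crossed once permutes \<open>G\<close> and reverses the
  weight, so the sum equals its negative. If that step is not a matrix position, every weight
  vanishes already.\<close>

lemma sum_weight_singleton:
  assumes G: "G \<subseteq> carrier_mat m n" "flip_closed m n G"
    and zs: "length zs = Suc L" and nsf: "\<not> singleton_free L (nth zs)"
  shows "(\<Sum>A\<in>G. weight (adj A) zs) = 0"
proof -
  obtain k where k: "k < L" "\<And>j. j < L \<Longrightarrow> j \<noteq> k \<Longrightarrow> step_edge (nth zs) j \<noteq> step_edge (nth zs) k"
    using nsf unfolding singleton_free_def by blast
  have w: "weight (adj A) zs = (\<Prod>i<L. adj A (zs ! i) (zs ! Suc i))" for A
    using zs by (simp add: weight_nth)
  have split: "(\<Prod>i<L. g i) = g k * (\<Prod>i\<in>{..<L} - {k}. g i)" for g :: "nat \<Rightarrow> real"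
    using k by (simp add: prod.remove)
  show ?thesis
  proof (cases "\<exists>i<m. \<exists>j<n. step_edge (nth zs) k = {Inl i, Inr j}")
    case True
    then obtain i j where ij: "i < m" "j < n" "step_edge (nth zs) k = {Inl i, Inr j}" by blast
    have f: "weight (adj (flip i j A)) zs = - weight (adj A) zs" for A
    proof -
      have "(\<Prod>l\<in>{..<L} - {k}. adj (flip i j A) (zs ! l) (zs ! Suc l)) = (\<Prod>l\<in>{..<L} - {k}. adj A (zs ! l) (zs ! Suc l))"
        using k(2) ij(3) by (intro prod.cong refl) (auto simp: adj_flip step_edge_def)
      moreover have "adj (flip i j A) (zs ! k) (zs ! Suc k) = - adj A (zs ! k) (zs ! Suc k)"
        using ij(3) by (simp add: adj_flip step_edge_def)
      ultimately show ?thesis unfolding w split by simp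
    qed
    have "(\<Sum>A\<in>G. weight (adj A) zs) = (\<Sum>A\<in>G. weight (adj (flip i j A)) zs)"
      by (rule sum.reindex_bij_witness[where i = "flip i j" and j = "flip i j"])
        (use G ij flip_flip in \<open>auto simp: flip_closed_def\<close>)
    also have "\<dots> = - (\<Sum>A\<in>G. weight (adj A) zs)" by (simp add: f sum_negf)
    finally show ?thesis by simp
  next
    case False
    have "weight (adj A) zs = 0" if "A \<in> G" for A
    proof -
      have "A \<in> carrier_mat m n" using G that by blast
      then have "adj A (zs ! k) (zs ! Suc k) = 0" using False
        by (cases "zs ! k"; cases "zs ! Suc k") (auto simp: step_edge_def doubleton_eq_iff)
      then show ?thesis unfolding w split by simp
    qed
    then show ?thesis by (simp add: sum.neutral)
  qed
qed

lemma finite_signed_biregular: "finite (signed_biregular m n s t)"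
proof -
  let ?F = "PiE ({..<m} \<times> {..<n}) (\<lambda>_. {0, 1, - 1 :: real})"
  have "signed_biregular m n s t \<subseteq> (\<lambda>f. mat m n f) ` ?F"
  proof
    fix A assume A: "A \<in> signed_biregular m n s t"
    note D = signed_biregularD[OF A]
    let ?f = "restrict (\<lambda>p. A $$ p) ({..<m} \<times> {..<n})"
    have "A = mat m n ?f" by (intro eq_matI) (auto simp: D)
    moreover have "?f \<in> ?F" using D(4) by (auto simp: PiE_def Pi_def)
    ultimately show "A \<in> (\<lambda>f. mat m n f) ` ?F" by blast
  qed
  then show ?thesis by (rule finite_subset) (intro finite_imageI finite_PiE, auto)
qed

text \<open>Here \<open>s - 1\<close> and \<open>t - 1\<close> are the branching numbers and \<open>\<rho> = 1\<close> would be the edge of the bulk.\<close>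
definition outlier :: "nat \<Rightarrow> nat \<Rightarrow> real \<Rightarrow> real mat \<Rightarrow> bool" where
  "outlier s t \<rho> A \<longleftrightarrow> (\<exists>K. eigenvalue (A * transpose_mat A) K \<and>
     (\<rho> + 1 / \<rho>) * sqrt ((real s - 1) * (real t - 1)) \<le> \<bar>K - (real s - 1) - (real t - 1)\<bar>)"

definition edge :: "real mat \<Rightarrow> nat + nat \<Rightarrow> nat + nat \<Rightarrow> bool" where
  "edge A x y \<longleftrightarrow> adj A x y \<noteq> 0"

lemma edge_bipartite_bounded:
  assumes A: "A \<in> signed_biregular m n s t" and st: "2 \<le> t" "t \<le> s" and L: "1 \<le> L"
  shows "bipartite_bounded (edge A) isl (s - 1) (t - 1) L"
proof
  note D = signed_biregularD[OF A]
  show "edge A x y \<Longrightarrow> edge A y x" for x y by (simp add: edge_def adj_sym)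
  show "edge A x y \<Longrightarrow> isl x \<noteq> isl y" for x y using adj_side by (simp add: edge_def)
  have sub: "{y. edge A x y} \<subseteq> verts m n" for x using adj_verts[OF D(1)] by (auto simp: edge_def)
  show "finite {y. edge A x y}" for x by (rule finite_subset[OF sub finite_verts])
  show "card {y. edge A x y} \<le> Suc (if isl x then s - 1 else t - 1)" for x
  proof (cases x)
    case (Inl i)
    have sub': "{y. edge A x y} \<subseteq> Inr ` {j. j < n \<and> A $$ (i, j) \<noteq> 0}" if "i < m"
    proof
      fix y assume "y \<in> {y. edge A x y}"
      then show "y \<in> Inr ` {j. j < n \<and> A $$ (i, j) \<noteq> 0}"
        using Inl D by (cases y) (auto simp: edge_def split: if_splits)
    qed
    have "card {y. edge A x y} \<le> card {j. j < n \<and> A $$ (i, j) \<noteq> 0}" if "i < m"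
      by (rule order_trans[OF card_mono[OF _ sub'[OF that]] card_image_le]) simp_all
    moreover have "{y. edge A x y} = {}" if "\<not> i < m"
      using that Inl D by (auto simp: edge_def adj_def split: sum.splits)
    ultimately show ?thesis using D(5)[of i] Inl st by (cases "i < m") auto
  next
    case (Inr j)
    have sub': "{y. edge A x y} \<subseteq> Inl ` {i. i < m \<and> A $$ (i, j) \<noteq> 0}" if "j < n"
    proof
      fix y assume "y \<in> {y. edge A x y}"
      then show "y \<in> Inl ` {i. i < m \<and> A $$ (i, j) \<noteq> 0}"
        using Inr D by (cases y) (auto simp: edge_def split: if_splits)
    qed
    have "card {y. edge A x y} \<le> card {i. i < m \<and> A $$ (i, j) \<noteq> 0}" if "j < n"
      by (rule order_trans[OF card_mono[OF _ sub'[OF that]] card_image_le]) simp_all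
    moreover have "{y. edge A x y} = {}" if "\<not> j < n"
      using that Inr D by (auto simp: edge_def adj_def split: sum.splits)
    ultimately show ?thesis using D(6)[of j] Inr st by (cases "j < n") auto
  qed
  show "1 \<le> t - 1" "t - 1 \<le> s - 1" "1 \<le> L" using st L by auto
qed

text \<open>After the cancellation each surviving walk has weight at most 1, and weight 0 unless it
  follows edges of A. Returning to a sum over A first, the survivors are exactly walks to which the
  bound for a single support applies.\<close>

lemma sum_frobenius_le:
  fixes C :: real
  assumes G: "G \<subseteq> signed_biregular m n s t" "flip_closed m n G" and st: "2 \<le> t" "t \<le> s" and h: "1 \<le> h"
    and c: "\<And>A. A \<in> G \<Longrightarrow>
      real (card (bipartite_bounded.closed_walks (edge A) h (2 * h) (Inl ` {..<m}))) \<le> C"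
  shows "(\<Sum>A\<in>G. frobenius m n h A) \<le> card G * C"
proof -
  let ?R = "{x \<in> verts m n. isl x}"
  let ?Z = "\<lambda>x. {zs. length zs = Suc (2 * h) \<and> set zs \<subseteq> verts m n \<and> zs ! 0 = x \<and> zs ! (2 * h) = x \<and>
     (\<forall>i. Suc i < 2 * h \<and> Suc i \<noteq> h \<longrightarrow> zs ! i \<noteq> zs ! (i + 2))}"
  let ?w = "\<lambda>A zs. weight (adj A) zs"
  let ?good = "\<lambda>A zs. singleton_free (2 * h) (nth zs) \<and> (\<forall>i<2 * h. edge A (zs ! i) (zs ! Suc i))"
  have finZ: "finite (?Z x)" for x
    by (rule finite_subset[OF _ finite_lists_length_eq[OF finite_verts[of m n], of "Suc (2 * h)"]]) auto
  have finR: "finite ?R" using finite_verts by simp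
  have finG: "finite G" using G finite_signed_biregular finite_subset by blast
  have R: "?R = Inl ` {..<m}" by (auto simp: verts_def)
  have fr: "frobenius m n h A = (\<Sum>x\<in>?R. \<Sum>zs\<in>?Z x. ?w A zs)" if "A \<in> G" for A
  proof -
    interpret weighted_graph "verts m n" "adj A" "\<lambda>x. if isl x then real s else real t"
      by (rule signed_weighted_graph) (use G that in blast)
    show ?thesis by (simp add: frobenius_def closedset_def)
  qed
  have wle: "?w A zs \<le> (if \<forall>i<2 * h. edge A (zs ! i) (zs ! Suc i) then 1 else 0)"
    if "A \<in> G" "length zs = Suc (2 * h)" for A zs
  proof -
    have w: "?w A zs = (\<Prod>i<2 * h. adj A (zs ! i) (zs ! Suc i))" using that by (simp add: weight_nth)
    have a1: "\<bar>adj A x y\<bar> \<le> 1" for x y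
    proof -
      interpret weighted_graph "verts m n" "adj A" "\<lambda>x. if isl x then real s else real t"
        by (rule signed_weighted_graph) (use G that in blast)
      have "adj A x y = 0 \<or> adj A x y * adj A x y = 1" using cube[of x y] by auto
      then show ?thesis by (auto simp: square_eq_1_iff)
    qed
    show ?thesis
    proof (cases "\<forall>i<2 * h. edge A (zs ! i) (zs ! Suc i)")
      case True
      have "?w A zs \<le> \<bar>?w A zs\<bar>" by simp
      also have "\<dots> = (\<Prod>i<2 * h. \<bar>adj A (zs ! i) (zs ! Suc i)\<bar>)" unfolding w by (rule abs_prod)
      also have "\<dots> \<le> 1" using a1 by (intro prod_le_1) auto
      finally show ?thesis using True by simp
    next
      case False
      then obtain i where "i < 2 * h" "adj A (zs ! i) (zs ! Suc i) = 0" by (auto simp: edge_def)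
      then have "?w A zs = 0" unfolding w by (intro prod_zero) auto
      then show ?thesis by simp
    qed
  qed
  have "(\<Sum>A\<in>G. frobenius m n h A) = (\<Sum>A\<in>G. \<Sum>x\<in>?R. \<Sum>zs\<in>?Z x. ?w A zs)" by (rule sum.cong[OF refl fr])
  also have "\<dots> = (\<Sum>x\<in>?R. \<Sum>A\<in>G. \<Sum>zs\<in>?Z x. ?w A zs)" by (rule sum.swap)
  also have "\<dots> = (\<Sum>x\<in>?R. \<Sum>zs\<in>?Z x. \<Sum>A\<in>G. ?w A zs)"
    by (rule sum.cong[OF refl]) (rule sum.swap)
  also have "\<dots> \<le> (\<Sum>x\<in>?R. \<Sum>zs\<in>?Z x. \<Sum>A\<in>G. if ?good A zs then 1 else 0)"
  proof (rule sum_mono, rule sum_mono)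
    fix x zs assume "zs \<in> ?Z x"
    then have l: "length zs = Suc (2 * h)" by simp
    show "(\<Sum>A\<in>G. ?w A zs) \<le> (\<Sum>A\<in>G. if ?good A zs then 1 else 0)"
    proof (cases "singleton_free (2 * h) (nth zs)")
      case True
      then show ?thesis using wle[OF _ l] by (intro sum_mono) simp
    next
      case False
      have "G \<subseteq> carrier_mat m n" using G(1) signed_biregularD(1) by blast
      then have "(\<Sum>A\<in>G. ?w A zs) = 0" by (rule sum_weight_singleton[OF _ G(2) l False])
      then show ?thesis by (simp add: sum_nonneg)
    qed
  qed
  also have "\<dots> = (\<Sum>x\<in>?R. \<Sum>A\<in>G. \<Sum>zs\<in>?Z x. if ?good A zs then 1 else 0)"
    by (rule sum.cong[OF refl]) (rule sum.swap)
  also have "\<dots> = (\<Sum>A\<in>G. \<Sum>x\<in>?R. \<Sum>zs\<in>?Z x. if ?good A zs then 1 else 0)" by (rule sum.swap)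
  also have "\<dots> \<le> (\<Sum>A\<in>G. C)"
  proof (rule sum_mono)
    fix A assume A: "A \<in> G"
    then have AS: "A \<in> signed_biregular m n s t" using G by blast
    interpret B: bipartite_bounded "edge A" isl "s - 1" "t - 1" h "2 * h"
      by (rule edge_bipartite_bounded[OF AS st]) (use h in simp)
    have finW: "finite (B.closed_walks (Inl ` {..<m}))"
      using B.walks_kraft[of "Inl ` {..<m}"] unfolding B.closed_walks_def by simp
    have sub: "(\<Union>x\<in>?R. {zs \<in> ?Z x. ?good A zs}) \<subseteq> B.closed_walks (Inl ` {..<m})"
    proof
      fix zs assume "zs \<in> (\<Union>x\<in>?R. {zs \<in> ?Z x. ?good A zs})"
      then have zs: "length zs = Suc (2 * h)" "zs ! 0 \<in> ?R" "zs ! (2 * h) = zs ! 0"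
        "\<And>i. Suc i < 2 * h \<Longrightarrow> Suc i \<noteq> h \<Longrightarrow> zs ! i \<noteq> zs ! (i + 2)" "?good A zs" by auto
      have "zs ! i \<noteq> zs ! Suc i" if "i < 2 * h" for i
        using zs(5) that B.side[of "zs ! i" "zs ! Suc i"] by auto
      then have "nbwalk h (2 * h) (nth zs)" using zs(4) unfolding nbwalk_def by blast
      then show "zs \<in> B.closed_walks (Inl ` {..<m})" using zs R
        unfolding B.closed_walks_def B.walks_def by auto
    qed
    have "(\<Sum>x\<in>?R. \<Sum>zs\<in>?Z x. if ?good A zs then 1 else (0::real)) = (\<Sum>x\<in>?R. real (card {zs \<in> ?Z x. ?good A zs}))"
      by (rule sum.cong[OF refl]) (use finZ in \<open>simp add: sum.If_cases Int_def\<close>)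
    also have "\<dots> = real (card (\<Union>x\<in>?R. {zs \<in> ?Z x. ?good A zs}))"
    proof -
      have "card (\<Union>x\<in>?R. {zs \<in> ?Z x. ?good A zs}) = (\<Sum>x\<in>?R. card {zs \<in> ?Z x. ?good A zs})"
      proof (rule card_UN_disjoint[OF finR])
        have "finite {zs \<in> ?Z x. ?good A zs}" for x by (rule finite_subset[OF _ finZ[of x]]) auto
        then show "\<forall>x\<in>?R. finite {zs \<in> ?Z x. ?good A zs}" by blast
      qed auto
      then show ?thesis by simp
    qed
    also have "\<dots> \<le> real (card (B.closed_walks (Inl ` {..<m})))"
      using card_mono[OF finW sub] by simp
    also have "\<dots> \<le> C" by (rule c[OF A])
    finally show "(\<Sum>x\<in>?R. \<Sum>zs\<in>?Z x. if ?good A zs then 1 else 0) \<le> C" .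
  qed
  finally show ?thesis by simp
qed

text \<open>Markov's inequality for the nonnegative quantity \<open>frobenius\<close>.\<close>

lemma outlier_count:
  fixes C :: real
  assumes G: "G \<subseteq> signed_biregular m n s t" "flip_closed m n G" and st: "2 \<le> t" "t \<le> s" and rho: "1 < \<rho>"
    and c: "\<And>A. A \<in> G \<Longrightarrow>
      real (card (bipartite_bounded.closed_walks (edge A) (2 * (j + 2)) (2 * (2 * (j + 2))) (Inl ` {..<m}))) \<le> C"
  shows "real (card {A \<in> G. outlier s t \<rho> A}) * (sqrt ((real s - 1) * (real t - 1)) ^ (j + 2) * (\<rho> ^ j * (\<rho> - 1)))\<^sup>2
    \<le> card G * C"
proof -
  let ?T = "(sqrt ((real s - 1) * (real t - 1)) ^ (j + 2) * (\<rho> ^ j * (\<rho> - 1)))\<^sup>2"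
  have finG: "finite G" using G finite_signed_biregular finite_subset by blast
  have "real (card {A \<in> G. outlier s t \<rho> A}) * ?T = (\<Sum>A\<in>{A \<in> G. outlier s t \<rho> A}. ?T)" by simp
  also have "\<dots> \<le> (\<Sum>A\<in>{A \<in> G. outlier s t \<rho> A}. frobenius m n (2 * (j + 2)) A)"
  proof (rule sum_mono)
    fix A assume "A \<in> {A \<in> G. outlier s t \<rho> A}"
    then have "A \<in> signed_biregular m n s t" "outlier s t \<rho> A" using G by auto
    then show "?T \<le> frobenius m n (2 * (j + 2)) A" unfolding outlier_def
      using far_eigenvalue_frobenius[OF _ st rho, where j = j] by blast
  qed
  also have "\<dots> \<le> (\<Sum>A\<in>G. frobenius m n (2 * (j + 2)) A)"
    by (intro sum_mono2[OF finG]) (use G frobenius_nonneg in blast)+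
  also have "\<dots> \<le> card G * C" by (rule sum_frobenius_le[OF G st _ c]) auto
  finally show ?thesis .
qed

section \<open>Switchings and short cycles\<close>

definition swap_index :: "nat \<Rightarrow> nat \<Rightarrow> nat \<Rightarrow> nat" where
  "swap_index a b k = (if k = a then b else if k = b then a else k)"

lemma swap_index_swap_index [simp]: "swap_index a b (swap_index a b k) = k"
  by (auto simp: swap_index_def)

lemma card_swap_index: "a < n \<Longrightarrow> b < n \<Longrightarrow> card {l. l < n \<and> P (swap_index a b l)} = card {l. l < n \<and> P l}"
proof -
  assume ab: "a < n" "b < n"
  have "bij_betw (swap_index a b) {l. l < n \<and> P (swap_index a b l)} {l. l < n \<and> P l}"
    by (rule bij_betwI[where g = "swap_index a b"]) (use ab in \<open>auto simp: swap_index_def\<close>)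
  then show ?thesis by (rule bij_betw_same_card)
qed

text \<open>If the entries \<open>(u, v)\<close>, \<open>(x, y)\<close> are nonzero and \<open>(u, y)\<close>, \<open>(x, v)\<close> vanish, exchanging the columns
  \<open>v\<close> and \<open>y\<close> in the two rows preserves all row and column counts.\<close>
definition switch :: "nat \<Rightarrow> nat \<Rightarrow> nat \<Rightarrow> nat \<Rightarrow> real mat \<Rightarrow> real mat" where
  "switch u v x y A = mat (dim_row A) (dim_col A) (\<lambda>(k, l). A $$ (k, if k = u \<or> k = x then swap_index v y l else l))"

lemma switch_signed_biregular:
  assumes A: "A \<in> signed_biregular m n s t" and uvxy: "u < m" "x < m" "v < n" "y < n"
    and nz: "A $$ (u, v) \<noteq> 0" "A $$ (x, y) \<noteq> 0" "A $$ (u, y) = 0" "A $$ (x, v) = 0"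
  shows "switch u v x y A \<in> signed_biregular m n s t"
proof -
  note D = signed_biregularD[OF A]
  have e: "switch u v x y A $$ (k, l) = A $$ (k, if k = u \<or> k = x then swap_index v y l else l)" if "k < m" "l < n" for k l
    using that D by (simp add: switch_def)
  have b: "(if k = u \<or> k = x then swap_index v y l else l) < n" if "l < n" for k l using that uvxy by (auto simp: swap_index_def)
  have "card {l. l < n \<and> switch u v x y A $$ (k, l) \<noteq> 0} = s" if k: "k < m" for k
  proof -
    have "{l. l < n \<and> switch u v x y A $$ (k, l) \<noteq> 0} = {l. l < n \<and> A $$ (k, if k = u \<or> k = x then swap_index v y l else l) \<noteq> 0}"
    proof (intro Collect_cong conj_cong refl)
      fix l assume "l < n"
      then show "switch u v x y A $$ (k, l) \<noteq> 0 \<longleftrightarrow> A $$ (k, if k = u \<or> k = x then swap_index v y l else l) \<noteq> 0"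
        by (simp only: e[OF k])
    qed
    also have "card \<dots> = card {l. l < n \<and> A $$ (k, l) \<noteq> 0}"
    proof (cases "k = u \<or> k = x")
      case True
      then show ?thesis using card_swap_index[OF uvxy(3,4), of "\<lambda>l. A $$ (k, l) \<noteq> 0"] by simp
    qed simp
    finally show ?thesis using D(5)[OF k] by simp
  qed
  moreover have "card {k. k < m \<and> switch u v x y A $$ (k, l) \<noteq> 0} = t" if l: "l < n" for l
  proof -
    have "{k. k < m \<and> switch u v x y A $$ (k, l) \<noteq> 0} = {k. k < m \<and> A $$ (if l = v \<or> l = y then swap_index u x k else k, l) \<noteq> 0}"
    proof (intro Collect_cong conj_cong refl)
      fix k assume "k < m"
      then show "switch u v x y A $$ (k, l) \<noteq> 0 \<longleftrightarrow> A $$ (if l = v \<or> l = y then swap_index u x k else k, l) \<noteq> 0"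
        using e[OF _ l] nz by (auto simp: swap_index_def)
    qed
    also have "card \<dots> = card {k. k < m \<and> A $$ (k, l) \<noteq> 0}"
    proof (cases "l = v \<or> l = y")
      case True
      then show ?thesis using card_swap_index[OF uvxy(1,2), of "\<lambda>k. A $$ (k, l) \<noteq> 0"] by simp
    qed simp
    finally show ?thesis using D(6)[OF l] by simp
  qed
  moreover have "switch u v x y A $$ (k, l) \<in> {0, 1, - 1}" if "k < m" "l < n" for k l
    using D(4)[OF that(1) b[OF that(2)]] e[OF that] by simp
  moreover have "switch u v x y A \<in> carrier_mat m n" by (simp add: switch_def D)
  ultimately show ?thesis unfolding signed_biregular_def by simp
qed

lemma switch_switch:
  assumes "A \<in> carrier_mat m n" "v < n" "y < n"
  shows "switch u v x y (switch u v x y A) = A"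
  by (intro eq_matI) (use assms in \<open>auto simp: switch_def swap_index_def\<close>)

definition containing :: "nat \<Rightarrow> nat \<Rightarrow> nat \<Rightarrow> nat \<Rightarrow> (nat \<times> nat) set \<Rightarrow> real mat set" where
  "containing m n s t S = {A \<in> signed_biregular m n s t. \<forall>p\<in>S. A $$ p \<noteq> 0}"

lemma card_support:
  assumes A: "A \<in> signed_biregular m n s t"
  shows "card {(x, y). x < m \<and> y < n \<and> A $$ (x, y) \<noteq> 0} = m * s"
proof -
  have "{(x, y). x < m \<and> y < n \<and> A $$ (x, y) \<noteq> 0} = (SIGMA x:{..<m}. {y. y < n \<and> A $$ (x, y) \<noteq> 0})" by auto
  then show ?thesis using signed_biregularD(5)[OF A] by (simp add: card_SigmaI)
qed

text \<open>Double counting of the switchings that destroy the entry (u, v). Of the m s nonzero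
  entries (x, y), at most s t share a column with a nonzero entry of row u, at most s t share a row
  with one of column v, and those in S must stay. In the other direction the new entries (x, v) and
  (u, y) leave t choices for x and s for y.\<close>

lemma switching_step:
  assumes S: "finite S" "S \<subseteq> {..<m} \<times> {..<n}" and uv: "u < m" "v < n" "(u, v) \<notin> S"
  shows "card (containing m n s t (insert (u, v) S)) * (m * s - (2 * s * t + card S)) \<le> s * t * card (containing m n s t S)"
proof -
  let ?X = "containing m n s t (insert (u, v) S)" and ?Y = "containing m n s t S"
  let ?sw = "\<lambda>A. {(x, y). x < m \<and> y < n \<and> A $$ (x, y) \<noteq> 0 \<and> A $$ (u, y) = 0 \<and> A $$ (x, v) = 0 \<and> (x, y) \<notin> S}"
  let ?bk = "\<lambda>A. {x. x < m \<and> A $$ (x, v) \<noteq> 0} \<times> {y. y < n \<and> A $$ (u, y) \<noteq> 0}"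
  have fin: "finite ?X" "finite ?Y" using finite_signed_biregular[of m n s t] by (auto simp: containing_def)
  have finsw: "finite (?sw A)" for A by (rule finite_subset[of _ "{..<m} \<times> {..<n}"]) auto
  have lower: "m * s - (2 * s * t + card S) \<le> card (?sw A)" if A: "A \<in> ?X" for A
  proof -
    have AS: "A \<in> signed_biregular m n s t" using A by (simp add: containing_def)
    note D = signed_biregularD[OF AS]
    let ?U = "SIGMA y:{y. y < n \<and> A $$ (u, y) \<noteq> 0}. {x. x < m \<and> A $$ (x, y) \<noteq> 0}"
    let ?V = "SIGMA x:{x. x < m \<and> A $$ (x, v) \<noteq> 0}. {y. y < n \<and> A $$ (x, y) \<noteq> 0}"
    have "card ?U = (\<Sum>y\<in>{y. y < n \<and> A $$ (u, y) \<noteq> 0}. t)" using D(6) by (simp add: card_SigmaI)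
    then have cU: "card ?U = s * t" using D(5)[OF uv(1)] by simp
    have "card ?V = (\<Sum>x\<in>{x. x < m \<and> A $$ (x, v) \<noteq> 0}. s)" using D(5) by (simp add: card_SigmaI)
    then have cV: "card ?V = s * t" using D(6)[OF uv(2)] by simp
    have finU: "finite ?U" "finite ?V" by auto
    have "{(x, y). x < m \<and> y < n \<and> A $$ (x, y) \<noteq> 0} \<subseteq> ?sw A \<union> (prod.swap ` ?U \<union> (?V \<union> S))"
      by (auto simp: image_iff)
    then have "m * s \<le> card (?sw A \<union> (prod.swap ` ?U \<union> (?V \<union> S)))"
      unfolding card_support[OF AS, symmetric] by (rule card_mono[rotated]) (use finsw finU S in auto)
    also have "\<dots> \<le> card (?sw A) + (card (prod.swap ` ?U) + (card ?V + card S))"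
      by (intro order_trans[OF card_Un_le] add_mono order_refl)
    also have "card (prod.swap ` ?U) \<le> card ?U" by (rule card_image_le[OF finU(1)])
    finally show ?thesis using cU cV by simp
  qed
  have upper: "card (?bk A) = s * t" if "A \<in> ?Y" for A
  proof -
    have AS: "A \<in> signed_biregular m n s t" using that by (simp add: containing_def)
    show ?thesis using signed_biregularD(5,6)[OF AS] uv by (simp add: card_cartesian_product)
  qed
  have "card ?X * (m * s - (2 * s * t + card S)) \<le> (\<Sum>A\<in>?X. card (?sw A))"
    using sum_bounded_below[of ?X "m * s - (2 * s * t + card S)" "\<lambda>A. card (?sw A)"] lower by simp
  also have "\<dots> = card (SIGMA A:?X. ?sw A)"
  proof (rule card_SigmaI[symmetric, OF fin(1)])
    show "\<forall>A\<in>?X. finite (?sw A)" using finsw by blast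
  qed
  also have "\<dots> \<le> card (SIGMA A:?Y. ?bk A)"
  proof (rule card_inj_on_le[where f = "\<lambda>(A, (x, y)). (switch u v x y A, (x, y))"])
    show "inj_on (\<lambda>(A, (x, y)). (switch u v x y A, (x, y))) (SIGMA A:?X. ?sw A)"
    proof (rule inj_onI)
      fix p p' assume p: "p \<in> (SIGMA A:?X. ?sw A)" "p' \<in> (SIGMA A:?X. ?sw A)"
        and eq: "(\<lambda>(A, (x, y)). (switch u v x y A, (x, y))) p = (\<lambda>(A, (x, y)). (switch u v x y A, (x, y))) p'"
      obtain A x y where pp: "p = (A, (x, y))" by (metis prod.exhaust)
      obtain A' x' y' where pp': "p' = (A', (x', y'))" by (metis prod.exhaust)
      have e: "x' = x" "y' = y" "switch u v x y A = switch u v x y A'" using eq pp pp' by auto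
      have c: "A \<in> carrier_mat m n" "A' \<in> carrier_mat m n" "y < n" using p pp pp' by (auto simp: containing_def signed_biregular_def)
      have "A = switch u v x y (switch u v x y A)" by (rule switch_switch[OF c(1) uv(2) c(3), symmetric])
      also have "\<dots> = A'" unfolding e(3) by (rule switch_switch[OF c(2) uv(2) c(3)])
      finally show "p = p'" unfolding pp pp' e(1,2) by simp
    qed
    show "(\<lambda>(A, (x, y)). (switch u v x y A, (x, y))) ` (SIGMA A:?X. ?sw A) \<subseteq> (SIGMA A:?Y. ?bk A)"
    proof
      fix p assume "p \<in> (\<lambda>(A, (x, y)). (switch u v x y A, (x, y))) ` (SIGMA A:?X. ?sw A)"
      then obtain A x y where p: "p = (switch u v x y A, (x, y))" "A \<in> ?X" "(x, y) \<in> ?sw A" by auto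
      have AS: "A \<in> signed_biregular m n s t" and nzS: "\<And>q. q \<in> S \<Longrightarrow> A $$ q \<noteq> 0" and nuv: "A $$ (u, v) \<noteq> 0"
        using p(2) by (auto simp: containing_def)
      have xy: "x < m" "y < n" "A $$ (x, y) \<noteq> 0" "A $$ (u, y) = 0" "A $$ (x, v) = 0" "(x, y) \<notin> S" using p(3) by auto
      have dims: "dim_row A = m" "dim_col A = n" using signed_biregularD(2,3)[OF AS] .
      have e: "switch u v x y A $$ (k, l) = A $$ (k, if k = u \<or> k = x then swap_index v y l else l)" if "k < m" "l < n" for k l
        using that dims by (simp add: switch_def)
      have "switch u v x y A $$ (k, l) \<noteq> 0" if q: "(k, l) \<in> S" for k l
      proof -
        have kl: "k < m" "l < n" using S(2) q by auto
        have "A $$ (k, l) \<noteq> 0" using nzS[OF q] .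
        \<comment> \<open>In rows u and x the entries of S avoid both switched columns: (u, y) and
          (x, v) are zero, and (u, v) and (x, y) are not in S.\<close>
        moreover have "(k = u \<or> k = x) \<Longrightarrow> l \<noteq> v \<and> l \<noteq> y" using q uv(3) xy \<open>A $$ (k, l) \<noteq> 0\<close> by auto
        ultimately show ?thesis using e[OF kl] by (auto simp: swap_index_def)
      qed
      then have "switch u v x y A \<in> ?Y"
        using switch_signed_biregular[OF AS uv(1) xy(1) uv(2) xy(2) nuv xy(3,4,5)] by (auto simp: containing_def)
      moreover have "switch u v x y A $$ (x, v) \<noteq> 0" "switch u v x y A $$ (u, y) \<noteq> 0"
        using e[OF xy(1) uv(2)] e[OF uv(1) xy(2)] nuv xy by (auto simp: swap_index_def)
      ultimately show "p \<in> (SIGMA A:?Y. ?bk A)" using p xy uv by auto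
    qed
    show "finite (SIGMA A:?Y. ?bk A)" using fin by auto
  qed
  also have "\<dots> = (\<Sum>A\<in>?Y. card (?bk A))" using fin by (subst card_SigmaI) auto
  also have "\<dots> = s * t * card ?Y" using upper by simp
  finally show ?thesis .
qed

text \<open>The entries of S are prescribed one after the other; by \<open>switching_step\<close>
  each costs a factor of at most s t / (m s / 2) = 2 t / m.\<close>

lemma containing_bound:
  assumes S: "finite S" "S \<subseteq> {..<m} \<times> {..<n}" and big: "2 * (2 * s * t + card S) \<le> m * s" and s: "0 < s" and m: "0 < m"
  shows "real (card (containing m n s t S)) \<le> (2 * real t / m) ^ card S * card (signed_biregular m n s t)"
  using assms(1,2,3)
proof (induction S rule: finite_induct)
  case empty
  then show ?case by (simp add: containing_def)
next
  case (insert p S)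
  obtain u v where p: "p = (u, v)" by (cases p)
  let ?X = "containing m n s t (insert p S)" and ?Y = "containing m n s t S"
  have cS: "card (insert p S) = Suc (card S)" using insert by simp
  have IH: "real (card ?Y) \<le> (2 * real t / m) ^ card S * card (signed_biregular m n s t)"
    using insert cS by simp
  have "card ?X * (m * s - (2 * s * t + card S)) \<le> s * t * card ?Y"
    unfolding p by (rule switching_step) (use insert p in auto)
  moreover have "m * s \<le> 2 * (m * s - (2 * s * t + card S))" using insert.prems cS by simp
  then have "card ?X * (m * s) \<le> 2 * (card ?X * (m * s - (2 * s * t + card S)))"
    using mult_le_mono2[of "m * s" "2 * (m * s - (2 * s * t + card S))" "card ?X"] by (simp add: mult.left_commute)
  ultimately have "card ?X * (m * s) \<le> 2 * (s * t * card ?Y)" by linarith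
  then have "s * (card ?X * m) \<le> s * (2 * t * card ?Y)" by (simp add: mult_ac)
  then have "card ?X * m \<le> 2 * t * card ?Y" using s by simp
  then have "real (card ?X * m) \<le> real (2 * t * card ?Y)" by (rule of_nat_mono)
  then have "real (card ?X) * m \<le> 2 * real t * card ?Y" by (simp only: of_nat_mult of_nat_numeral)
  then have "real (card ?X) \<le> (2 * real t / m) * card ?Y" using m by (simp add: field_simps)
  also have "\<dots> \<le> (2 * real t / m) * ((2 * real t / m) ^ card S * card (signed_biregular m n s t))"
    using IH by (intro mult_left_mono) auto
  finally show ?case by (simp add: cS)
qed

section \<open>Union bound over walks with many cycles\<close>

text \<open>On prepending an entry, new values contribute at most |V| \<theta> in total, and
  repeated ones at most the length of the list.\<close>

lemma sum_power_distinct: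
  fixes \<theta> :: real
  assumes V: "finite V" and th: "0 \<le> \<theta>" "\<theta> \<le> 1"
  shows "(\<Sum>xs\<in>{xs. set xs \<subseteq> V \<and> length xs = k}. \<theta> ^ card (set xs)) \<le> (real (card V) * \<theta> + k) ^ k"
proof (induction k)
  case 0
  have "{xs. set xs \<subseteq> V \<and> length xs = 0} = {[]}" by auto
  then show ?case by simp
next
  case (Suc k)
  let ?L = "\<lambda>k. {xs. set xs \<subseteq> V \<and> length xs = k}"
  have finL: "finite (?L k)" for k by (rule finite_lists_length_eq[OF V])
  have im: "?L (Suc k) = (\<lambda>(y, xs). y # xs) ` (V \<times> ?L k)"
    by (auto simp: length_Suc_conv image_iff)
  have "(\<Sum>xs\<in>?L (Suc k). \<theta> ^ card (set xs)) = (\<Sum>(y, xs)\<in>V \<times> ?L k. \<theta> ^ card (set (y # xs)))"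
    unfolding im by (subst sum.reindex) (auto simp: inj_on_def comp_def case_prod_beta)
  also have "\<dots> = (\<Sum>y\<in>V. \<Sum>xs\<in>?L k. \<theta> ^ card (insert y (set xs)))"
    by (simp add: sum.cartesian_product)
  also have "\<dots> = (\<Sum>xs\<in>?L k. \<Sum>y\<in>V. \<theta> ^ card (insert y (set xs)))" by (rule sum.swap)
  also have "\<dots> \<le> (\<Sum>xs\<in>?L k. (card V * \<theta> + Suc k) * \<theta> ^ card (set xs))"
  proof (rule sum_mono)
    fix xs assume xs: "xs \<in> ?L k"
    have "(\<Sum>y\<in>V. \<theta> ^ card (insert y (set xs))) \<le> (\<Sum>y\<in>V. \<theta> * \<theta> ^ card (set xs) + (if y \<in> set xs then \<theta> ^ card (set xs) else 0))"
      by (rule sum_mono) (use th in \<open>auto simp: insert_absorb\<close>)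
    also have "\<dots> = card V * (\<theta> * \<theta> ^ card (set xs)) + card (V \<inter> set xs) * \<theta> ^ card (set xs)"
      using V by (simp add: sum.distrib sum.If_cases)
    also have "\<dots> \<le> card V * (\<theta> * \<theta> ^ card (set xs)) + Suc k * \<theta> ^ card (set xs)"
    proof -
      have "card (V \<inter> set xs) \<le> card (set xs)" by (intro card_mono) auto
      also have "\<dots> \<le> Suc k" using card_length[of xs] xs by simp
      finally show ?thesis using th by (intro add_left_mono mult_right_mono) auto
    qed
    finally show "(\<Sum>y\<in>V. \<theta> ^ card (insert y (set xs))) \<le> (card V * \<theta> + Suc k) * \<theta> ^ card (set xs)"
      by (simp add: distrib_right mult.assoc)
  qed
  also have "\<dots> = (card V * \<theta> + Suc k) * (\<Sum>xs\<in>?L k. \<theta> ^ card (set xs))" by (simp add: sum_distrib_left)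
  also have "\<dots> \<le> (card V * \<theta> + Suc k) * (card V * \<theta> + k) ^ k" using Suc th by (intro mult_left_mono) auto
  also have "\<dots> \<le> (card V * \<theta> + Suc k) * (card V * \<theta> + Suc k) ^ k" using th by (intro mult_left_mono power_mono) auto
  finally show ?case by simp
qed

text \<open>The graph traced out by a walk of length \<open>L\<close> has at most \<open>g\<close> independent cycles.\<close>
definition cycle_sparse :: "nat \<Rightarrow> nat \<Rightarrow> real mat \<Rightarrow> bool" where
  "cycle_sparse L g A \<longleftrightarrow> (\<forall>x. (\<forall>i<L. edge A (x i) (x (Suc i))) \<longrightarrow> card (step_edge x ` {..<L}) + 1 \<le> card (x ` {..L}) + g)"

lemma edge_flip: "edge (flip i j A) = edge A"
  by (intro ext) (simp add: edge_def adj_flip_zero)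

text \<open>A failure exhibits a trace with e \<ge> v + g edges. With \<theta> = 2 t / m such a
  trace is present with probability at most \<theta>^e \<le> \<theta>^g \<theta>^v;
  \<open>sum_power_distinct\<close> sums the factors \<theta>^v over all vertex lists, and
  \<theta>^g is the gain.\<close>

lemma cycle_sparse_fails_bound:
  assumes big: "2 * (2 * s * t + L) \<le> m * s" and s: "0 < s" and m: "0 < m" and L: "0 < L" and th: "2 * t \<le> m"
  shows "real (card {A \<in> signed_biregular m n s t. \<not> cycle_sparse L g A})
    \<le> (2 * real t / m) ^ g * (real (m + n) * (2 * real t / m) + (L + 1)) ^ (L + 1) * card (signed_biregular m n s t)"
proof -
  let ?\<theta> = "2 * real t / m"
  let ?N = "real (card (signed_biregular m n s t))"
  let ?V = "verts m n"
  let ?E = "\<lambda>xs. {(i, j). {Inl i, Inr j} \<in> step_edge (nth xs) ` {..<L}}"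
  let ?Q = "{xs. set xs \<subseteq> ?V \<and> length xs = Suc L}"
  let ?B = "{xs \<in> ?Q. step_edge (nth xs) ` {..<L} \<subseteq> (\<lambda>(i, j). {Inl i, Inr j}) ` ({..<m} \<times> {..<n}) \<and>
     card (nth xs ` {..L}) + g \<le> card (step_edge (nth xs) ` {..<L})}"
  have finV: "finite ?V" by (rule finite_verts)
  have finQ: "finite ?Q" by (rule finite_lists_length_eq[OF finV])
  have th1: "0 \<le> ?\<theta>" "?\<theta> \<le> 1" using th m by auto
  have Ecard: "?E xs \<subseteq> {..<m} \<times> {..<n}" "finite (?E xs)" "card (?E xs) = card (step_edge (nth xs) ` {..<L})" if "xs \<in> ?B" for xs
  proof -
    have sub: "step_edge (nth xs) ` {..<L} \<subseteq> (\<lambda>(i, j). {Inl i, Inr j}) ` ({..<m} \<times> {..<n})" using that by simp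
    have inj: "inj (\<lambda>(i, j). {Inl i, Inr j} :: (nat + nat) set)" by (auto simp: inj_on_def doubleton_eq_iff)
    have im: "(\<lambda>(i, j). {Inl i, Inr j}) ` ?E xs = step_edge (nth xs) ` {..<L}"
    proof
      show "step_edge (nth xs) ` {..<L} \<subseteq> (\<lambda>(i, j). {Inl i, Inr j}) ` ?E xs"
      proof
        fix e assume e: "e \<in> step_edge (nth xs) ` {..<L}"
        have "e \<in> (\<lambda>(i, j). {Inl i, Inr j}) ` ({..<m} \<times> {..<n})" by (rule subsetD[OF sub e])
        then obtain i j where "e = {Inl i, Inr j}" by auto
        then show "e \<in> (\<lambda>(i, j). {Inl i, Inr j}) ` ?E xs" using e by (intro image_eqI[of _ _ "(i, j)"]) auto
      qed
    qed auto
    show E1: "?E xs \<subseteq> {..<m} \<times> {..<n}"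
    proof
      fix p assume "p \<in> ?E xs"
      then obtain i j where p: "p = (i, j)" "{Inl i, Inr j} \<in> step_edge (nth xs) ` {..<L}" by auto
      have "{Inl i, Inr j} \<in> (\<lambda>(i, j). {Inl i, Inr j} :: (nat + nat) set) ` ({..<m} \<times> {..<n})" by (rule subsetD[OF sub p(2)])
      then obtain i' j' where "i' < m" "j' < n" "({Inl i, Inr j} :: (nat + nat) set) = {Inl i', Inr j'}" by auto
      then show "p \<in> {..<m} \<times> {..<n}" using p by (auto simp: doubleton_eq_iff)
    qed
    show "finite (?E xs)" by (rule finite_subset[OF E1]) simp
    have "card ((\<lambda>(i, j). {Inl i, Inr j} :: (nat + nat) set) ` ?E xs) = card (?E xs)"
      by (rule card_image[OF inj_on_subset[OF inj]]) simp
    then show "card (?E xs) = card (step_edge (nth xs) ` {..<L})" unfolding im by (rule sym)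
  qed
  have sub: "{A \<in> signed_biregular m n s t. \<not> cycle_sparse L g A} \<subseteq> (\<Union>xs\<in>?B. containing m n s t (?E xs))"
  proof
    fix A assume "A \<in> {A \<in> signed_biregular m n s t. \<not> cycle_sparse L g A}"
    then have A: "A \<in> signed_biregular m n s t" "\<not> cycle_sparse L g A" by auto
    note D = signed_biregularD[OF A(1)]
    obtain x where x0: "\<forall>i<L. edge A (x i) (x (Suc i))" "\<not> card (step_edge x ` {..<L}) + 1 \<le> card (x ` {..L}) + g"
      using A(2) unfolding cycle_sparse_def by blast
    have x: "\<And>i. i < L \<Longrightarrow> edge A (x i) (x (Suc i))" "card (x ` {..L}) + g \<le> card (step_edge x ` {..<L})"
      using x0 by auto
    define xs where "xs = map x [0..<Suc L]"
    have nx: "xs ! i = x i" if "i \<le> L" for i using that by (simp add: xs_def del: upt_Suc)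
    have e: "step_edge (nth xs) ` {..<L} = step_edge x ` {..<L}" by (rule image_cong[OF refl]) (simp add: step_edge_def nx)
    have v: "nth xs ` {..L} = x ` {..L}" by (rule image_cong[OF refl]) (simp add: nx)
    have xv: "x i \<in> ?V" if "i \<le> L" for i
    proof (cases "i < L")
      case True
      then show ?thesis using x(1)[of i] adj_verts[OF D(1)] by (auto simp: edge_def)
    next
      case False
      then obtain k where "L = Suc k" "i = L" using \<open>i \<le> L\<close> False L by (cases L) auto
      then show ?thesis using x(1)[of k] adj_verts[OF D(1)] by (auto simp: edge_def)
    qed
    have ex: "\<exists>i<m. \<exists>j<n. step_edge x k = {Inl i, Inr j} \<and> A $$ (i, j) \<noteq> 0" if "k < L" for k
      using x(1)[OF that] D unfolding edge_def step_edge_def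
      by (cases "x k"; cases "x (Suc k)") (auto simp: insert_commute split: if_splits)
    have "xs \<in> ?B"
    proof -
      have "length xs = Suc L" by (simp add: xs_def)
      moreover have "set xs \<subseteq> ?V" using xv by (auto simp: xs_def)
      moreover have "step_edge (nth xs) ` {..<L} \<subseteq> (\<lambda>(i, j). {Inl i, Inr j}) ` ({..<m} \<times> {..<n})"
        unfolding e using ex by fastforce
      ultimately show ?thesis using x(2) by (simp add: e v)
    qed
    moreover have "A \<in> containing m n s t (?E xs)"
    proof -
      have nz: "A $$ (i, j) \<noteq> 0" if "{Inl i, Inr j} \<in> step_edge (nth xs) ` {..<L}" for i j
      proof -
        have "{Inl i, Inr j} \<in> step_edge x ` {..<L}" using that by (simp only: e)
        then obtain k where k: "k < L" "step_edge x k = {Inl i, Inr j}" by (metis imageE lessThan_iff)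
        obtain i' j' where "step_edge x k = {Inl i', Inr j'}" "A $$ (i', j') \<noteq> 0" using ex[OF k(1)] by blast
        then show ?thesis using k(2) by (auto simp: doubleton_eq_iff)
      qed
      have "A $$ p \<noteq> 0" if p: "p \<in> ?E xs" for p
      proof (cases p)
        case (Pair i j)
        then show ?thesis using nz[of i j] p by simp
      qed
      then show ?thesis using A(1) by (simp only: containing_def mem_Collect_eq) simp
    qed
    ultimately show "A \<in> (\<Union>xs\<in>?B. containing m n s t (?E xs))" by (rule UN_I)
  qed
  have finC: "finite (containing m n s t S)" for S using finite_signed_biregular by (simp add: containing_def)
  have BQ: "?B \<subseteq> ?Q" by (rule Collect_restrict)
  have finB: "finite ?B" by (rule finite_subset[OF BQ finQ])
  have "finite (\<Union>xs\<in>?B. containing m n s t (?E xs))" by (rule finite_UN_I[OF finB finC])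
  then have "card {A \<in> signed_biregular m n s t. \<not> cycle_sparse L g A} \<le> card (\<Union>xs\<in>?B. containing m n s t (?E xs))"
    using sub by (rule card_mono)
  also have "\<dots> \<le> (\<Sum>xs\<in>?B. card (containing m n s t (?E xs)))" by (rule card_UN_le[OF finB])
  finally have "real (card {A \<in> signed_biregular m n s t. \<not> cycle_sparse L g A}) \<le> (\<Sum>xs\<in>?B. real (card (containing m n s t (?E xs))))"
    unfolding of_nat_sum[symmetric] by (rule of_nat_mono)
  also have "\<dots> \<le> (\<Sum>xs\<in>?B. ?\<theta> ^ g * ?\<theta> ^ card (set xs) * ?N)"
  proof (rule sum_mono)
    fix xs assume xs: "xs \<in> ?B"
    note E = Ecard[OF xs]
    have eL: "card (step_edge (nth xs) ` {..<L}) \<le> L" using card_image_le[of "{..<L}" "step_edge (nth xs)"] by simp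
    have lx: "length xs = Suc L" using conjunct1[OF CollectD[OF xs]] by simp
    have "{..L} = {0..<Suc L}" by auto
    moreover have "nth xs ` {0..<Suc L} = set xs" using nth_image[of "Suc L" xs] lx by simp
    ultimately have sx: "set xs = nth xs ` {..L}" by (simp only:)
    have cE: "card (?E xs) \<le> L" unfolding E(3) by (rule eL)
    have bigE: "2 * (2 * s * t + card (?E xs)) \<le> m * s"
      by (rule order_trans[OF mult_le_mono2[OF add_left_mono[OF cE]] big])
    have le: "card (set xs) + g \<le> card (?E xs)"
      unfolding E(3) sx by (rule conjunct2[OF conjunct2[OF CollectD[OF xs]]])
    have "real (card (containing m n s t (?E xs))) \<le> ?\<theta> ^ card (?E xs) * ?N"
      by (rule containing_bound[OF E(2,1) bigE s m])
    also have "\<dots> \<le> ?\<theta> ^ (card (set xs) + g) * ?N"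
      by (rule mult_right_mono[OF power_decreasing[OF le th1]]) simp
    also have "\<dots> = ?\<theta> ^ g * ?\<theta> ^ card (set xs) * ?N"
      by (simp only: power_add mult.commute)
    finally show "real (card (containing m n s t (?E xs))) \<le> ?\<theta> ^ g * ?\<theta> ^ card (set xs) * ?N" .
  qed
  also have "\<dots> = ?\<theta> ^ g * (\<Sum>xs\<in>?B. ?\<theta> ^ card (set xs)) * ?N"
    by (simp add: sum_distrib_left sum_distrib_right)
  also have "\<dots> \<le> ?\<theta> ^ g * (\<Sum>xs\<in>?Q. ?\<theta> ^ card (set xs)) * ?N"
    using th1 by (intro mult_right_mono mult_left_mono sum_mono2[OF finQ BQ]) auto
  also have "\<dots> \<le> ?\<theta> ^ g * (real (card ?V) * ?\<theta> + Suc L) ^ Suc L * ?N"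
    using sum_power_distinct[OF finV th1, of "Suc L"] th1 by (intro mult_right_mono mult_left_mono) auto
  also have "card ?V = m + n" by (simp add: verts_def card_Plus)
  finally show ?thesis by simp
qed

section \<open>Existence of biregular matrices\<close>

lemma add_mod_inj: assumes "(a + c) mod n = (a + d) mod n" "c < n" "d < n" shows "c = (d::nat)"
  using assms
proof (induction c d rule: linorder_wlog)
  case (le c d)
  then have "n dvd (a + d) - (a + c)" using mod_eq_dvd_iff_nat[of "a + c" "a + d" n] by simp
  then have "n dvd d - c" by simp
  then show ?case using le by (auto dest: dvd_imp_le)
qed auto

text \<open>The m s slots u = i s + c are dealt to the columns u mod n. A row owns s consecutive
  slots, which lie in distinct columns as s \<le> n, and every column receives t of them as m s = n
  t. Nonemptiness keeps the proportion in the theorem from being the default value of a division by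
  zero.\<close>

lemma signed_biregular_nonempty:
  assumes "m * s = n * t" "s \<le> n" "0 < n" "0 < s"
  shows "signed_biregular m n s t \<noteq> {}"
proof -
  let ?P = "\<lambda>i j. \<exists>c<s. (i * s + c) mod n = j"
  define A :: "real mat" where "A = mat m n (\<lambda>(i, j). if ?P i j then 1 else 0)"
  have Anz: "A $$ (i, j) \<noteq> 0 \<longleftrightarrow> ?P i j" if "i < m" "j < n" for i j
    using that by (cases "?P i j") (simp_all add: A_def)
  have row: "card {j. j < n \<and> A $$ (i, j) \<noteq> 0} = s" if "i < m" for i
  proof -
    have im: "{j. j < n \<and> A $$ (i, j) \<noteq> 0} = (\<lambda>c. (i * s + c) mod n) ` {..<s}"
    proof (rule Set.set_eqI)
      fix j
      show "j \<in> {j. j < n \<and> A $$ (i, j) \<noteq> 0} \<longleftrightarrow> j \<in> (\<lambda>c. (i * s + c) mod n) ` {..<s}"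
      proof (cases "j < n")
        case True
        then show ?thesis using Anz[OF that True] by (simp only: image_iff mem_Collect_eq) (metis lessThan_iff)
      next
        case False
        then show ?thesis using assms by auto
      qed
    qed
    have "inj_on (\<lambda>c. (i * s + c) mod n) {..<s}"
    proof (rule inj_onI)
      fix c d assume "c \<in> {..<s}" "d \<in> {..<s}" "(i * s + c) mod n = (i * s + d) mod n"
      then show "c = d" using add_mod_inj[of "i * s" c n d] assms(2) by simp
    qed
    then show ?thesis unfolding im by (subst card_image) simp_all
  qed
  have col: "card {i. i < m \<and> A $$ (i, j) \<noteq> 0} = t" if j: "j < n" for j
  proof -
    let ?U = "{u. u < m * s \<and> u mod n = j}"
    have U: "?U = (\<lambda>k. j + n * k) ` {..<t}"
    proof
      show "?U \<subseteq> (\<lambda>k. j + n * k) ` {..<t}"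
      proof
        fix u assume u: "u \<in> ?U"
        then have "u = j + n * (u div n)" by (metis (mono_tags, lifting) mem_Collect_eq mod_mult_div_eq)
        moreover have "u div n < t" using u assms by (simp add: less_mult_imp_div_less mult.commute)
        ultimately show "u \<in> (\<lambda>k. j + n * k) ` {..<t}" by blast
      qed
      show "(\<lambda>k. j + n * k) ` {..<t} \<subseteq> ?U"
      proof
        fix u assume "u \<in> (\<lambda>k. j + n * k) ` {..<t}"
        then obtain k where k: "k < t" "u = j + n * k" by auto
        have "n * Suc k \<le> n * t" using k by (intro mult_le_mono2) simp
        then show "u \<in> ?U" using k j assms by simp
      qed
    qed
    have "inj_on (\<lambda>k. j + n * k) {..<t}" using assms by (intro inj_onI) simp
    then have "card ?U = t" unfolding U by (simp add: card_image)
    moreover have "{i. i < m \<and> A $$ (i, j) \<noteq> 0} = (\<lambda>u. u div s) ` ?U"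
    proof
      show "{i. i < m \<and> A $$ (i, j) \<noteq> 0} \<subseteq> (\<lambda>u. u div s) ` ?U"
      proof
        fix i assume "i \<in> {i. i < m \<and> A $$ (i, j) \<noteq> 0}"
        then obtain c where c: "i < m" "c < s" "(i * s + c) mod n = j" using j Anz[of i j] by blast
        have "Suc i * s \<le> m * s" using c by (intro mult_le_mono1) simp
        then have "i * s + c < m * s" using c by simp
        then show "i \<in> (\<lambda>u. u div s) ` ?U" using c by (intro image_eqI[of _ _ "i * s + c"]) auto
      qed
      show "(\<lambda>u. u div s) ` ?U \<subseteq> {i. i < m \<and> A $$ (i, j) \<noteq> 0}"
      proof
        fix i assume "i \<in> (\<lambda>u. u div s) ` ?U"
        then obtain u where u: "u < m * s" "u mod n = j" "i = u div s" by auto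
        then have "i < m" using assms by (simp add: less_mult_imp_div_less)
        moreover have "?P i j" using u assms by (intro exI[of _ "u mod s"]) simp
        ultimately show "i \<in> {i. i < m \<and> A $$ (i, j) \<noteq> 0}" using j Anz[of i j] by simp
      qed
    qed
    moreover have "inj_on (\<lambda>u. u div s) ?U"
    proof (rule inj_onI)
      fix u u' assume u: "u \<in> ?U" "u' \<in> ?U" "u div s = u' div s"
      have "u = u div s * s + u mod s" "u' = u div s * s + u' mod s"
        unfolding u(3) using div_mult_mod_eq[of u s] div_mult_mod_eq[of u' s] u(3) by simp_all
      moreover have "u mod s < n" "u' mod s < n" using assms by (meson less_le_trans mod_less_divisor)+
      ultimately show "u = u'" using add_mod_inj[of "u div s * s" "u mod s" n "u' mod s"] u by auto
    qed
    ultimately show ?thesis by (simp add: card_image)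
  qed
  have "A \<in> signed_biregular m n s t" unfolding signed_biregular_def using row col by (auto simp: A_def)
  then show ?thesis by blast
qed

section \<open>Choice of scales\<close>

text \<open>Logarithm of the bound in \<open>outlier_fraction\<close> at x = \<mu>: the annotations
  contribute order x^3 ln x, and the x^4 from the number of rows is beaten by 3 x^4 from the growth
  in \<rho>.\<close>

lemma main_term_asymp:
  fixes C c D \<eta> :: real
  assumes "0 < C" "0 < c" "0 < \<eta>"
  shows "eventually (\<lambda>x. 3 + x^4 + (2*x + 6 + 2*c*x\<^sup>2*(2*x+4)) * ln (C * x^12) + D - 3*x^4 \<le> ln \<eta>) at_top"
proof -
  have "filterlim (\<lambda>x. 3 + x^4 + (2*x + 6 + 2*c*x\<^sup>2*(2*x+4)) * ln (C * x^12) + D - 3*x^4) at_bot at_top"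
    using assms by real_asymp
  then show ?thesis by (simp add: filterlim_at_bot)
qed

text \<open>Logarithm of the failure bound for full walks, of length 4 c x^4 with x cycles allowed:
  a gain of order x^5 against x^4 ln x for the number of walks.\<close>

lemma sparse_term1_asymp:
  fixes c \<eta> :: real
  assumes "0 < c" "0 < \<eta>"
  shows "eventually (\<lambda>x. x * (ln 2 + 100 * ln x - (x-1)^4) + (4*c*x^4+1) * ln (4*x^100 + 4*c*x^4+1) \<le> ln \<eta>) at_top"
proof -
  have "filterlim (\<lambda>x. x * (ln 2 + 100 * ln x - (x-1)^4) + (4*c*x^4+1) * ln (4*x^100 + 4*c*x^4+1)) at_bot at_top"
    using assms by real_asymp
  then show ?thesis by (simp add: filterlim_at_bot)
qed

text \<open>The same for windows of length 2 x^2 with one cycle allowed: x^4 against x^2 ln x.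
  Windows of length comparable to x^4 would not be covered.\<close>

lemma sparse_term2_asymp:
  fixes \<eta> :: real
  assumes "0 < \<eta>"
  shows "eventually (\<lambda>x. (ln 2 + 100 * ln x - (x-1)^4) + (2*x\<^sup>2+1) * ln (4*x^100 + 2*x\<^sup>2+1) \<le> ln \<eta>) at_top"
proof -
  have "filterlim (\<lambda>x::real. (ln 2 + 100 * ln x - (x-1)^4) + (2*x\<^sup>2+1) * ln (4*x^100 + 2*x\<^sup>2+1)) at_bot at_top"
    by real_asymp
  then show ?thesis by (simp add: filterlim_at_bot)
qed

text \<open>The first line fixes the exponent 100 of the threshold for s: the eighth power of the
  step cost is of order x^96. The second makes m large against both the degrees and the walk length,
  as switching requires.\<close>

lemma side_asymp:
  fixes C c \<alpha> :: real
  assumes "0 < C" "0 < c" "0 < \<alpha>"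
  shows "eventually (\<lambda>x. (C * x^12)^8 \<le> \<alpha> / 2 * x^100) at_top"
    and "eventually (\<lambda>x. 4*x^100 + 8*c*x^4 \<le> \<alpha> * exp ((x-1)^4)) at_top"
proof -
  have "eventually (\<lambda>x. C^8 * x^96 \<le> \<alpha> / 2 * x^100) at_top"
    using assms by real_asymp
  then show "eventually (\<lambda>x. (C * x^12)^8 \<le> \<alpha> / 2 * x^100) at_top"
    by (simp add: power_mult_distrib flip: power_mult)
  show "eventually (\<lambda>x. 4*x^100 + 8*c*x^4 \<le> \<alpha> * exp ((x-1)^4)) at_top"
    using assms by real_asymp
qed

text \<open>The power \<open>h\<close> of the mean branching occurs on both sides and cancels; only
  the number of rows, the annotation cost and the growth in \<rho> are left to compare.\<close>

lemma outlier_fraction: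
  fixes h j Z :: nat
  assumes G: "G \<subseteq> signed_biregular m n s t" "flip_closed m n G" and st: "2 \<le> t" "t \<le> s" and rho: "1 < \<rho>"
    and h: "h = 2 * (j + 2)"
    and c: "\<And>A. A \<in> G \<Longrightarrow> real (card (bipartite_bounded.closed_walks (edge A) h (2 * h) (Inl ` {..<m})))
       \<le> exp 3 * m * (sqrt ((real s - 1) * (real t - 1)) ^ h * \<Gamma> ^ Z)"
  shows "real (card {A \<in> G. outlier s t \<rho> A}) \<le> card G * (exp 3 * m * \<Gamma> ^ Z / (\<rho> ^ j * (\<rho> - 1))\<^sup>2)"
proof -
  define w where "w = sqrt ((real s - 1) * (real t - 1))"
  have w0: "0 < w" using st by (simp add: w_def)
  have "real (card {A \<in> G. outlier s t \<rho> A}) * (w ^ (j + 2) * (\<rho> ^ j * (\<rho> - 1)))\<^sup>2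
    \<le> card G * (exp 3 * m * (w ^ h * \<Gamma> ^ Z))"
    unfolding w_def by (rule outlier_count[OF G st rho]) (use c h in auto)
  also have "(w ^ (j + 2) * (\<rho> ^ j * (\<rho> - 1)))\<^sup>2 = w ^ h * (\<rho> ^ j * (\<rho> - 1))\<^sup>2"
    unfolding h power_mult_distrib[of "w ^ (j + 2)"] by (simp only: power_mult[symmetric] mult.commute[of 2])
  finally have "w ^ h * (real (card {A \<in> G. outlier s t \<rho> A}) * (\<rho> ^ j * (\<rho> - 1))\<^sup>2)
    \<le> w ^ h * (card G * (exp 3 * m * \<Gamma> ^ Z))" by (simp add: mult_ac)
  then have "real (card {A \<in> G. outlier s t \<rho> A}) * (\<rho> ^ j * (\<rho> - 1))\<^sup>2 \<le> card G * (exp 3 * m * \<Gamma> ^ Z)"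
    using w0 by (simp add: mult_le_cancel_left_pos)
  moreover have "0 < (\<rho> ^ j * (\<rho> - 1))\<^sup>2" using rho by simp
  ultimately show ?thesis by (simp add: pos_le_divide_eq)
qed

text \<open>Together with \<open>cost_base\<close> this repeats \<open>branching_mean\<close> and
  \<open>step_cost\<close> outside the locale, with real subtraction, for use in asymptotic
  estimates.\<close>

definition mean_branching :: "nat \<Rightarrow> nat \<Rightarrow> real" where "mean_branching s t = sqrt ((real s - 1) * (real t - 1))"
definition cost_base :: "nat \<Rightarrow> nat \<Rightarrow> nat \<Rightarrow> real" where "cost_base s t L = sqrt ((real s - 1) / (real t - 1)) * real L ^ 3"

lemma closed_count_dense:
  assumes A: "A \<in> signed_biregular m n s t" and st: "2 \<le> t" "t \<le> s" and h: "1 \<le> h"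
    and big: "cost_base s t (2 * h) ^ 8 \<le> mean_branching s t" and le: "cost_base s t (2 * h) \<le> \<Gamma>" and Z: "6 \<le> Z"
  shows "real (card (bipartite_bounded.closed_walks (edge A) h (2 * h) (Inl ` {..<m})))
       \<le> exp 3 * m * (sqrt ((real s - 1) * (real t - 1)) ^ h * \<Gamma> ^ Z)"
proof -
  interpret B: bipartite_bounded "edge A" isl "s - 1" "t - 1" h "2 * h"
    by (rule edge_bipartite_bounded[OF A st]) (use h in simp)
  have e: "B.branching_mean = mean_branching s t" "B.step_cost = cost_base s t (2 * h)"
  proof -
    have c: "real (s - 1) = real s - 1" "real (t - 1) = real t - 1" using st by (simp_all add: of_nat_diff)
    show "B.branching_mean = mean_branching s t" unfolding B.branching_mean_def mean_branching_def of_nat_mult c ..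
    show "B.step_cost = cost_base s t (2 * h)" unfolding B.step_cost_def B.branching_ratio_def cost_base_def c ..
  qed
  have m: "card (Inl ` {..<m} :: (nat + nat) set) = m" by (simp add: card_image)
  have "real (card (B.closed_walks (Inl ` {..<m}))) \<le> exp 3 * m * (mean_branching s t ^ h * cost_base s t (2 * h) ^ 6)"
    using B.closed_walks_dense[of "Inl ` {..<m}"] big unfolding e m by simp
  also have "\<dots> \<le> exp 3 * m * (mean_branching s t ^ h * \<Gamma> ^ Z)"
  proof (intro mult_left_mono)
    have "cost_base s t (2 * h) ^ 6 \<le> cost_base s t (2 * h) ^ Z" using B.step_cost Z unfolding e by (rule power_increasing[rotated])
    also have "\<dots> \<le> \<Gamma> ^ Z" using le B.step_cost unfolding e by (intro power_mono) auto
    finally show "cost_base s t (2 * h) ^ 6 \<le> \<Gamma> ^ Z" .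
  qed (use st in \<open>auto simp: mean_branching_def\<close>)
  finally show ?thesis by (simp add: mean_branching_def)
qed

lemma closed_count_sparse:
  assumes A: "A \<in> signed_biregular m n s t" and st: "2 \<le> t" "t \<le> s" and h: "1 \<le> h" "l dvd h" "0 < l"
    and cycle_sparse: "cycle_sparse (2 * h) g A" "cycle_sparse l 1 A" and le: "cost_base s t (2 * h) \<le> \<Gamma>"
    and Z: "Z = 2 * g + 6 + (2 * h) div l * (2 * g + 4)"
  shows "real (card (bipartite_bounded.closed_walks (edge A) h (2 * h) (Inl ` {..<m})))
       \<le> exp 3 * m * (sqrt ((real s - 1) * (real t - 1)) ^ h * \<Gamma> ^ Z)"
proof -
  interpret B: bipartite_bounded "edge A" isl "s - 1" "t - 1" h "2 * h"
    by (rule edge_bipartite_bounded[OF A st]) (use h in simp)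
  have e: "B.branching_mean = mean_branching s t" "B.step_cost = cost_base s t (2 * h)"
  proof -
    have c: "real (s - 1) = real s - 1" "real (t - 1) = real t - 1" using st by (simp_all add: of_nat_diff)
    show "B.branching_mean = mean_branching s t" unfolding B.branching_mean_def mean_branching_def of_nat_mult c ..
    show "B.step_cost = cost_base s t (2 * h)" unfolding B.step_cost_def B.branching_ratio_def cost_base_def c ..
  qed
  have m: "card (Inl ` {..<m} :: (nat + nat) set) = m" by (simp add: card_image)
  have f: "B.cycle_sparse_cycles (2 * h) g" "B.cycle_sparse_cycles l 1" using cycle_sparse unfolding cycle_sparse_def B.cycle_sparse_cycles_def by blast+
  have "real (card (B.closed_walks (Inl ` {..<m}))) \<le> exp 3 * m * (mean_branching s t ^ h * cost_base s t (2 * h) ^ Z)"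
    using B.closed_walks_sparse[OF _ refl h(2,3) f, of "Inl ` {..<m}"] unfolding e m Z by simp
  also have "\<dots> \<le> exp 3 * m * (mean_branching s t ^ h * \<Gamma> ^ Z)"
  proof (intro mult_left_mono)
    show "cost_base s t (2 * h) ^ Z \<le> \<Gamma> ^ Z" using le B.step_cost unfolding e by (intro power_mono) auto
  qed (use st in \<open>auto simp: mean_branching_def\<close>)
  finally show ?thesis by (simp add: mean_branching_def)
qed

lemma cycle_sparse_flip: "cycle_sparse L g (flip i j A) = cycle_sparse L g A"
  by (simp add: cycle_sparse_def edge_flip)

lemma outliers_dense:
  fixes h j Z :: nat
  assumes st: "2 \<le> t" "t \<le> s" and rho: "1 < \<rho>" and h: "h = 2 * (j + 2)"
    and big: "cost_base s t (2 * h) ^ 8 \<le> mean_branching s t" and le: "cost_base s t (2 * h) \<le> \<Gamma>" and Z: "6 \<le> Z"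
  shows "real (card {A \<in> signed_biregular m n s t. outlier s t \<rho> A})
     \<le> card (signed_biregular m n s t) * (exp 3 * m * \<Gamma> ^ Z / (\<rho> ^ j * (\<rho> - 1))\<^sup>2)"
  by (rule outlier_fraction[OF order_refl _ st rho h closed_count_dense])
    (use st big le Z h in \<open>auto simp: flip_closed_def intro: flip_signed_biregular\<close>)

text \<open>Cycle sparsity depends on the support alone, so the restricted family is still closed
  under sign flips; the excluded matrices are simply added.\<close>

lemma outliers_sparse:
  fixes h j Z :: nat
  assumes st: "2 \<le> t" "t \<le> s" and rho: "1 < \<rho>" and h: "h = 2 * (j + 2)" "l dvd h" "0 < l"
    and le: "cost_base s t (2 * h) \<le> \<Gamma>" and G0: "0 \<le> \<Gamma>"
    and Z: "Z = 2 * g + 6 + (2 * h) div l * (2 * g + 4)"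
  shows "real (card {A \<in> signed_biregular m n s t. outlier s t \<rho> A})
     \<le> card (signed_biregular m n s t) * (exp 3 * m * \<Gamma> ^ Z / (\<rho> ^ j * (\<rho> - 1))\<^sup>2)
       + card {A \<in> signed_biregular m n s t. \<not> cycle_sparse (2 * h) g A} + card {A \<in> signed_biregular m n s t. \<not> cycle_sparse l 1 A}"
proof -
  let ?S = "signed_biregular m n s t"
  define G where "G = {A \<in> ?S. cycle_sparse (2 * h) g A \<and> cycle_sparse l 1 A}"
  have fin: "finite ?S" by (rule finite_signed_biregular)
  have GS: "G \<subseteq> ?S" by (auto simp: G_def)
  have fc: "flip_closed m n G" by (auto simp: flip_closed_def G_def cycle_sparse_flip intro: flip_signed_biregular)
  have "real (card {A \<in> G. outlier s t \<rho> A}) \<le> card G * (exp 3 * m * \<Gamma> ^ Z / (\<rho> ^ j * (\<rho> - 1))\<^sup>2)"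
  proof (rule outlier_fraction[OF GS fc st rho h(1)])
    fix A assume "A \<in> G"
    then show "real (card (bipartite_bounded.closed_walks (edge A) h (2 * h) (Inl ` {..<m})))
       \<le> exp 3 * m * (sqrt ((real s - 1) * (real t - 1)) ^ h * \<Gamma> ^ Z)"
      by (intro closed_count_sparse[OF _ st _ h(2,3) _ _ le Z]) (use h in \<open>auto simp: G_def\<close>)
  qed
  also have "\<dots> \<le> card ?S * (exp 3 * m * \<Gamma> ^ Z / (\<rho> ^ j * (\<rho> - 1))\<^sup>2)"
    using card_mono[OF fin GS] G0 by (intro mult_right_mono) auto
  finally have 1: "real (card {A \<in> G. outlier s t \<rho> A}) \<le> card ?S * (exp 3 * m * \<Gamma> ^ Z / (\<rho> ^ j * (\<rho> - 1))\<^sup>2)" .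
  have "{A \<in> ?S. outlier s t \<rho> A} \<subseteq> {A \<in> G. outlier s t \<rho> A} \<union> ({A \<in> ?S. \<not> cycle_sparse (2 * h) g A} \<union> {A \<in> ?S. \<not> cycle_sparse l 1 A})"
    by (auto simp: G_def)
  then have "card {A \<in> ?S. outlier s t \<rho> A} \<le> card ({A \<in> G. outlier s t \<rho> A} \<union> ({A \<in> ?S. \<not> cycle_sparse (2 * h) g A} \<union> {A \<in> ?S. \<not> cycle_sparse l 1 A}))"
    by (rule card_mono[rotated]) (use fin finite_subset[OF GS fin] in simp)
  also have "\<dots> \<le> card {A \<in> G. outlier s t \<rho> A} + (card {A \<in> ?S. \<not> cycle_sparse (2 * h) g A} + card {A \<in> ?S. \<not> cycle_sparse l 1 A})"
    by (intro order_trans[OF card_Un_le] add_mono order_refl)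
  finally show ?thesis using 1 by linarith
qed

text \<open>All parameters are powers of \<open>\<mu> = (ln n)^(1/4)\<close>: the half length is \<open>2 c0 \<mu>^4\<close>, the windows have
  length \<open>2 \<mu>^2\<close>, at most \<open>\<mu>\<close> independent cycles are allowed, and the two regimes for \<open>s\<close> meet at \<open>\<mu>^100\<close>.\<close>
lemma outlier_rare_scale:
  fixes \<alpha> \<rho> \<eta> :: real
  assumes al: "0 < \<alpha>" "\<alpha> < 1" and rho: "1 < \<rho>" and eta: "0 < \<eta>"
  shows "\<exists>\<mu>0. \<forall>\<mu>\<ge>\<mu>0. \<forall>n m s t. real m = \<alpha> * n \<longrightarrow> real t = \<alpha> * s \<longrightarrow> 3 \<le> t \<longrightarrow>
    0 < n \<longrightarrow> (real \<mu> - 1) ^ 4 \<le> ln n \<longrightarrow> ln n \<le> real \<mu> ^ 4 \<longrightarrow>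
    real (card {A \<in> signed_biregular m n s t. outlier s t \<rho> A}) \<le> 3 * \<eta> * card (signed_biregular m n s t)"
proof -
  \<comment> \<open>The growth exponent 2 c0 ln \<rho> must reach 3, three times what the number of
    rows consumes; the summand 2 keeps \<open>j = c0 * \<mu> ^ 4 - 2\<close> from being
    truncated.\<close>
  define c0 where "c0 = 2 + nat \<lceil>3 / (2 * ln \<rho>)\<rceil>"
  have lr: "0 < ln \<rho>" using rho by simp
  have c0: "2 \<le> c0" "3 \<le> 2 * real c0 * ln \<rho>"
  proof -
    show "2 \<le> c0" by (simp add: c0_def)
    have "3 / (2 * ln \<rho>) \<le> real c0" unfolding c0_def by linarith
    then show "3 \<le> 2 * real c0 * ln \<rho>" using lr by (simp add: field_simps)
  qed
  \<comment> \<open>128 = 2 * 4^3: the branching ratio is at most 2 / \<alpha>, and the walks have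
    length 2 h = 4 c0 \<mu>^4.\<close>
  define C where "C = 128 * real c0 ^ 3 / \<alpha>"
  \<comment> \<open>The correction from \<open>j + 2 = c0 * \<mu> ^ 4\<close> and from the factor
    (\<rho> - 1)^2.\<close>
  define D where "D = 4 * ln \<rho> - 2 * ln (\<rho> - 1)"
  have C0: "0 < C" using c0 al by (simp add: C_def)
  have c0p: "0 < real c0" using c0 by simp
  have "eventually (\<lambda>x::real. 3 + x^4 + (2*x + 6 + 2*real c0*x\<^sup>2*(2*x+4)) * ln (C * x^12) + D - 3*x^4 \<le> ln \<eta> \<and>
    x * (ln 2 + 100 * ln x - (x-1)^4) + (4*real c0*x^4+1) * ln (4*x^100 + 4*real c0*x^4+1) \<le> ln \<eta> \<and>
    (ln 2 + 100 * ln x - (x-1)^4) + (2*x\<^sup>2+1) * ln (4*x^100 + 2*x\<^sup>2+1) \<le> ln \<eta> \<and>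
    (C * x^12)^8 \<le> \<alpha> / 2 * x^100 \<and> 4*x^100 + 8*real c0*x^4 \<le> \<alpha> * exp ((x-1)^4)) at_top"
    by (intro eventually_conj main_term_asymp sparse_term1_asymp sparse_term2_asymp side_asymp(1)[OF C0 c0p al(1)] side_asymp(2)[OF C0] C0 c0p eta al)
  then obtain X where X: "\<And>x. X \<le> x \<Longrightarrow> 3 + x^4 + (2*x + 6 + 2*real c0*x\<^sup>2*(2*x+4)) * ln (C * x^12) + D - 3*x^4 \<le> ln \<eta>"
    "\<And>x. X \<le> x \<Longrightarrow> x * (ln 2 + 100 * ln x - (x-1)^4) + (4*real c0*x^4+1) * ln (4*x^100 + 4*real c0*x^4+1) \<le> ln \<eta>"
    "\<And>x. X \<le> x \<Longrightarrow> (ln 2 + 100 * ln x - (x-1)^4) + (2*x\<^sup>2+1) * ln (4*x^100 + 2*x\<^sup>2+1) \<le> ln \<eta>"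
    "\<And>x. X \<le> x \<Longrightarrow> (C * x^12)^8 \<le> \<alpha> / 2 * x^100"
    "\<And>x. X \<le> x \<Longrightarrow> 4*x^100 + 8*real c0*x^4 \<le> \<alpha> * exp ((x-1)^4)"
    unfolding eventually_at_top_linorder by blast
  show ?thesis
  proof (intro exI[of _ "max 1 (nat \<lceil>X\<rceil>)"] allI impI)
    fix \<mu> n m s t :: nat
    assume mu: "max 1 (nat \<lceil>X\<rceil>) \<le> \<mu>" and mn: "real m = \<alpha> * n" and ts: "real t = \<alpha> * s" and t3: "3 \<le> t"
      and n0: "0 < n" and lo: "(real \<mu> - 1) ^ 4 \<le> ln n" and hi: "ln n \<le> real \<mu> ^ 4"
    define x where "x = real \<mu>"
    have x1: "1 \<le> x" "X \<le> x" "1 \<le> \<mu>" using mu unfolding x_def by linarith+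
    have np: "0 < real n" using n0 by simp
    have nlo: "exp ((x - 1) ^ 4) \<le> n" using lo np unfolding x_def by (simp add: ln_ge_iff)
    have nhi: "real n \<le> exp (x ^ 4)" using hi np unfolding x_def by (metis exp_le_cancel_iff exp_ln)
    have tles: "t \<le> s"
    proof -
      have "real t \<le> 1 * real s" unfolding ts using al by (intro mult_right_mono) auto
      then show ?thesis by simp
    qed
    have mlen: "real m \<le> n" unfolding mn using al np by simp
    have m0: "0 < m" using mn al np by (metis mult_pos_pos of_nat_0_less_iff)
    have st: "2 \<le> t" "t \<le> s" using t3 tles by auto
    have s0: "0 < s" using st by simp
    define j where "j = c0 * \<mu> ^ 4 - 2"
    define h where "h = 2 * (j + 2)"
    have mu4: "1 \<le> \<mu> ^ 4" using x1 by simp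
    have "2 * 1 \<le> c0 * \<mu> ^ 4" by (rule mult_le_mono[OF c0(1) mu4])
    then have j2: "j + 2 = c0 * \<mu> ^ 4" by (simp add: j_def)
    have h': "h = 2 * c0 * \<mu> ^ 4" unfolding h_def j2 by simp
    define l where "l = 2 * \<mu>\<^sup>2"
    have l0: "0 < l" using x1 by (simp add: l_def)
    have hl: "h = l * (c0 * \<mu>\<^sup>2)" by (simp add: h' l_def power2_eq_square power4_eq_xxxx)
    have Ldl: "2 * h div l = 2 * c0 * \<mu>\<^sup>2"
    proof -
      have "2 * h = (2 * c0 * \<mu>\<^sup>2) * l" by (simp add: hl)
      then show ?thesis using l0 by simp
    qed
    define Z where "Z = 2 * \<mu> + 6 + (2 * h) div l * (2 * \<mu> + 4)"
    have Zx: "real Z = 2*x + 6 + 2*real c0*x\<^sup>2*(2*x+4)" by (simp add: Z_def Ldl x_def)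
    define \<Gamma> where "\<Gamma> = C * x ^ 12"
    have G0: "0 < \<Gamma>" using C0 x1 by (simp add: \<Gamma>_def)
    have rp: "1 \<le> real t - 1" using t3 by simp
    have tr: "2 / 3 * real t \<le> real t - 1" using t3 by simp
    have gle: "cost_base s t (2 * h) \<le> \<Gamma>"
    proof -
      have ra: "1 \<le> (real s - 1) / (real t - 1)" using st rp by (simp add: pos_le_divide_eq)
      have "sqrt ((real s - 1) / (real t - 1)) \<le> (real s - 1) / (real t - 1)"
      proof (rule real_le_lsqrt)
        show "0 \<le> (real s - 1) / (real t - 1)" using ra by linarith
        show "(real s - 1) / (real t - 1) \<le> ((real s - 1) / (real t - 1))\<^sup>2"
          using power_increasing[OF _ ra, of 1 2] by simp
      qed
      also have "\<dots> \<le> 2 / \<alpha>"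
      proof -
        have "\<alpha> * (real s - 1) \<le> real t" using ts al by (simp add: algebra_simps)
        also have "\<dots> \<le> 2 * (real t - 1)" using t3 by simp
        finally show ?thesis using rp al by (simp add: pos_divide_le_eq pos_le_divide_eq mult.commute)
      qed
      finally have "cost_base s t (2 * h) \<le> 2 / \<alpha> * real (2 * h) ^ 3" unfolding cost_base_def by (intro mult_right_mono) auto
      also have "\<dots> = \<Gamma>"
        by (simp add: \<Gamma>_def C_def h' x_def power_mult_distrib flip: power_mult)
      finally show ?thesis .
    qed
    let ?N = "real (card (signed_biregular m n s t))"
    have main: "exp 3 * m * \<Gamma> ^ Z / (\<rho> ^ j * (\<rho> - 1))\<^sup>2 \<le> \<eta>"
    proof -
      have r1: "\<Gamma> ^ Z = exp (real Z * ln \<Gamma>)" using G0 by (simp add: exp_of_nat_mult)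
      have "(\<rho> ^ j * (\<rho> - 1))\<^sup>2 = exp (2 * real j * ln \<rho> + 2 * ln (\<rho> - 1))"
      proof -
        have "\<rho> ^ j = exp (real j * ln \<rho>)" using rho by (simp add: exp_of_nat_mult)
        moreover have "\<rho> - 1 = exp (ln (\<rho> - 1))" using rho by simp
        ultimately have "(\<rho> ^ j * (\<rho> - 1))\<^sup>2 = (exp (real j * ln \<rho> + ln (\<rho> - 1)))\<^sup>2" by (simp add: exp_add)
        also have "\<dots> = exp (2 * (real j * ln \<rho> + ln (\<rho> - 1)))" by (metis exp_double)
        finally show ?thesis by (simp add: algebra_simps)
      qed
      moreover have "exp 3 * m * \<Gamma> ^ Z \<le> exp (3 + x ^ 4 + real Z * ln \<Gamma>)"
      proof -
        have "real m \<le> exp (x ^ 4)" using mlen nhi by linarith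
        then have "exp 3 * m * \<Gamma> ^ Z \<le> exp 3 * exp (x ^ 4) * \<Gamma> ^ Z" using G0 by (intro mult_right_mono mult_left_mono) auto
        then show ?thesis by (simp add: r1 exp_add)
      qed
      ultimately have "exp 3 * m * \<Gamma> ^ Z / (\<rho> ^ j * (\<rho> - 1))\<^sup>2
        \<le> exp (3 + x ^ 4 + real Z * ln \<Gamma>) / exp (2 * real j * ln \<rho> + 2 * ln (\<rho> - 1))"
        by (simp add: divide_right_mono)
      also have "\<dots> = exp (3 + x ^ 4 + real Z * ln \<Gamma> - (2 * real j * ln \<rho> + 2 * ln (\<rho> - 1)))" by (simp add: exp_diff)
      also have "\<dots> \<le> exp (ln \<eta>)"
      proof (subst exp_le_cancel_iff)
        have rj: "real j = c0 * x ^ 4 - 2" using arg_cong[OF j2, of real] by (simp add: x_def)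
        have "2 * real j * ln \<rho> = (2 * real c0 * ln \<rho>) * x ^ 4 - 4 * ln \<rho>" unfolding rj by (simp add: algebra_simps)
        moreover have "3 * x ^ 4 \<le> (2 * c0 * ln \<rho>) * x ^ 4" using c0(2) by (intro mult_right_mono) auto
        ultimately show "3 + x ^ 4 + real Z * ln \<Gamma> - (2 * real j * ln \<rho> + 2 * ln (\<rho> - 1)) \<le> ln \<eta>"
          using X(1)[OF x1(2)] unfolding Zx \<Gamma>_def D_def by linarith
      qed
      finally show ?thesis using eta by simp
    qed
    show "real (card {A \<in> signed_biregular m n s t. outlier s t \<rho> A}) \<le> 3 * \<eta> * card (signed_biregular m n s t)"
    proof (cases "x ^ 100 \<le> real s")
      case True
      have "cost_base s t (2 * h) ^ 8 \<le> \<Gamma> ^ 8" using gle st by (intro power_mono) (auto simp: cost_base_def)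
      also have "\<dots> \<le> \<alpha> / 2 * x ^ 100" using X(4)[OF x1(2)] by (simp add: \<Gamma>_def)
      also have "\<dots> \<le> \<alpha> / 2 * real s" using True al by (intro mult_left_mono) auto
      also have "\<dots> = real t / 2" using ts by simp
      also have "\<dots> \<le> real t - 1" using t3 by simp
      also have "\<dots> \<le> mean_branching s t" unfolding mean_branching_def
      proof (rule real_le_rsqrt)
        show "(real t - 1)\<^sup>2 \<le> (real s - 1) * (real t - 1)" unfolding power2_eq_square
          using st by (intro mult_right_mono) auto
      qed
      finally have big: "cost_base s t (2 * h) ^ 8 \<le> mean_branching s t" .
      have "real (card {A \<in> signed_biregular m n s t. outlier s t \<rho> A}) \<le> ?N * (exp 3 * m * \<Gamma> ^ Z / (\<rho> ^ j * (\<rho> - 1))\<^sup>2)"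
        by (rule outliers_dense[OF st rho h_def big gle]) (simp add: Z_def)
      also have "\<dots> \<le> ?N * \<eta>" using main by (intro mult_left_mono) auto
      also have "\<dots> \<le> ?N * (3 * \<eta>)" using eta by (intro mult_left_mono) auto
      finally show ?thesis by (simp add: mult.commute)
    next
      case False
      then have s100: "real s \<le> x ^ 100" by simp
      have mlo: "4 * x ^ 100 + 8 * real c0 * x ^ 4 \<le> m"
      proof -
        have "\<alpha> * exp ((x - 1) ^ 4) \<le> \<alpha> * n" using nlo al by (intro mult_left_mono) auto
        then show ?thesis using X(5)[OF x1(2)] mn by linarith
      qed
      have t100: "real t \<le> x ^ 100" using s100 tles by linarith
      have hx: "real h = 2 * real c0 * x ^ 4" by (simp add: h' x_def)
      have tm: "4 * t + 4 * h \<le> m"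
      proof -
        have "real (4 * t + 4 * h) \<le> real m" using mlo t100 hx by simp
        then show ?thesis by (simp only: of_nat_le_iff)
      qed
      have lh: "l \<le> h" unfolding hl using c0 x1 by simp
      have bigL: "2 * (2 * s * t + k) \<le> m * s" if "k \<le> 2 * h" for k
      proof -
        have "2 * (2 * s * t + k) \<le> 2 * (2 * s * t + 2 * h)" using that by simp
        also have "\<dots> \<le> s * (4 * t) + s * (4 * h)" using s0 by (simp add: mult_ac)
        also have "\<dots> = s * (4 * t + 4 * h)" by (simp add: distrib_left)
        also have "\<dots> \<le> s * m" using tm by (intro mult_le_mono2)
        finally show ?thesis by (simp add: mult.commute)
      qed
      have th: "2 * t \<le> m" using tm by simp
      have theta: "2 * real t / m = 2 * s / n" unfolding mn ts using al np by (simp add: field_simps)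
      have base: "real (m + n) * (2 * real t / m) \<le> 4 * x ^ 100"
      proof -
        have "real (m + n) * (2 * s / n) \<le> (2 * n) * (2 * s / n)" using mlen by (intro mult_right_mono) auto
        also have "\<dots> = 4 * s" using np by simp
        finally show ?thesis using s100 unfolding theta by simp
      qed
      have th_exp: "2 * real t / m \<le> exp (ln 2 + 100 * ln x - (x - 1) ^ 4)"
      proof -
        have "2 * real t / m \<le> 2 * x ^ 100 / exp ((x - 1) ^ 4)" unfolding theta
          using s100 nlo x1 by (intro frac_le) auto
        also have "\<dots> = exp (ln 2 + 100 * ln x - (x - 1) ^ 4)"
        proof -
          have "exp (100 * ln x) = x ^ 100" using x1 exp_of_nat_mult[of 100 "ln x"] by simp
          then show ?thesis by (simp add: exp_diff exp_add)
        qed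
        finally show ?thesis .
      qed
      \<comment> \<open>Used for full walks with \<open>\<mu>\<close> cycles and for windows with
        one; together with the main term this makes up the three shares of \<eta>.\<close>
      have fail: "real (card {A \<in> signed_biregular m n s t. \<not> cycle_sparse k g A}) \<le> \<eta> * ?N"
        if k: "k \<le> 2 * h" "0 < k" and as: "g * (ln 2 + 100 * ln x - (x-1)^4) + (real k + 1) * ln (4*x^100 + real k + 1) \<le> ln \<eta>" for k g
      proof -
        have p: "0 < 4 * x ^ 100 + real k + 1" using x1 by (intro add_nonneg_pos) auto
        have "real (card {A \<in> signed_biregular m n s t. \<not> cycle_sparse k g A})
          \<le> (2 * real t / m) ^ g * (real (m + n) * (2 * real t / m) + real (k + 1)) ^ (k + 1) * ?N"
          by (rule cycle_sparse_fails_bound[OF bigL[OF k(1)] s0 m0 k(2) th])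
        also have "\<dots> \<le> exp (ln 2 + 100 * ln x - (x - 1) ^ 4) ^ g * (4 * x ^ 100 + real k + 1) ^ (k + 1) * ?N"
          using th_exp base by (intro mult_right_mono mult_mono power_mono) auto
        also have "exp (ln 2 + 100 * ln x - (x - 1) ^ 4) ^ g = exp (g * (ln 2 + 100 * ln x - (x - 1) ^ 4))"
          by (simp add: exp_of_nat_mult)
        also have "(4 * x ^ 100 + real k + 1) ^ (k + 1) = exp ((real k + 1) * ln (4*x^100 + real k + 1))"
          using exp_of_nat_mult[of "k + 1" "ln (4*x^100 + real k + 1)"] p by (simp add: add.commute)
        also have "exp (g * (ln 2 + 100 * ln x - (x - 1) ^ 4)) * exp ((real k + 1) * ln (4*x^100 + real k + 1)) * ?N
          = exp (g * (ln 2 + 100 * ln x - (x - 1) ^ 4) + (real k + 1) * ln (4*x^100 + real k + 1)) * ?N" by (simp add: exp_add)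
        also have "\<dots> \<le> exp (ln \<eta>) * ?N" using as by (intro mult_right_mono) auto
        finally show ?thesis using eta by simp
      qed
      have f1: "real (card {A \<in> signed_biregular m n s t. \<not> cycle_sparse (2 * h) \<mu> A}) \<le> \<eta> * ?N"
        by (rule fail) (use X(2)[OF x1(2)] hx l0 lh in \<open>auto simp: x_def[symmetric] mult.assoc\<close>)
      have lx: "real l = 2 * x\<^sup>2" by (simp add: l_def x_def)
      have f2: "real (card {A \<in> signed_biregular m n s t. \<not> cycle_sparse l 1 A}) \<le> \<eta> * ?N"
        by (rule fail) (use X(3)[OF x1(2)] lx l0 lh in auto)
      have "real (card {A \<in> signed_biregular m n s t. outlier s t \<rho> A}) \<le> ?N * (exp 3 * m * \<Gamma> ^ Z / (\<rho> ^ j * (\<rho> - 1))\<^sup>2)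
         + card {A \<in> signed_biregular m n s t. \<not> cycle_sparse (2 * h) \<mu> A} + card {A \<in> signed_biregular m n s t. \<not> cycle_sparse l 1 A}"
        by (rule outliers_sparse[OF st rho h_def _ l0 gle _ Z_def]) (use hl G0 in auto)
      moreover have "?N * (exp 3 * m * \<Gamma> ^ Z / (\<rho> ^ j * (\<rho> - 1))\<^sup>2) \<le> ?N * \<eta>" using main by (intro mult_left_mono) auto
      ultimately show ?thesis using f1 f2 by (simp add: mult.commute)
    qed
  qed
qed

section \<open>Location of the singular values\<close>

lemma outlier_rare:
  fixes \<alpha> \<rho> \<eta> :: real
  assumes al: "0 < \<alpha>" "\<alpha> < 1" and rho: "1 < \<rho>" and eta: "0 < \<eta>"
  shows "\<exists>n0. \<forall>n\<ge>n0. \<forall>m s t. real m = \<alpha> * n \<longrightarrow> real t = \<alpha> * s \<longrightarrow> 3 \<le> t \<longrightarrow>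
    real (card {A \<in> signed_biregular m n s t. outlier s t \<rho> A}) \<le> \<eta> * card (signed_biregular m n s t)"
proof -
  have eta3: "0 < \<eta> / 3" using eta by simp
  obtain \<mu>0 where M': "\<forall>\<mu>\<ge>\<mu>0. \<forall>n m s t. real m = \<alpha> * n \<longrightarrow> real t = \<alpha> * s \<longrightarrow> 3 \<le> t \<longrightarrow>
    0 < n \<longrightarrow> (real \<mu> - 1) ^ 4 \<le> ln n \<longrightarrow> ln n \<le> real \<mu> ^ 4 \<longrightarrow>
    real (card {A \<in> signed_biregular m n s t. outlier s t \<rho> A}) \<le> 3 * (\<eta> / 3) * card (signed_biregular m n s t)"
    using outlier_rare_scale[OF al rho eta3] by blast
  show ?thesis
  proof (intro exI[of _ "nat \<lceil>exp (real (\<mu>0 + 1) ^ 4)\<rceil>"] allI impI)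
    fix n m s t
    assume n: "nat \<lceil>exp (real (\<mu>0 + 1) ^ 4)\<rceil> \<le> n" and mn: "real m = \<alpha> * real n" and ts: "real t = \<alpha> * real s" and t3: "3 \<le> t"
    have en: "exp (real (\<mu>0 + 1) ^ 4) \<le> n" using n by linarith
    then have np: "0 < real n" by (meson exp_gt_zero less_le_trans)
    have ln: "real (\<mu>0 + 1) ^ 4 \<le> ln n" using en np by (simp add: ln_ge_iff)
    define y where "y = root 4 (ln n)"
    have "0 \<le> ln n" using ln by (meson order_trans zero_le_power of_nat_0_le_iff)
    then have y4: "y ^ 4 = ln n" "0 \<le> y" by (simp_all add: y_def)
    have ymu: "real (\<mu>0 + 1) \<le> y" using ln y4 by (metis power_mono_iff of_nat_0_le_iff zero_less_numeral)
    \<comment> \<open>Rounding up leaves ln n between (\<mu> - 1)^4 and \<mu>^4, whence the x - 1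
      wherever n is bounded from below.\<close>
    define \<mu> where "\<mu> = nat \<lceil>y\<rceil>"
    have mu: "y \<le> \<mu>" "real \<mu> < y + 1" using y4(2) unfolding \<mu>_def by linarith+
    have "\<mu>0 \<le> \<mu>" using mu ymu by linarith
    moreover have "(real \<mu> - 1) ^ 4 \<le> ln n" unfolding y4(1)[symmetric]
      by (rule power_mono) (use mu ymu in linarith)+
    moreover have "ln n \<le> real \<mu> ^ 4" unfolding y4(1)[symmetric] by (rule power_mono) (use mu y4 in auto)
    ultimately show "real (card {A \<in> signed_biregular m n s t. outlier s t \<rho> A}) \<le> \<eta> * card (signed_biregular m n s t)"
      using M'[rule_format, of \<mu> m n t s] mn ts t3 np by simp
  qed
qed

text \<open>Put a = sqrt (s - 1) and b = sqrt (t - 1), so that K deviates from a^2 + b^2 by at most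
  (2 + \<eta>) a b. At the upper end \<eta> \<le> \<epsilon> suffices. At the lower end the square
  has the extra term (2 \<epsilon> + \<epsilon>^2) b^2; since b \<le> sqrt \<alpha> a, it fits below
  (2 \<epsilon> - \<eta>) a b, which after cancellation is the assumption on \<epsilon>.\<close>

lemma singular_values_in_interval:
  fixes \<alpha> \<epsilon> :: real
  assumes al: "0 < \<alpha>" "\<alpha> < 1" and A: "A \<in> signed_biregular m n s t" and mn: "m \<le> n" and ts: "real t = \<alpha> * s" and t2: "2 \<le> t"
    and eps: "0 < \<epsilon>" "\<epsilon> * sqrt \<alpha> \<le> 1 - sqrt \<alpha>"
    and rho: "\<rho> + 1 / \<rho> \<le> 2 + \<epsilon> * (1 - sqrt \<alpha>)" and no: "\<not> outlier s t \<rho> A"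
  shows "singular_values A \<subseteq> {sqrt (real s - 1) - (1 + \<epsilon>) * sqrt (real t - 1) .. sqrt (real s - 1) + (1 + \<epsilon>) * sqrt (real t - 1)}"
proof
  fix \<sigma> assume "\<sigma> \<in> singular_values A"
  then obtain K where K: "eigenvalue (A * transpose_mat A) K" "\<sigma> = sqrt K"
    using signed_biregularD(2,3)[OF A] mn by (auto simp: singular_values_def)
  have K0: "0 \<le> K" by (rule eigenvalue_gram_nonneg[OF signed_biregularD(1)[OF A] K(1)])
  define a b where "a = sqrt (real s - 1)" and "b = sqrt (real t - 1)"
  have sa: "sqrt \<alpha> < 1" "0 < sqrt \<alpha>" using al by auto
  have tles: "real t \<le> real s" unfolding ts using al by (intro mult_left_le_one_le) auto
  have sq: "a\<^sup>2 = real s - 1" "b\<^sup>2 = real t - 1" "0 \<le> a" "0 \<le> b" using t2 tles by (auto simp: a_def b_def)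
  have w: "sqrt ((real s - 1) * (real t - 1)) = a * b" by (simp add: a_def b_def real_sqrt_mult)
  have bsa: "b \<le> sqrt \<alpha> * a"
  proof -
    have "real t - 1 \<le> \<alpha> * (real s - 1)" using ts al by (simp add: algebra_simps)
    then show ?thesis unfolding a_def b_def real_sqrt_mult[symmetric] by simp
  qed
  define \<eta> where "\<eta> = \<epsilon> * (1 - sqrt \<alpha>)"
  have "\<not> (\<rho> + 1 / \<rho>) * (a * b) \<le> \<bar>K - a\<^sup>2 - b\<^sup>2\<bar>" using no K(1) unfolding outlier_def w sq by blast
  then have "\<bar>K - a\<^sup>2 - b\<^sup>2\<bar> \<le> (\<rho> + 1 / \<rho>) * (a * b)" by simp
  also have "\<dots> \<le> (2 + \<eta>) * (a * b)" using rho sq by (intro mult_right_mono) (auto simp: \<eta>_def)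
  finally have dev: "\<bar>K - a\<^sup>2 - b\<^sup>2\<bar> \<le> (2 + \<eta>) * (a * b)" .
  have ab0: "0 \<le> a * b" using sq by simp
  have upper: "sqrt K \<le> a + (1 + \<epsilon>) * b"
  proof (rule real_le_lsqrt)
    show "0 \<le> a + (1 + \<epsilon>) * b" using sq eps by simp
    have "\<eta> \<le> \<epsilon>" unfolding \<eta>_def using eps sa by (simp add: mult_le_cancel_left1 mult_left_le)
    then have "(2 + \<eta>) * (a * b) \<le> (2 + 2 * \<epsilon>) * (a * b)" using ab0 eps by (intro mult_right_mono) auto
    moreover have "b\<^sup>2 \<le> (1 + \<epsilon>)\<^sup>2 * b\<^sup>2"
      using eps by (simp add: mult_le_cancel_right1 one_le_power)
    moreover have "(a + (1 + \<epsilon>) * b)\<^sup>2 = a\<^sup>2 + (1 + \<epsilon>)\<^sup>2 * b\<^sup>2 + (2 + 2 * \<epsilon>) * (a * b)" by (simp add: power2_eq_square algebra_simps)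
    ultimately show "K \<le> (a + (1 + \<epsilon>) * b)\<^sup>2" using dev by linarith
  qed
  have lower: "a - (1 + \<epsilon>) * b \<le> sqrt K"
  proof (cases "0 \<le> a - (1 + \<epsilon>) * b")
    case True
    show ?thesis
    proof (rule real_le_rsqrt)
      have "b * b \<le> (sqrt \<alpha> * a) * b" using bsa sq by (intro mult_right_mono) auto
      then have "(2 * \<epsilon> + \<epsilon>\<^sup>2) * b\<^sup>2 \<le> (2 * \<epsilon> + \<epsilon>\<^sup>2) * (sqrt \<alpha> * (a * b))"
        using eps by (intro mult_left_mono) (auto simp: power2_eq_square mult.assoc)
      also have "\<dots> = ((2 * \<epsilon> + \<epsilon>\<^sup>2) * sqrt \<alpha>) * (a * b)" by simp
      also have "\<dots> \<le> (2 * \<epsilon> - \<eta>) * (a * b)"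
      proof (rule mult_right_mono[OF _ ab0])
        have "\<epsilon> * (\<epsilon> * sqrt \<alpha>) \<le> \<epsilon> * (1 - sqrt \<alpha>)" using eps by (intro mult_left_mono) auto
        then show "(2 * \<epsilon> + \<epsilon>\<^sup>2) * sqrt \<alpha> \<le> 2 * \<epsilon> - \<eta>" by (simp add: \<eta>_def power2_eq_square algebra_simps)
      qed
      finally have "(2 * \<epsilon> + \<epsilon>\<^sup>2) * b\<^sup>2 \<le> (2 * \<epsilon> - \<eta>) * (a * b)" .
      moreover have "(a - (1 + \<epsilon>) * b)\<^sup>2 = a\<^sup>2 + b\<^sup>2 + (2 * \<epsilon> + \<epsilon>\<^sup>2) * b\<^sup>2 - (2 + 2 * \<epsilon>) * (a * b)" by (simp add: power2_eq_square algebra_simps)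
      moreover have "(2 + 2 * \<epsilon>) * (a * b) = (2 + \<eta>) * (a * b) + (2 * \<epsilon> - \<eta>) * (a * b)" by (simp add: algebra_simps)
      ultimately show "(a - (1 + \<epsilon>) * b)\<^sup>2 \<le> K" using dev by linarith
    qed
  next
    case False
    then show ?thesis using K0 real_sqrt_ge_zero[of K] by linarith
  qed
  show "\<sigma> \<in> {sqrt (real s - 1) - (1 + \<epsilon>) * sqrt (real t - 1) .. sqrt (real s - 1) + (1 + \<epsilon>) * sqrt (real t - 1)}"
    using upper lower unfolding K(2) a_def b_def by simp
qed

lemma diagonal_choice:
  fixes Q :: "nat \<Rightarrow> nat \<Rightarrow> bool"
  assumes "\<And>p. \<exists>n0. \<forall>n\<ge>n0. Q p n"
  shows "\<exists>g. filterlim g at_top sequentially \<and> eventually (\<lambda>n. Q (g n) n) sequentially"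
proof -
  obtain M where M: "\<And>p n. M p \<le> n \<Longrightarrow> Q p n" using assms by metis
  define S where "S n = {p. p \<le> n \<and> (M p \<le> n \<or> p = 0)}" for n
  have S: "finite (S n)" "0 \<in> S n" for n by (auto simp: S_def)
  define g where "g n = Max (S n)" for n
  have gS: "g n \<in> S n" for n unfolding g_def using S by (intro Max_in) auto
  have "eventually (\<lambda>n. Q (g n) n) sequentially"
  proof (rule eventually_sequentiallyI)
    fix n assume "M 0 \<le> n"
    then show "Q (g n) n" using gS[of n] M[of "g n" n] by (auto simp: S_def)
  qed
  moreover have "filterlim g at_top sequentially"
    unfolding filterlim_at_top
  proof
    fix P
    show "eventually (\<lambda>n. P \<le> g n) sequentially"
    proof (rule eventually_sequentiallyI)
      fix n assume "max P (M P) \<le> n"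
      then have "P \<in> S n" by (simp add: S_def)
      then show "P \<le> g n" unfolding g_def by (rule Max_ge[OF S(1)])
    qed
  qed
  ultimately show ?thesis by blast
qed

text \<open>\<open>N\<close> consists of admissible n, as \<alpha> n has to be an integer, and
  limits are taken along it. The bound \<open>s n \<le> n\<close> expresses that a row has only n
  places and ensures that the class is nonempty.\<close>

theorem theorem2:
  fixes \<alpha> :: real and N :: "nat set" and m s t :: "nat \<Rightarrow> nat"
  assumes "0 < \<alpha>" and "\<alpha> < 1"
    and "infinite N"
    and "\<forall>n\<in>N. real (m n) / real n = \<alpha> \<and> real (t n) / real (s n) = \<alpha> \<and> 3 \<le> t n \<and> s n \<le> n"
  shows "\<exists>\<epsilon> :: nat \<Rightarrow> real.
           (\<epsilon> \<longlongrightarrow> 0) (inf at_top (principal N)) \<and>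
           ((\<lambda>n. real (card {A \<in> signed_biregular (m n) n (s n) (t n).
                     singular_values A \<subseteq>
                       {sqrt (real (s n) - 1) - (1 + \<epsilon> n) * sqrt (real (t n) - 1) ..
                        sqrt (real (s n) - 1) + (1 + \<epsilon> n) * sqrt (real (t n) - 1)}})
                 / real (card (signed_biregular (m n) n (s n) (t n))))
             \<longlongrightarrow> 1) (inf at_top (principal N))"
proof -
  let ?S = "\<lambda>n. signed_biregular (m n) n (s n) (t n)"
  define good where "good \<epsilon> n = {A \<in> ?S n. singular_values A \<subseteq>
    {sqrt (real (s n) - 1) - (1 + \<epsilon>) * sqrt (real (t n) - 1) .. sqrt (real (s n) - 1) + (1 + \<epsilon>) * sqrt (real (t n) - 1)}}" for \<epsilon> n
  have sa: "0 < sqrt \<alpha>" "sqrt \<alpha> < 1" using assms(1,2) by auto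
  \<comment> \<open>The first entry is the constraint of \<open>singular_values_in_interval\<close>
    on \<epsilon>; the second makes the sequence tend to 0.\<close>
  define ep where "ep p = min ((1 - sqrt \<alpha>) / sqrt \<alpha>) (1 / real (Suc p))" for p
  have ep0: "0 < ep p" for p using sa by (simp add: ep_def)
  have ep1: "ep p * sqrt \<alpha> \<le> 1 - sqrt \<alpha>" for p
  proof -
    have "ep p \<le> (1 - sqrt \<alpha>) / sqrt \<alpha>" by (simp add: ep_def)
    then show ?thesis using sa by (simp add: pos_le_divide_eq)
  qed
  have fin: "finite (?S n)" for n by (rule finite_signed_biregular)
  have props: "real (m n) = \<alpha> * n" "real (t n) = \<alpha> * s n" "3 \<le> t n" "0 < card (?S n)" "m n \<le> n" if n: "n \<in> N" for n
  proof -
    have a: "real (m n) / real n = \<alpha>" "real (t n) / real (s n) = \<alpha>" "3 \<le> t n" "s n \<le> n" using assms(4) n by auto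
    have n0: "0 < n" "0 < s n" using a(1,2) assms(1) by (auto intro!: Nat.gr0I)
    show mn: "real (m n) = \<alpha> * n" using a(1) n0 by (simp add: field_simps)
    show ts: "real (t n) = \<alpha> * s n" using a(2) n0 by (simp add: field_simps)
    show "3 \<le> t n" by (rule a(3))
    have "real (m n * s n) = real (n * t n)" by (simp add: mn ts)
    then have "m n * s n = n * t n" by (simp only: of_nat_eq_iff)
    then show "0 < card (?S n)" using signed_biregular_nonempty[of "m n" "s n" n "t n"] n0 a(4) fin by (simp add: card_gt_0_iff)
    have "real (m n) \<le> 1 * real n" unfolding mn using assms(1,2) by (intro mult_right_mono) auto
    then show "m n \<le> n" by simp
  qed
  have ratio_le: "real (card (good \<epsilon> n)) / real (card (?S n)) \<le> 1" if "n \<in> N" for \<epsilon> n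
    using card_mono[OF fin[of n], of "good \<epsilon> n"] props(4)[OF that] by (simp add: good_def divide_le_eq_1)
  have "\<exists>n0. \<forall>n\<ge>n0. n \<in> N \<longrightarrow> 1 - 1 / real (Suc p) \<le> real (card (good (ep p) n)) / real (card (?S n))" for p
  proof -
    \<comment> \<open>\<rho> + 1 / \<rho> - 2 is quadratic in \<rho> - 1, hence the square
      root.\<close>
    define \<delta> where "\<delta> = sqrt (ep p * (1 - sqrt \<alpha>))"
    have d: "0 < \<delta>" "\<delta>\<^sup>2 = ep p * (1 - sqrt \<alpha>)" using ep0[of p] sa by (auto simp: \<delta>_def)
    define \<rho> where "\<rho> = 1 + \<delta>"
    have rho: "1 < \<rho>" using d by (simp add: \<rho>_def)
    have "\<rho> + 1 / \<rho> = 2 + \<delta>\<^sup>2 / \<rho>" using d by (simp add: \<rho>_def field_simps power2_eq_square)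
    also have "\<delta>\<^sup>2 / \<rho> \<le> \<delta>\<^sup>2 / 1" using rho by (intro divide_left_mono) auto
    finally have rr: "\<rho> + 1 / \<rho> \<le> 2 + ep p * (1 - sqrt \<alpha>)" using d(2) by simp
    have etap: "0 < 1 / real (Suc p)" by simp
    obtain n0 where n0: "\<forall>n\<ge>n0. \<forall>m s t. real m = \<alpha> * n \<longrightarrow> real t = \<alpha> * s \<longrightarrow> 3 \<le> t \<longrightarrow>
      real (card {A \<in> signed_biregular m n s t. outlier s t \<rho> A}) \<le> 1 / real (Suc p) * card (signed_biregular m n s t)"
      using outlier_rare[OF assms(1,2) rho etap] by blast
    show ?thesis
    proof (intro exI[of _ n0] allI impI)
      fix n assume n: "n0 \<le> n" "n \<in> N"
      note P = props[OF n(2)]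
      let ?O = "{A \<in> ?S n. outlier (s n) (t n) \<rho> A}"
      have O: "real (card ?O) \<le> 1 / real (Suc p) * card (?S n)" using n0 n(1) P(1,2,3) by blast
      have "?S n - ?O \<subseteq> good (ep p) n"
      proof
        fix A assume "A \<in> ?S n - ?O"
        then have A: "A \<in> ?S n" "\<not> outlier (s n) (t n) \<rho> A" by auto
        have "2 \<le> t n" using P(3) by simp
        then show "A \<in> good (ep p) n"
          using singular_values_in_interval[OF assms(1,2) A(1) P(5) P(2) _ ep0[of p] ep1[of p] rr A(2)] A(1)
          unfolding good_def by blast
      qed
      then have "card (?S n - ?O) \<le> card (good (ep p) n)" by (intro card_mono) (use fin in \<open>auto simp: good_def\<close>)
      moreover have "card (?S n - ?O) = card (?S n) - card ?O" by (rule card_Diff_subset) (use fin in auto)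
      moreover have "card ?O \<le> card (?S n)" by (rule card_mono[OF fin]) auto
      ultimately have "real (card (?S n)) - 1 / real (Suc p) * card (?S n) \<le> real (card (good (ep p) n))" using O by linarith
      then have "(1 - 1 / real (Suc p)) * card (?S n) \<le> real (card (good (ep p) n))" by (simp add: left_diff_distrib)
      then show "1 - 1 / real (Suc p) \<le> real (card (good (ep p) n)) / real (card (?S n))"
        using P(4) by (simp add: pos_le_divide_eq)
    qed
  qed
  then obtain g where g: "filterlim g at_top sequentially"
    "eventually (\<lambda>n. n \<in> N \<longrightarrow> 1 - 1 / real (Suc (g n)) \<le> real (card (good (ep (g n)) n)) / real (card (?S n))) sequentially"
    using diagonal_choice[of "\<lambda>p n. n \<in> N \<longrightarrow> 1 - 1 / real (Suc p) \<le> real (card (good (ep p) n)) / real (card (?S n))"] by blast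
  have inv0: "(\<lambda>p. 1 / real (Suc p)) \<longlonglongrightarrow> 0" using LIMSEQ_inverse_real_of_nat by (simp add: inverse_eq_divide)
  have ep_lim: "ep \<longlonglongrightarrow> 0"
  proof (rule tendsto_sandwich[OF _ _ tendsto_const inv0])
    show "eventually (\<lambda>p. 0 \<le> ep p) sequentially" using ep0 by (simp add: less_imp_le)
    show "eventually (\<lambda>p. ep p \<le> 1 / real (Suc p)) sequentially" by (simp add: ep_def)
  qed
  have lo: "(\<lambda>n. 1 - 1 / real (Suc (g n))) \<longlonglongrightarrow> 1 - 0"
    by (intro tendsto_diff tendsto_const filterlim_compose[OF inv0 g(1)])
  show ?thesis
  proof (intro exI[of _ "\<lambda>n. ep (g n)"] conjI)
    show "((\<lambda>n. ep (g n)) \<longlongrightarrow> 0) (inf at_top (principal N))"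
      by (rule tendsto_mono[OF inf_le1 filterlim_compose[OF ep_lim g(1)]])
    have "((\<lambda>n. real (card (good (ep (g n)) n)) / real (card (?S n))) \<longlongrightarrow> 1) (inf at_top (principal N))"
    proof (rule tendsto_sandwich)
      show "((\<lambda>n. 1 - 1 / real (Suc (g n))) \<longlongrightarrow> 1) (inf at_top (principal N))"
        using tendsto_mono[OF inf_le1 lo] by simp
      show "((\<lambda>_. 1) \<longlongrightarrow> (1::real)) (inf at_top (principal N))" by (rule tendsto_const)
      show "eventually (\<lambda>n. 1 - 1 / real (Suc (g n)) \<le> real (card (good (ep (g n)) n)) / real (card (?S n))) (inf at_top (principal N))"
        unfolding eventually_inf_principal by (rule g(2))
      show "eventually (\<lambda>n. real (card (good (ep (g n)) n)) / real (card (?S n)) \<le> 1) (inf at_top (principal N))"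
        unfolding eventually_inf_principal using ratio_le by (simp add: eventuallyI)
    qed
    then show "((\<lambda>n. real (card {A \<in> ?S n. singular_values A \<subseteq>
         {sqrt (real (s n) - 1) - (1 + ep (g n)) * sqrt (real (t n) - 1) ..
          sqrt (real (s n) - 1) + (1 + ep (g n)) * sqrt (real (t n) - 1)}})
       / real (card (?S n))) \<longlongrightarrow> 1) (inf at_top (principal N))"
      unfolding good_def .
  qed
qed

end
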